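(* Let $P\subset\mathbb{R}^n$ be an $n$-dimensional convex body of unit volume, let $(\mu_0,\phi_0)$ be a weighted measure on $\mathbb{R}^n$ and fix $0<\beta<\infty$. If $\mu_0=\rho_0\,dx$ for a strictly positive function $\rho_0$ (so that $X=\operatorname{supp}\mu_0=\mathbb{R}^n$), then the functions $$\phi^{(N)}_\beta(x):=\frac1\beta\log\int_{X^{N-1}}\frac{1}{Z_N}\big(\mathrm{Per}_k(x,x_2,\dots,x_N)\big)^{\beta/k}\,(e^{-\beta\phi_0}\mu_0)^{\otimes (N-1)}$$ are such that $\nabla\phi_\beta^{(N)}$ maps $\mathbb{R}^n$ into $P$, and, as $N=N_k\to\infty$, they converge locally uniformly to the unique solution of the second boundary value problem with target $P$ for the Monge–Ampère equation $$MA(\phi)=e^{\beta(\phi-\phi_0)}\mu_0 .$$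
   Context: $\phi_P(x)=\sup_{p\in P}x\cdot p$. Weighted measure: $\mu_0$ is a Borel measure on $\mathbb{R}^n$ with support $X$; $\phi_0$ is a continuous function on $X$ with $\phi_0-\phi_P\to\infty$ as $|x|\to\infty$ in $X$; and $e^{b(\phi_P-\phi_0)}\mu_0$ has finite total mass for every $b>0$. For a positive integer $k$, let $p_1,\dots,p_N$ ($N=N_k$) be the points of $kP\cap\mathbb{Z}^n$ and $\mathrm{Per}_k(x_1,\dots,x_N)=\sum_{\sigma\in S_N}\prod_{i=1}^N e^{x_i\cdot p_{\sigma(i)}}$. $Z_N=\int_{X^N}\mathrm{Per}_k(x_1,\dots,x_N)^{\beta/k}(e^{-\beta\phi_0}\mu_0)^{\otimes N}$. $MA(\phi)$ is the Alexandrov Monge–Ampère measure of a convex function $\phi$: $MA(\phi)(E)$ is the Lebesgue measure of the image of $E$ under the subgradient map of $\phi$. A solution of the second boundary value problem with target $P$ is a convex solution $\phi$ all of whose subgradients lie in $P$ and for which $MA(\phi)$ has total mass $1$, i.e. the subgradient image covers $P$ up to a null set. *)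

theory Defs
  imports "HOL-Analysis.Analysis"
begin

definition support_fun :: "(real^'n) set \<Rightarrow> real^'n \<Rightarrow> real" where
  "support_fun P x = (SUP p\<in>P. x \<bullet> p)"

definition measure_support :: "('a::topological_space) measure \<Rightarrow> 'a set" where
  "measure_support M = {x. \<forall>U. open U \<and> x \<in> U \<longrightarrow> 0 < emeasure M U}"

text \<open>
  The measure \<open>e\<^sup>g M\<close>. The exponent \<open>g\<close> only needs to be meaningful on the support of \<open>M\<close>
  (the weight \<open>\<phi>\<^sub>0\<close> below is a function on the support), hence the indicator function.
\<close>
definition exp_measure :: "('a::topological_space \<Rightarrow> real) \<Rightarrow> 'a measure \<Rightarrow> 'a measure" where
  "exp_measure g M =
     density M (\<lambda>x. ennreal (exp (g x)) * indicator (measure_support M) x)"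

definition weighted_measure ::
    "(real^'n) set \<Rightarrow> (real^'n) measure \<Rightarrow> (real^'n \<Rightarrow> real) \<Rightarrow> bool" where
  "weighted_measure P \<mu>\<^sub>0 \<phi>\<^sub>0 \<longleftrightarrow>
     sets \<mu>\<^sub>0 = sets borel \<and>
     continuous_on (measure_support \<mu>\<^sub>0) \<phi>\<^sub>0 \<and>
     filterlim (\<lambda>x. \<phi>\<^sub>0 x - support_fun P x) at_top
       (inf at_infinity (principal (measure_support \<mu>\<^sub>0))) \<and>
     (\<forall>b>0. emeasure (exp_measure (\<lambda>x. b * (support_fun P x - \<phi>\<^sub>0 x)) \<mu>\<^sub>0) UNIV < \<infinity>)"

definition lattice_points :: "nat \<Rightarrow> (real^'n) set \<Rightarrow> (real^'n) set" where
  "lattice_points k P = (\<lambda>x. real k *\<^sub>R x) ` P \<inter> {x. \<forall>i. x $ i \<in> \<int>}"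

text \<open>
  Below, \<open>p 1, \<dots>, p N\<close> enumerates the lattice points of \<open>k P\<close> and an element of \<open>(\<real>\<^sup>n)\<^sup>N\<close> is a
  function on the index set \<open>{1..N}\<close>.
\<close>
definition Per :: "nat \<Rightarrow> (nat \<Rightarrow> real^'n) \<Rightarrow> (nat \<Rightarrow> real^'n) \<Rightarrow> real" where
  "Per N p x = (\<Sum>\<sigma> | \<sigma> permutes {1..N}. \<Prod>i=1..N. exp (x i \<bullet> p (\<sigma> i)))"

definition partition_fun ::
    "real \<Rightarrow> (real^'n) measure \<Rightarrow> (real^'n \<Rightarrow> real) \<Rightarrow> nat \<Rightarrow> nat \<Rightarrow> (nat \<Rightarrow> real^'n) \<Rightarrow> real" where
  "partition_fun \<beta> \<mu>\<^sub>0 \<phi>\<^sub>0 k N p =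
     (\<integral>x. Per N p x powr (\<beta> / real k)
        \<partial>(Pi\<^sub>M {1..N} (\<lambda>_. exp_measure (\<lambda>x. - \<beta> * \<phi>\<^sub>0 x) \<mu>\<^sub>0)))"

definition phi_N ::
    "real \<Rightarrow> (real^'n) measure \<Rightarrow> (real^'n \<Rightarrow> real) \<Rightarrow> nat \<Rightarrow> nat \<Rightarrow> (nat \<Rightarrow> real^'n)
       \<Rightarrow> real^'n \<Rightarrow> real" where
  "phi_N \<beta> \<mu>\<^sub>0 \<phi>\<^sub>0 k N p x =
     1 / \<beta> * ln (\<integral>y. 1 / partition_fun \<beta> \<mu>\<^sub>0 \<phi>\<^sub>0 k N p * Per N p (y(1 := x)) powr (\<beta> / real k)
        \<partial>(Pi\<^sub>M {2..N} (\<lambda>_. exp_measure (\<lambda>x. - \<beta> * \<phi>\<^sub>0 x) \<mu>\<^sub>0)))"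

definition subgradients :: "(real^'n \<Rightarrow> real) \<Rightarrow> real^'n \<Rightarrow> (real^'n) set" where
  "subgradients \<phi> x = {y. \<forall>z. \<phi> z \<ge> \<phi> x + y \<bullet> (z - x)}"

text \<open>
  Images of Borel sets under the subgradient map of a convex function are Lebesgue measurable,
  but not obviously Borel; hence \<open>lebesgue\<close> rather than \<open>lborel\<close>.
\<close>
definition MA :: "(real^'n \<Rightarrow> real) \<Rightarrow> (real^'n) measure" where
  "MA \<phi> = measure_of UNIV (sets borel) (\<lambda>E. emeasure lebesgue (\<Union>x\<in>E. subgradients \<phi> x))"

definition solves_second_bvp ::
    "(real^'n) set \<Rightarrow> real \<Rightarrow> (real^'n) measure \<Rightarrow> (real^'n \<Rightarrow> real) \<Rightarrow> (real^'n \<Rightarrow> real) \<Rightarrow> bool" where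
  "solves_second_bvp P \<beta> \<mu>\<^sub>0 \<phi>\<^sub>0 \<phi> \<longleftrightarrow>
     convex_on UNIV \<phi> \<and>
     (\<forall>x. subgradients \<phi> x \<subseteq> P) \<and>
     emeasure (MA \<phi>) UNIV = 1 \<and>
     MA \<phi> = exp_measure (\<lambda>x. \<beta> * (\<phi> x - \<phi>\<^sub>0 x)) \<mu>\<^sub>0"

definition locally_uniform_limit ::
    "('i \<Rightarrow> 'a::topological_space \<Rightarrow> 'b::metric_space) \<Rightarrow> ('a \<Rightarrow> 'b) \<Rightarrow> 'i filter \<Rightarrow> bool" where
  "locally_uniform_limit f l F \<longleftrightarrow> (\<forall>x. \<exists>U. open U \<and> x \<in> U \<and> uniform_limit U f l F)"

end

theory Submission
  imports Defs
begin

text \<open>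
  Write \<open>\<nu> = e\<^sup>-\<^sup>\<beta>\<^sup>\<phi>\<^sup>0 \<mu>\<^sub>0\<close>. Solutions of the Monge--Ampere equation are the minimisers of the convex functional
  \<open>J \<psi> = \<integral>\<^sub>P \<psi>\<^sup>* dp\<close> on the convex functions with subgradients in \<open>P\<close> and \<open>\<integral> e\<^sup>\<beta>\<^sup>\<psi> d\<nu> = 1\<close>. A minimising sequence is
  Cauchy for the Hellinger distance of the probability measures \<open>e\<^sup>\<beta>\<^sup>\<psi> \<nu>\<close>, which controls locally uniform
  convergence because the functions are uniformly Lipschitz. Raising \<open>\<psi>\<^sup>*\<close> by \<open>t\<close> near the subgradient
  image of a compact set \<open>F\<close> shows that the minimiser satisfies \<open>\<integral>\<^sub>F e\<^sup>\<beta>\<^sup>\<psi> d\<nu> \<le> MA \<psi> F\<close>; the left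
  side has total mass 1 and the right side at most the volume of \<open>P\<close>, which is 1, so the measures agree. Uniqueness is a comparison principle.

  For the convergence let \<open>\<psi>\<close> be the solution. The Young inequality bounds the permanent
  by \<open>N! exp (k \<Sum>\<psi> (x\<^sub>i) + k \<Sum>\<psi>\<^sup>* (p\<^sub>i / k))\<close> (with \<open>max \<psi> (\<phi>\<^sub>P - c)\<close> in place of \<open>\<psi>\<close>, since \<open>\<psi>\<^sup>*\<close> may be
  infinite on the boundary of \<open>P\<close>), and subadditivity of the entropy turns this into the estimate
  \<open>D \<le> \<beta> \<integral>\<^sub>P \<psi>\<^sup>* dp - (ln Z\<^sub>N) / N + o(1)\<close> for the relative entropy \<open>D\<close> of the one-point
  marginal of the Gibbs measure with respect to \<open>e\<^sup>\<beta>\<^sup>\<psi> \<nu>\<close>. Conversely, cutting \<open>P\<close> into small cubes and keeping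
  only the configurations with the right number of points in the preimage of each cube gives
  \<open>(ln Z\<^sub>N) / N \<ge> \<beta> \<integral>\<^sub>P \<psi>\<^sup>* dp - o(1)\<close>. Hence \<open>D\<close> tends to 0, and so does the Hellinger distance.
\<close>

section \<open>Support functions\<close>

text \<open>Existence needs no compactness theorem, only a quantitative convexity. At the midpoint
  of two normalised functions the Legendre transform is at most the average of the two transforms,
  whereas the mass of exp (\<beta> \<psi>) drops by half the squared Hellinger distance;
  renormalising gains the logarithm of this drop. Near-minimisers are therefore close to each other.
  For the Gibbs measure, N is of order k^n and the permanent carries the power \<beta>/k. The factor
  N! from the Young inequality thus contributes only (\<beta>/k) ln N! / N, of order ln k / k, and
  disappears. In the lower bound the combinatorial factor is not raised to that power: the
  multinomial coefficient is the entropy of distributing the points among the cells. Cells of equal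
  volume v make this entropy cancel the factors v coming from the masses of the preimages, and the
  integral of the Legendre transform is all that remains. Subgradient images of disjoint sets may
  overlap, but only in a null set; countable additivity of the Monge-Ampere measure, and the passage
  between points and slopes, rest on this fact.\<close>

lemma bdd_above_inner_compact: "compact P \<Longrightarrow> bdd_above ((\<lambda>p. x \<bullet> p) ` P)"
  by (intro bounded_imp_bdd_above compact_imp_bounded compact_continuous_image continuous_intros)

lemma inner_le_support_fun: "compact P \<Longrightarrow> p \<in> P \<Longrightarrow> x \<bullet> p \<le> support_fun P x"
  unfolding support_fun_def by (rule cSUP_upper) (auto intro: bdd_above_inner_compact)

lemma support_fun_le: "P \<noteq> {} \<Longrightarrow> (\<And>p. p \<in> P \<Longrightarrow> x \<bullet> p \<le> c) \<Longrightarrow> support_fun P x \<le> c"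
  unfolding support_fun_def by (rule cSUP_least)

text \<open>Separation: if \<open>g\<close> lay outside \<open>P\<close>, a hyperplane with normal
  \<open>a\<close> would have \<open>g\<close> strictly below it and \<open>P\<close> above it, and
  the direction \<open>- a\<close> would violate the assumed bound. Both subgradients and gradients
  are placed in \<open>P\<close> through this criterion.\<close>

lemma mem_if_inner_le_support_fun:
  assumes "compact P" "convex P" "P \<noteq> {}" "\<And>v. v \<bullet> g \<le> support_fun P v"
  shows "g \<in> P"
proof (rule ccontr)
  assume "g \<notin> P"
  then obtain a b where ab: "a \<bullet> g < b" "\<And>x. x \<in> P \<Longrightarrow> b < a \<bullet> x"
    using separating_hyperplane_closed_point[of P g] assms compact_imp_closed by blast
  have "support_fun P (- a) \<le> - b"
    using assms(3) ab(2) by (intro support_fun_le) (auto intro: less_imp_le)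
  with assms(4)[of "- a"] ab(1) show False by simp
qed

lemma support_fun_add_le:
  assumes "compact P" "P \<noteq> {}"
  shows "support_fun P (x + y) \<le> support_fun P x + support_fun P y"
  by (rule support_fun_le[OF assms(2)])
    (auto simp: inner_add_left intro!: add_mono inner_le_support_fun assms)

lemma support_fun_zero: "P \<noteq> {} \<Longrightarrow> support_fun P 0 = 0"
  by (simp add: support_fun_def)

lemma convex_support_fun:
  assumes "compact P" "P \<noteq> {}"
  shows "convex_on UNIV (support_fun P)"
proof (rule convex_onI)
  fix t :: real and x y assume t: "0 < t" "t < 1"
  show "support_fun P ((1 - t) *\<^sub>R x + t *\<^sub>R y) \<le> (1 - t) * support_fun P x + t * support_fun P y"
    using t by (intro support_fun_le[OF assms(2)])
      (auto simp: inner_add_left intro!: add_mono mult_left_mono inner_le_support_fun assms)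
qed simp

text \<open>For convex \<open>\<psi>\<close> this says that all subgradients of \<open>\<psi>\<close> lie in \<open>P\<close>.\<close>
definition PLip :: "(real^'n) set \<Rightarrow> (real^'n \<Rightarrow> real) \<Rightarrow> bool" where
  "PLip P \<psi> \<longleftrightarrow> (\<forall>x y. \<psi> x - \<psi> y \<le> support_fun P (x - y))"

lemma PLipD: "PLip P \<psi> \<Longrightarrow> \<psi> x - \<psi> y \<le> support_fun P (x - y)"
  by (simp add: PLip_def)

lemma PLip_subgradients:
  assumes "compact P" "convex P" "P \<noteq> {}" "PLip P \<psi>"
  shows "subgradients \<psi> x \<subseteq> P"
proof
  fix y assume y: "y \<in> subgradients \<psi> x"
  show "y \<in> P"
  proof (rule mem_if_inner_le_support_fun[OF assms(1-3)])
    fix v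
    have "\<psi> x + y \<bullet> (x + v - x) \<le> \<psi> (x + v)" using y unfolding subgradients_def by blast
    with PLipD[OF assms(4), of "x + v" x] show "v \<bullet> y \<le> support_fun P v"
      by (simp add: inner_commute)
  qed
qed

lemma PLip_support_fun: "compact P \<Longrightarrow> P \<noteq> {} \<Longrightarrow> PLip P (support_fun P)"
  unfolding PLip_def using support_fun_add_le[of P "x - y" y for x y] by (fastforce simp: algebra_simps)

lemma PLip_diff_const: "PLip P \<psi> \<Longrightarrow> PLip P (\<lambda>x. \<psi> x - c)"
  by (simp add: PLip_def)

lemma PLip_max: "PLip P \<phi> \<Longrightarrow> PLip P \<psi> \<Longrightarrow> PLip P (\<lambda>x. max (\<phi> x) (\<psi> x))"
  unfolding PLip_def by (smt (verit))

lemma PLip_midpoint: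
  assumes "PLip P \<phi>" "PLip P \<psi>"
  shows "PLip P (\<lambda>x. (\<phi> x + \<psi> x) / 2)"
  unfolding PLip_def
proof (intro allI)
  fix x y
  show "(\<phi> x + \<psi> x) / 2 - (\<phi> y + \<psi> y) / 2 \<le> support_fun P (x - y)"
    using PLipD[OF assms(1), of x y] PLipD[OF assms(2), of x y] by argo
qed

lemma PLip_lipschitz:
  assumes "compact P" "P \<noteq> {}" "\<And>p. p \<in> P \<Longrightarrow> norm p \<le> L" "PLip P \<psi>"
  shows "\<bar>\<psi> x - \<psi> y\<bar> \<le> L * norm (x - y)"
proof -
  have *: "support_fun P v \<le> L * norm v" for v
  proof (rule support_fun_le[OF assms(2)])
    fix p assume "p \<in> P"
    have "v \<bullet> p \<le> norm v * norm p" by (rule norm_cauchy_schwarz)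
    also have "\<dots> \<le> norm v * L" by (intro mult_left_mono assms(3) \<open>p \<in> P\<close>) auto
    finally show "v \<bullet> p \<le> L * norm v" by (simp add: mult.commute)
  qed
  show ?thesis
    using PLipD[OF assms(4), of x y] PLipD[OF assms(4), of y x] *[of "x - y"] *[of "y - x"]
    by (simp add: norm_minus_commute abs_le_iff)
qed

lemma PLip_continuous:
  assumes "compact P" "P \<noteq> {}" "PLip P \<psi>"
  shows "continuous_on UNIV \<psi>"
proof -
  obtain L where L: "\<And>p. p \<in> P \<Longrightarrow> norm p \<le> L"
    using compact_imp_bounded[OF assms(1)] by (auto simp: bounded_iff)
  have "0 \<le> L" using L assms(2) norm_ge_zero order_trans by blast
  have "L-lipschitz_on UNIV \<psi>"
    using PLip_lipschitz[OF assms(1,2) L assms(3)] \<open>0 \<le> L\<close>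
    by (auto simp: lipschitz_on_def dist_real_def dist_norm)
  then show ?thesis by (rule lipschitz_on_continuous_on)
qed

section \<open>Closed monotone relations and the Monge--Ampere measure\<close>

lemma null_sets_lebesgue_subset:
  "A \<in> null_sets lebesgue \<Longrightarrow> B \<subseteq> A \<Longrightarrow> B \<in> null_sets lebesgue"
  using negligible_subset by (auto simp: negligible_iff_null_sets[symmetric])

text \<open>Two shifts \<open>v / (i + 1)\<close> and \<open>v / (j + 1)\<close> differ by a nonzero
  multiple of \<open>v\<close>, so these translates are pairwise disjoint. They have equal measure
  and all fit into one ball, since the shifts have length at most \<open>norm v\<close>; infinitely
  many of them leave room only for measure zero.\<close>

lemma null_of_disjoint_translates:
  fixes S :: "'a::euclidean_space set"
  assumes "bounded S" "S \<in> sets lebesgue"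
    and disj: "\<And>t. t > 0 \<Longrightarrow> S \<inter> (\<lambda>x. t *\<^sub>R v + x) ` S = {}"
  shows "S \<in> null_sets lebesgue"
proof -
  define T where "T = (\<lambda>i::nat. (\<lambda>x. (1 / real (Suc i)) *\<^sub>R v + x) ` S)"
  have mS: "S \<in> lmeasurable" using assms bounded_set_imp_lmeasurable by blast
  obtain B where B: "\<And>x. x \<in> S \<Longrightarrow> norm x \<le> B" using assms(1) by (auto simp: bounded_iff)
  have disjT: "disjoint_family T"
    unfolding disjoint_family_on_def
  proof (intro ballI impI)
    fix i j :: nat assume "i \<noteq> j"
    have *: False if "a < b" "(1 / real (Suc a)) *\<^sub>R v + x = (1 / real (Suc b)) *\<^sub>R v + y"
       "x \<in> S" "y \<in> S" for a b x y
    proof -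
      define t where "t = 1 / real (Suc a) - 1 / real (Suc b)"
      have "t > 0" using that(1) by (simp add: t_def divide_simps)
      have "y = t *\<^sub>R v + x" using that(2) by (simp add: t_def algebra_simps)
      then show False using disj[OF \<open>t > 0\<close>] that by auto
    qed
    show "T i \<inter> T j = {}"
      using *[of i j] *[of j i] \<open>i \<noteq> j\<close> by (cases "i < j") (fastforce simp: T_def)+
  qed
  have mT: "T i \<in> lmeasurable" "measure lebesgue (T i) = measure lebesgue S" for i
    unfolding T_def using mS by (auto simp: measurable_translation measure_translation)
  have sub: "T i \<subseteq> cball 0 (norm v + B)" for i
  proof
    fix z assume "z \<in> T i"
    then obtain x where x: "x \<in> S" "z = (1 / real (Suc i)) *\<^sub>R v + x" by (auto simp: T_def)
    have "norm z \<le> norm ((1 / real (Suc i)) *\<^sub>R v) + norm x" using x norm_triangle_ineq by blast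
    also have "\<dots> \<le> norm v + B"
      using B[OF x(1)] by (intro add_mono) (auto simp: divide_simps mult_le_cancel_left1)
    finally show "z \<in> cball 0 (norm v + B)" by simp
  qed
  have bound: "real m * measure lebesgue S \<le> measure lebesgue (cball (0::'a) (norm v + B))" for m
  proof -
    have "measure lebesgue (\<Union>i<m. T i) = (\<Sum>i<m. measure lebesgue (T i))"
      using mT(1) disjT fmeasurableD2[OF mT(1)] by (intro measure_finite_Union)
        (auto simp: disjoint_family_on_def fmeasurableD simp del: emeasure_completion)
    also have "\<dots> = real m * measure lebesgue S" by (simp add: mT)
    finally have "real m * measure lebesgue S = measure lebesgue (\<Union>i<m. T i)" by simp
    also have "\<dots> \<le> measure lebesgue (cball (0::'a) (norm v + B))"
      using sub mT by (intro measure_mono_fmeasurable) (auto intro!: fmeasurableD sets.finite_UN)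
    finally show ?thesis .
  qed
  have "measure lebesgue S = 0"
  proof (rule ccontr)
    assume "measure lebesgue S \<noteq> 0"
    then have "measure lebesgue S > 0" using measure_nonneg[of lebesgue S] by linarith
    then obtain m :: nat where "real m * measure lebesgue S > measure lebesgue (cball (0::'a) (norm v + B))"
      using reals_Archimedean3 by blast
    with bound[of m] show False by simp
  qed
  then show ?thesis using mS
    by (simp add: fmeasurable_def null_sets_def emeasure_eq_ennreal_measure top.not_eq_extremum)
qed

lemma closed_Image_compact:
  fixes R :: "('a::euclidean_space \<times> 'b::euclidean_space) set"
  assumes "closed R" "compact K"
  shows "closed (R `` K)"
proof -
  have "R `` K = {y. \<exists>x. x \<in> K \<and> (x, y) \<in> R}" by auto
  then show ?thesis using closed_compact_projection[OF assms(2,1)] by simp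
qed

text \<open>Symmetric in the two coordinates, so that one null-set lemma serves both the subgradient
  relation (slopes attained at two points) and its converse (points with two slopes).\<close>

definition monotone_rel :: "('a::real_inner \<times> 'a) set \<Rightarrow> bool" where
  "monotone_rel R \<longleftrightarrow> (\<forall>(x, y)\<in>R. \<forall>(x', y')\<in>R. 0 \<le> (x - x') \<bullet> (y - y'))"

lemma closed_converse:
  fixes R :: "('a::topological_space \<times> 'b::topological_space) set"
  assumes "closed R"
  shows "closed (R\<inverse>)"
proof -
  have "R\<inverse> = (\<lambda>z. (snd z, fst z)) -` R" by auto
  then show ?thesis using assms by (simp only:) (intro closed_vimage continuous_intros)
qed

lemma monotone_rel_converse: "monotone_rel R \<Longrightarrow> monotone_rel (R\<inverse>)"
  by (fastforce simp: monotone_rel_def inner_commute)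

text \<open>If \<open>x\<close> and \<open>x'\<close> differ in coordinate \<open>i\<close>, two
  rationals separate these coordinates, so countably many sets \<open>S (i, q, q', m)\<close>
  suffice. Suppose \<open>y\<close> and \<open>y + t e_i\<close> with \<open>t > 0\<close> both lie
  in such a set. A source of \<open>y + t e_i\<close> on the low side and a source of
  \<open>y\<close> on the high side then contradict monotonicity; so \<open>S\<close> is disjoint
  from its translates. The balls of radius \<open>m\<close> make \<open>S\<close> bounded and the
  images closed.\<close>

lemma monotone_rel_overlap_null:
  fixes R :: "((real^'n) \<times> (real^'n)) set"
  assumes "closed R" "monotone_rel R"
  shows "{y. \<exists>x x'. x \<noteq> x' \<and> (x, y) \<in> R \<and> (x', y) \<in> R} \<in> null_sets lebesgue"
proof -
  define A where "A = (\<lambda>(i::'n) (q::rat) m::nat. {x::real^'n. x $ i \<le> of_rat q} \<inter> cball 0 (real m))"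
  define B where "B = (\<lambda>(i::'n) (q::rat) m::nat. {x::real^'n. of_rat q \<le> x $ i} \<inter> cball 0 (real m))"
  define S where "S = (\<lambda>(i, q, q', m). R `` A i q m \<inter> R `` B i q' m \<inter> cball 0 (real m))"
  have cA: "compact (A i q m)" and cB: "compact (B i q m)" for i q m
    unfolding A_def B_def
    by (auto intro!: closed_Int_compact closed_Collect_le continuous_intros)
  have null: "S (i, q, q', m) \<in> null_sets lebesgue" if "q < q'" for i q q' m
  proof (rule null_of_disjoint_translates[where v = "axis i 1"])
    have "closed (S (i, q, q', m))"
      unfolding S_def using assms(1) cA cB by (auto intro!: closed_Int closed_Image_compact)
    then show "S (i, q, q', m) \<in> sets lebesgue" by simp
    show "bounded (S (i, q, q', m))"
      unfolding S_def by (auto intro: bounded_subset[OF bounded_cball])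
    fix t :: real assume t: "t > 0"
    show "S (i, q, q', m) \<inter> (\<lambda>x. t *\<^sub>R axis i 1 + x) ` S (i, q, q', m) = {}"
    proof (rule ccontr)
      assume "\<not> ?thesis"
      then obtain y where y: "y \<in> S (i, q, q', m)" "t *\<^sub>R axis i 1 + y \<in> S (i, q, q', m)" by auto
      obtain x where x: "x \<in> A i q m" "(x, t *\<^sub>R axis i 1 + y) \<in> R" using y(2) by (auto simp: S_def)
      obtain x' where x': "x' \<in> B i q' m" "(x', y) \<in> R" using y(1) by (auto simp: S_def)
      have "0 \<le> (x - x') \<bullet> (t *\<^sub>R axis i 1 + y - y)"
        using assms(2) x(2) x'(2) unfolding monotone_rel_def by fast
      then have "0 \<le> (x - x') $ i" using t by (simp add: inner_axis zero_le_mult_iff)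
      moreover have "(of_rat q::real) < of_rat q'" using that by (simp add: of_rat_less)
      ultimately show False using x(1) x'(1) by (auto simp: A_def B_def)
    qed
  qed
  have "{y. \<exists>x x'. x \<noteq> x' \<and> (x, y) \<in> R \<and> (x', y) \<in> R} \<subseteq>
      (\<Union>z\<in>{(i, q, q', m). q < q'}. S z)"
  proof safe
    fix y x x' assume *: "x \<noteq> x'" "(x, y) \<in> R" "(x', y) \<in> R"
    have **: "\<exists>i q q' m. q < q' \<and> y \<in> S (i, q, q', m)"
      if xx: "(u, y) \<in> R" "(w, y) \<in> R" "u $ i < w $ i" for u w i
    proof -
      obtain q1 :: rat where q1: "u $ i < of_rat q1" "of_rat q1 < w $ i"
        using of_rat_dense[OF xx(3)] by blast
      obtain q2 :: rat where q2: "of_rat q1 < (of_rat q2::real)" "of_rat q2 < w $ i"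
        using of_rat_dense[OF q1(2)] by blast
      obtain m :: nat where m: "real m \<ge> max (norm y) (max (norm u) (norm w))"
        using real_arch_simple by blast
      have "y \<in> S (i, q1, q2, m)" using xx q1 q2 m by (auto simp: S_def A_def B_def)
      moreover have "q1 < q2" using q2 by (simp add: of_rat_less)
      ultimately show ?thesis by blast
    qed
    obtain i where "x $ i \<noteq> x' $ i" using * by (auto simp: vec_eq_iff)
    then show "y \<in> (\<Union>z\<in>{(i, q, q', m). q < q'}. S z)"
      using **[of x x' i] **[of x' x i] * by (cases "x $ i < x' $ i") fastforce+
  qed
  moreover have "(\<Union>z\<in>{(i, q, q', m). q < q'}. S z) \<in> null_sets lebesgue"
    using null by (intro null_sets_UN') auto
  ultimately show ?thesis
    by (rule null_sets_lebesgue_subset[rotated])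
qed

definition subgrad_rel :: "(real^'n \<Rightarrow> real) \<Rightarrow> ((real^'n) \<times> (real^'n)) set" where
  "subgrad_rel \<phi> = {(x, y). y \<in> subgradients \<phi> x}"

lemma subgrad_rel_iff: "(x, y) \<in> subgrad_rel \<phi> \<longleftrightarrow> y \<in> subgradients \<phi> x"
  by (simp add: subgrad_rel_def)

lemma subgradientsD: "y \<in> subgradients \<phi> x \<Longrightarrow> \<phi> x + y \<bullet> (z - x) \<le> \<phi> z"
  by (simp add: subgradients_def)

lemma subgrad_rel_Image: "subgrad_rel \<phi> `` E = (\<Union>x\<in>E. subgradients \<phi> x)"
  by (auto simp: subgrad_rel_def)

lemma closed_subgrad_rel:
  assumes "continuous_on UNIV \<phi>"
  shows "closed (subgrad_rel \<phi>)"
proof -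
  have "subgrad_rel \<phi> = (\<Inter>z. {w. \<phi> (fst w) + snd w \<bullet> (z - fst w) \<le> \<phi> z})"
    by (auto simp: subgrad_rel_def subgradients_def)
  moreover have "continuous_on UNIV (\<lambda>w. \<phi> (fst w))"
    by (rule continuous_on_compose2[OF assms]) (auto intro!: continuous_intros)
  ultimately show ?thesis
    by (simp only:) (intro closed_INT ballI closed_Collect_le continuous_intros)
qed

lemma monotone_subgrad_rel: "monotone_rel (subgrad_rel \<phi>)"
  unfolding monotone_rel_def
proof clarsimp
  fix x y x' y' assume "(x, y) \<in> subgrad_rel \<phi>" "(x', y') \<in> subgrad_rel \<phi>"
  then have "\<phi> x + y \<bullet> (x' - x) \<le> \<phi> x'" "\<phi> x' + y' \<bullet> (x - x') \<le> \<phi> x"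
    by (auto simp: subgrad_rel_iff dest: subgradientsD)
  then show "0 \<le> (x - x') \<bullet> (y - y')"
    by (simp add: inner_diff_left inner_diff_right inner_commute)
qed

text \<open>Induction over the generation of the Borel sets by closed sets. The image of a
  complement is not the complement of the image, but the two differ inside the overlap null set, and
  completeness of \<open>lebesgue\<close> makes every subset of that set measurable.\<close>

lemma Image_Borel_lebesgue:
  fixes R :: "((real^'n) \<times> (real^'n)) set"
  assumes "closed R" "monotone_rel R" "E \<in> sets borel"
  shows "R `` E \<in> sets lebesgue"
proof -
  have closed_case: "R `` F \<in> sets lebesgue" if "closed F" for F
  proof -
    have "\<exists>m::nat. x \<in> cball 0 (real m)" for x :: "real^'n"
      using real_arch_simple[of "norm x"] by auto
    then have "R `` F = (\<Union>m::nat. R `` (F \<inter> cball 0 (real m)))" by blast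
    moreover have "closed (R `` (F \<inter> cball 0 (real m)))" for m
      using that assms(1) by (auto intro!: closed_Image_compact closed_Int_compact)
    ultimately show ?thesis by (auto intro!: sets.countable_UN)
  qed
  have "E \<in> sigma_sets UNIV {F. closed F}" using assms(3) by (simp add: borel_eq_closed)
  then show ?thesis
  proof induction
    case (Basic F)
    then show ?case by (simp add: closed_case)
  next
    case Empty
    then show ?case by simp
  next
    case (Compl F)
    let ?N = "{y. \<exists>x x'. x \<noteq> x' \<and> (x, y) \<in> R \<and> (x', y) \<in> R}"
    have "R `` F \<inter> R `` (UNIV - F) \<subseteq> ?N"
    proof
      fix y assume "y \<in> R `` F \<inter> R `` (UNIV - F)"
      then obtain x x' where "x \<in> F" "(x, y) \<in> R" "x' \<notin> F" "(x', y) \<in> R" by blast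
      moreover from this have "x \<noteq> x'" by blast
      ultimately show "y \<in> ?N" by blast
    qed
    then have "R `` F \<inter> R `` (UNIV - F) \<in> sets lebesgue"
      using monotone_rel_overlap_null[OF assms(1,2)]
      by (blast intro: null_setsD2 null_sets_lebesgue_subset)
    moreover have "R `` (UNIV - F) = (R `` UNIV - R `` F) \<union> (R `` F \<inter> R `` (UNIV - F))" by auto
    moreover have "R `` UNIV \<in> sets lebesgue" by (simp add: closed_case)
    ultimately show ?case using Compl by (metis sets.Diff sets.Un)
  next
    case (Union F)
    have "R `` (\<Union>i. F i) = (\<Union>i. R `` F i)" by auto
    then show ?case using Union by (auto intro!: sets.countable_UN)
  qed
qed

lemma sets_subgradients_image:
  "continuous_on UNIV \<phi> \<Longrightarrow> E \<in> sets borel \<Longrightarrow> (\<Union>x\<in>E. subgradients \<phi> x) \<in> sets lebesgue"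
  using Image_Borel_lebesgue[OF closed_subgrad_rel monotone_subgrad_rel] by (simp only: subgrad_rel_Image)

lemma sets_MA: "sets (MA \<phi>) = sets borel" and space_MA: "space (MA \<phi>) = UNIV"
  by (auto simp: MA_def sets.sigma_sets_eq[of borel, simplified])

text \<open>\<open>measure_of\<close> gives this value only once countable additivity is known.
  Deleting the null set \<open>Z\<close> of slopes attained at two points makes the images of
  disjoint sets disjoint without changing any volume.\<close>

lemma emeasure_MA:
  assumes "continuous_on UNIV \<phi>" "E \<in> sets borel"
  shows "emeasure (MA \<phi>) E = emeasure lebesgue (\<Union>x\<in>E. subgradients \<phi> x)"
proof -
  let ?R = "subgrad_rel \<phi>"
  define Z where "Z = {y. \<exists>x x'. x \<noteq> x' \<and> (x, y) \<in> ?R \<and> (x', y) \<in> ?R}"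
  have Z: "Z \<in> null_sets lebesgue"
    unfolding Z_def by (intro monotone_rel_overlap_null closed_subgrad_rel monotone_subgrad_rel assms)
  have meas: "?R `` E \<in> sets lebesgue" if "E \<in> sets borel" for E
    by (intro Image_Borel_lebesgue closed_subgrad_rel monotone_subgrad_rel assms that)
  let ?f = "\<lambda>E. emeasure lebesgue (\<Union>x\<in>E. subgradients \<phi> x)"
  have f: "?f E = emeasure lebesgue (?R `` E - Z)" if "E \<in> sets borel" for E
    unfolding subgrad_rel_Image[symmetric] by (rule emeasure_Diff_null_set[OF Z meas[OF that], symmetric])
  show ?thesis
  proof (rule emeasure_measure_of[OF MA_def])
    show "countably_additive (sets (MA \<phi>)) ?f"
      unfolding countably_additive_def
    proof clarify
      fix A :: "nat \<Rightarrow> _" assume "range A \<subseteq> sets (MA \<phi>)" and d: "disjoint_family A"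
      then have A: "A i \<in> sets borel" for i unfolding sets_MA by blast
      then have U: "(\<Union>i. A i) \<in> sets borel" by (intro sets.countable_UN) auto
      have "(\<Sum>i. ?f (A i)) = (\<Sum>i. emeasure lebesgue (?R `` A i - Z))"
        by (simp only: f[OF A])
      also have "\<dots> = emeasure lebesgue (\<Union>i. ?R `` A i - Z)"
      proof (rule suminf_emeasure)
        show "range (\<lambda>i. ?R `` A i - Z) \<subseteq> sets lebesgue" using meas[OF A] Z by (blast intro: null_setsD2)
        show "disjoint_family (\<lambda>i. ?R `` A i - Z)"
          unfolding disjoint_family_on_def
        proof (intro ballI impI equals0I)
          fix i j :: nat and y
          assume "i \<noteq> j" and y: "y \<in> (?R `` A i - Z) \<inter> (?R `` A j - Z)"
          then obtain x x' where "x \<in> A i" "(x, y) \<in> ?R" "x' \<in> A j" "(x', y) \<in> ?R" by blast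
          moreover from this have "x \<noteq> x'"
            using d \<open>i \<noteq> j\<close> by (auto simp: disjoint_family_on_def)
          ultimately show False using y by (auto simp: Z_def)
        qed
      qed
      also have "(\<Union>i. ?R `` A i - Z) = ?R `` (\<Union>i. A i) - Z" by auto
      finally show "(\<Sum>i. ?f (A i)) = ?f (\<Union>i. A i)"
        by (simp only: f[OF U])
    qed
    show "positive (sets (MA \<phi>)) ?f" by (simp add: positive_def)
    show "E \<in> sets (MA \<phi>)" using assms(2) by (simp add: sets_MA)
  qed simp
qed

text \<open>The converse of the subgradient relation is closed and monotone too, so the overlap
  lemma applies with points and slopes exchanged. For convex \<open>\<phi>\<close> this is
  differentiability almost everywhere.\<close>

lemma subgradients_not_unique_null:
  assumes "continuous_on UNIV \<phi>"
  shows "{x. \<exists>y y'. y \<noteq> y' \<and> y \<in> subgradients \<phi> x \<and> y' \<in> subgradients \<phi> x} \<in> null_sets lebesgue"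
  using monotone_rel_overlap_null[of "(subgrad_rel \<phi>)\<inverse>"] closed_subgrad_rel[OF assms]
    monotone_rel_converse[OF monotone_subgrad_rel]
  by (auto simp: subgrad_rel_iff closed_converse)

section \<open>The Monge--Ampere equation with exponential right-hand side\<close>

lemma density_open_pos:
  fixes r :: "'a::euclidean_space \<Rightarrow> real"
  assumes "r \<in> borel_measurable borel" "\<And>x. 0 < r x" "open U" "U \<noteq> {}"
  shows "0 < emeasure (density lborel (\<lambda>x. ennreal (r x))) U"
proof (rule ccontr)
  assume "\<not> 0 < emeasure (density lborel (\<lambda>x. ennreal (r x))) U"
  then have "U \<in> null_sets (density lborel (\<lambda>x. ennreal (r x)))" using assms(3) by (auto simp: null_sets_def)
  then have "AE x in lborel. x \<in> U \<longrightarrow> ennreal (r x) = 0"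
    using assms(1) by (subst (asm) null_sets_density_iff) auto
  then have "AE x in lborel. x \<notin> U"
    using assms(2) by (auto simp: ennreal_eq_0_iff elim!: eventually_mono) (meson not_le)
  then have "U \<in> null_sets lborel" using assms(3) by (subst AE_iff_null_sets) auto
  then have "negligible U" by (simp add: negligible_iff_null_sets null_sets_completionI)
  with open_not_negligible[OF assms(3,4)] show False by simp
qed

text \<open>In the main theorem \<open>r\<close> becomes
  \<open>exp (- \<beta> * \<phi>\<^sub>0 x) * \<rho>\<^sub>0 x\<close>, so that weight and density
  merge into one reference measure \<open>\<nu>\<close>. \<open>finite_mass\<close> is then the case
  \<open>b = \<beta>\<close> of the mass condition in \<open>weighted_measure\<close>.\<close>

locale ma_equation =
  fixes P :: "(real^'n) set" and \<beta> :: real and r :: "real^'n \<Rightarrow> real"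
  assumes compact_P: "compact P" and convex_P: "convex P" and interior_P: "interior P \<noteq> {}"
    and volume_P: "emeasure lborel P = 1" and beta_pos: "0 < \<beta>"
    and r_borel: "r \<in> borel_measurable borel" and r_pos: "\<And>x. 0 < r x"
    and finite_mass: "(\<integral>\<^sup>+x. ennreal (exp (\<beta> * support_fun P x) * r x) \<partial>lborel) < \<infinity>"
begin

definition \<nu> :: "(real^'n) measure" where "\<nu> = density lborel (\<lambda>x. ennreal (r x))"

definition wt :: "(real^'n \<Rightarrow> real) \<Rightarrow> (real^'n) measure" where
  "wt \<psi> = density \<nu> (\<lambda>x. ennreal (exp (\<beta> * \<psi> x)))"

definition M :: "(real^'n \<Rightarrow> real) \<Rightarrow> real" where "M \<psi> = (\<integral>x. exp (\<beta> * \<psi> x) \<partial>\<nu>)"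

lemma sets_nu [measurable_cong, simp]: "sets \<nu> = sets borel" and space_nu [simp]: "space \<nu> = UNIV"
  by (simp_all add: \<nu>_def)

lemma sets_wt [simp]: "sets (wt \<psi>) = sets borel" and space_wt [simp]: "space (wt \<psi>) = UNIV"
  by (simp_all add: wt_def)

lemma r_measurable [measurable]: "r \<in> borel_measurable borel" by (rule r_borel)

lemma P_nonempty: "P \<noteq> {}" using interior_P interior_subset by blast

lemma closed_P: "closed P" by (rule compact_imp_closed[OF compact_P])

lemma P_borel [measurable]: "P \<in> sets borel" using closed_P by simp

definition L :: real where "L = (SOME L. 0 < L \<and> (\<forall>p\<in>P. norm p \<le> L))"

lemma L_pos: "0 < L" and norm_le_L: "p \<in> P \<Longrightarrow> norm p \<le> L"
proof -
  obtain B where B: "\<forall>p\<in>P. norm p \<le> B" using compact_imp_bounded[OF compact_P] by (auto simp: bounded_iff)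
  then have "0 < max B 1 \<and> (\<forall>p\<in>P. norm p \<le> max B 1)" by (auto intro: order_trans[OF _ max.cobounded1])
  then have *: "0 < L \<and> (\<forall>p\<in>P. norm p \<le> L)" unfolding L_def by (rule someI)
  then show "0 < L" "p \<in> P \<Longrightarrow> norm p \<le> L" by auto
qed

lemma lipschitz: "PLip P \<psi> \<Longrightarrow> \<bar>\<psi> x - \<psi> y\<bar> \<le> L * norm (x - y)"
  by (rule PLip_lipschitz[OF compact_P P_nonempty norm_le_L])

lemma continuous: "PLip P \<psi> \<Longrightarrow> continuous_on UNIV \<psi>"
  by (rule PLip_continuous[OF compact_P P_nonempty])

lemma borel: "PLip P \<psi> \<Longrightarrow> \<psi> \<in> borel_measurable borel"
  by (rule borel_measurable_continuous_onI[OF continuous])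

lemma PLip_support: "PLip P (support_fun P)"
  by (rule PLip_support_fun[OF compact_P P_nonempty])

lemma borel_support [measurable]: "support_fun P \<in> borel_measurable borel"
  by (rule borel[OF PLip_support])

lemma le_support: "PLip P \<psi> \<Longrightarrow> \<psi> x \<le> \<psi> 0 + support_fun P x"
  using PLipD[of P \<psi> x 0] by simp

lemma sigma_finite_nu: "sigma_finite_measure \<nu>"
  unfolding \<nu>_def by (subst sigma_finite_measure.sigma_finite_iff_density_finite[OF sigma_finite_lborel]) auto

lemma null_nu: "A \<in> null_sets lborel \<Longrightarrow> A \<in> null_sets \<nu>"
  unfolding \<nu>_def by (subst null_sets_density_iff) (auto dest: AE_not_in elim!: eventually_mono)

lemma nu_open_pos: "open U \<Longrightarrow> U \<noteq> {} \<Longrightarrow> 0 < emeasure \<nu> U"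
  unfolding \<nu>_def by (rule density_open_pos[OF r_borel r_pos])

lemma integrable_support: "integrable \<nu> (\<lambda>x. exp (\<beta> * support_fun P x))"
proof (rule integrableI_nonneg)
  have "(\<integral>\<^sup>+x. ennreal (exp (\<beta> * support_fun P x)) \<partial>\<nu>)
      = (\<integral>\<^sup>+x. ennreal (exp (\<beta> * support_fun P x) * r x) \<partial>lborel)"
    unfolding \<nu>_def using r_pos
    by (subst nn_integral_density) (auto simp: ennreal_mult less_imp_le mult.commute intro!: nn_integral_cong)
  then show "(\<integral>\<^sup>+x. ennreal (exp (\<beta> * support_fun P x)) \<partial>\<nu>) < \<infinity>" using finite_mass by simp
qed auto

lemma integrable_bound_support:
  assumes "f \<in> borel_measurable borel" "\<And>x. \<bar>f x\<bar> \<le> c * exp (\<beta> * support_fun P x)"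
  shows "integrable \<nu> f"
proof (rule Bochner_Integration.integrable_bound)
  show "integrable \<nu> (\<lambda>x. c * exp (\<beta> * support_fun P x))" using integrable_support by simp
  show "f \<in> borel_measurable \<nu>" using assms(1) by simp
  show "AE x in \<nu>. norm (f x) \<le> norm (c * exp (\<beta> * support_fun P x))"
    using assms(2) by (intro AE_I2) (auto intro: order_trans[OF _ abs_ge_self])
qed

lemma exp_le_support:
  assumes "PLip P \<psi>" shows "exp (\<beta> * \<psi> x) \<le> exp (\<beta> * \<psi> 0) * exp (\<beta> * support_fun P x)"
  using le_support[OF assms, of x] beta_pos
  by (simp add: exp_add[symmetric] distrib_left[symmetric])

lemma integrable_exp: "PLip P \<psi> \<Longrightarrow> integrable \<nu> (\<lambda>x. exp (\<beta> * \<psi> x))"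
  using exp_le_support borel by (intro integrable_bound_support[where c = "exp (\<beta> * \<psi> 0)"]) auto

lemma M_pos:
  assumes "PLip P \<psi>" shows "0 < M \<psi>"
proof -
  have "M \<psi> \<noteq> 0"
  proof
    assume "M \<psi> = 0"
    then have "AE x in \<nu>. exp (\<beta> * \<psi> x) = 0"
      unfolding M_def using integral_nonneg_eq_0_iff_AE[OF integrable_exp[OF assms]] by simp
    then have "AE x in \<nu>. x \<notin> UNIV" by simp
    then have "UNIV \<in> null_sets \<nu>" by (subst AE_iff_null_sets) auto
    with nu_open_pos[of UNIV] show False by auto
  qed
  moreover have "0 \<le> M \<psi>" unfolding M_def by simp
  ultimately show ?thesis by simp
qed

lemma M_mono: "PLip P \<phi> \<Longrightarrow> PLip P \<psi> \<Longrightarrow> (\<And>x. \<phi> x \<le> \<psi> x) \<Longrightarrow> M \<phi> \<le> M \<psi>"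
  unfolding M_def using beta_pos by (intro integral_mono integrable_exp) auto

lemma M_diff_const: "M (\<lambda>x. \<psi> x - c) = exp (- (\<beta> * c)) * M \<psi>"
proof -
  have "(\<lambda>x. exp (\<beta> * (\<psi> x - c))) = (\<lambda>x. exp (- (\<beta> * c)) * exp (\<beta> * \<psi> x))"
    by (auto simp: exp_add[symmetric] algebra_simps)
  then show ?thesis by (simp add: M_def)
qed

lemma emeasure_wt:
  assumes "PLip P \<psi>" "E \<in> sets borel"
  shows "emeasure (wt \<psi>) E = ennreal (\<integral>x. indicator E x * exp (\<beta> * \<psi> x) \<partial>\<nu>)"
proof -
  note [measurable] = borel[OF assms(1)] assms(2)
  have "emeasure (wt \<psi>) E = (\<integral>\<^sup>+x. ennreal (indicator E x * exp (\<beta> * \<psi> x)) \<partial>\<nu>)"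
    unfolding wt_def by (subst emeasure_density) (auto intro!: nn_integral_cong split: split_indicator)
  also have "\<dots> = ennreal (\<integral>x. indicator E x * exp (\<beta> * \<psi> x) \<partial>\<nu>)"
    using integrable_real_mult_indicator[of E \<nu> "\<lambda>x. exp (\<beta> * \<psi> x)"] integrable_exp[OF assms(1)]
    by (intro nn_integral_eq_integral) (auto simp: mult.commute)
  finally show ?thesis .
qed

lemma emeasure_wt_UNIV: "PLip P \<psi> \<Longrightarrow> emeasure (wt \<psi>) UNIV = ennreal (M \<psi>)"
  by (simp add: emeasure_wt M_def)

text \<open>For \<open>PLip P \<psi>\<close> the difference \<open>\<psi> x - \<psi> 0\<close> lies
  between \<open>- support_fun P (- x)\<close> and \<open>support_fun P x\<close>. Comparing the
  masses of the three exponentials when \<open>M \<psi> = 1\<close> confines \<open>\<psi> 0\<close>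
  to the interval from \<open>- M_bound\<close> to \<open>M_bound\<close>.\<close>

definition M_bound :: real where
  "M_bound = max (ln (M (support_fun P)) / \<beta>) (- ln (M (\<lambda>x. - support_fun P (- x))) / \<beta>)"

lemma PLip_support_uminus: "PLip P (\<lambda>x. - support_fun P (- x))"
  unfolding PLip_def
proof (intro allI)
  fix x y
  show "- support_fun P (- x) - - support_fun P (- y) \<le> support_fun P (x - y)"
    using support_fun_add_le[OF compact_P P_nonempty, of "- x" "x - y"] by simp
qed

lemma normalized_bounds:
  assumes "PLip P \<psi>" "M \<psi> = 1"
  shows "- M_bound \<le> \<psi> 0" "\<psi> 0 \<le> M_bound"
proof -
  have *: "M (\<lambda>x. \<psi> x - \<psi> 0) = exp (- (\<beta> * \<psi> 0))" using assms(2) M_diff_const[of \<psi>] by simp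
  have "M (\<lambda>x. \<psi> x - \<psi> 0) \<le> M (support_fun P)"
    using le_support[OF assms(1)] by (intro M_mono PLip_diff_const assms PLip_support) (simp add: algebra_simps)
  then have "- (\<beta> * \<psi> 0) \<le> ln (M (support_fun P))"
    using M_pos[OF PLip_support] by (simp add: * ln_ge_iff)
  then have "- \<psi> 0 \<le> ln (M (support_fun P)) / \<beta>" using beta_pos by (simp add: field_simps)
  then show "- M_bound \<le> \<psi> 0" unfolding M_bound_def by linarith
  have "- support_fun P (- x) \<le> \<psi> x - \<psi> 0" for x using PLipD[OF assms(1), of 0 x] by simp
  then have "M (\<lambda>x. - support_fun P (- x)) \<le> M (\<lambda>x. \<psi> x - \<psi> 0)"
    by (intro M_mono PLip_diff_const assms PLip_support_uminus)
  then have "ln (M (\<lambda>x. - support_fun P (- x))) \<le> - (\<beta> * \<psi> 0)"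
    using M_pos[OF PLip_support_uminus] unfolding * by (metis ln_exp ln_mono exp_gt_zero)
  then have "\<psi> 0 \<le> - ln (M (\<lambda>x. - support_fun P (- x))) / \<beta>" using beta_pos by (simp add: field_simps)
  then show "\<psi> 0 \<le> M_bound" unfolding M_bound_def by linarith
qed

text \<open>Finitely many balls of half the radius cover the compact ball and each has positive
  mass. A ball of radius \<open>\<rho>\<close> centred in the compact ball contains the covering
  ball in which its centre lies.\<close>

lemma ball_mass_lower:
  assumes "0 < \<rho>"
  shows "\<exists>\<kappa>>0. \<forall>x\<in>cball 0 R. \<kappa> \<le> emeasure \<nu> (ball x \<rho>)"
proof -
  obtain k where k: "finite k" "cball (0::real^'n) R \<subseteq> (\<Union>x\<in>k. ball x (\<rho> / 2))"
  proof (rule compactE_image[OF compact_cball, of UNIV "\<lambda>y. ball y (\<rho> / 2)" 0 R])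
    show "cball (0::real^'n) R \<subseteq> (\<Union>y\<in>UNIV. ball y (\<rho> / 2))" 
    proof
      fix x :: "real^'n"
      have "x \<in> ball x (\<rho> / 2)" using assms by simp
      then show "x \<in> (\<Union>y\<in>UNIV. ball y (\<rho> / 2))" by blast
    qed
  qed auto
  define \<kappa> where "\<kappa> = Min (insert 1 ((\<lambda>y. emeasure \<nu> (ball y (\<rho> / 2))) ` k))"
  have "0 < \<kappa>" unfolding \<kappa>_def using k(1) nu_open_pos assms by (subst Min_gr_iff) auto
  moreover have "\<kappa> \<le> emeasure \<nu> (ball x \<rho>)" if x: "x \<in> cball 0 R" for x
  proof -
    obtain y where y: "y \<in> k" "x \<in> ball y (\<rho> / 2)" using k x by blast
    have "\<kappa> \<le> emeasure \<nu> (ball y (\<rho> / 2))" unfolding \<kappa>_def using k(1) y(1) by (intro Min_le) auto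
    also have "ball y (\<rho> / 2) \<subseteq> ball x \<rho>"
    proof
      fix z assume "z \<in> ball y (\<rho> / 2)"
      then show "z \<in> ball x \<rho>" using y(2) dist_triangle[of x z y] by (simp add: dist_commute)
    qed
    then have "emeasure \<nu> (ball y (\<rho> / 2)) \<le> emeasure \<nu> (ball x \<rho>)" by (intro emeasure_mono) auto
    finally show ?thesis .
  qed
  ultimately show ?thesis by blast
qed

text \<open>Functions that are uniformly Lipschitz are locally uniformly close as soon as their
  Hellinger distance is small.\<close>
lemma hellinger_control:
  assumes "0 < \<epsilon>"
  shows "\<exists>\<delta>>0. \<forall>u w. PLip P u \<and> PLip P w \<and> - C \<le> u 0 \<and> - C \<le> w 0 \<and>
    (\<integral>\<^sup>+x. ennreal ((exp (\<beta> * u x / 2) - exp (\<beta> * w x / 2))\<^sup>2) \<partial>\<nu>) \<le> ennreal \<delta>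
    \<longrightarrow> (\<forall>x\<in>cball 0 R. \<bar>u x - w x\<bar> \<le> \<epsilon>)"
proof -
  \<comment> \<open>Within this distance \<open>u\<close> and \<open>w\<close> each change by at
    most \<open>\<epsilon> / 4\<close>, so a gap above \<open>\<epsilon>\<close> at the centre
    remains at least \<open>\<epsilon> / 2\<close> on the whole ball.\<close>
  define \<rho> where "\<rho> = \<epsilon> / (4 * L)"
  have \<rho>: "0 < \<rho>" "L * \<rho> = \<epsilon> / 4" using assms L_pos by (auto simp: \<rho>_def)
  obtain \<kappa> where \<kappa>: "0 < \<kappa>" "\<And>x. x \<in> cball 0 R \<Longrightarrow> \<kappa> \<le> emeasure \<nu> (ball x \<rho>)"
    using ball_mass_lower[OF \<rho>(1)] by blast
  \<comment> \<open>Lower bound on that ball for the difference of the square-root densities,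
    factored as \<open>exp (\<beta> * w y / 2) * (exp (\<beta> * (u y - w y) / 2) - 1)\<close>. The
    first factor uses \<open>w y \<ge> - (C + L * (R + \<rho>))\<close>, the second the remaining
    gap \<open>\<epsilon> / 2\<close>.\<close>
  define d where "d = exp (- \<beta> * (C + L * (R + \<rho>)) / 2) * (exp (\<beta> * \<epsilon> / 4) - 1)"
  have d: "0 < d" using beta_pos assms by (simp add: d_def)
  have "0 < ennreal (d\<^sup>2) * \<kappa>" using d \<kappa>(1) by (simp add: ennreal_zero_less_mult_iff)
  then obtain \<delta>' where \<delta>': "0 < \<delta>'" "\<delta>' < ennreal (d\<^sup>2) * \<kappa>" using dense by blast
  then have "\<delta>' < top" by (meson order_less_le_trans top_greatest)
  then obtain \<delta> where \<delta>: "0 \<le> \<delta>" "\<delta>' = ennreal \<delta>" using less_top_ennreal by blast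
  have one_sided: "u x - w x \<le> \<epsilon>"
    if u: "PLip P u" "PLip P w" "- C \<le> w 0"
      and int: "(\<integral>\<^sup>+x. ennreal ((exp (\<beta> * u x / 2) - exp (\<beta> * w x / 2))\<^sup>2) \<partial>\<nu>) \<le> ennreal \<delta>"
      and x: "x \<in> cball 0 R" for u w x
  proof (rule ccontr)
    assume "\<not> u x - w x \<le> \<epsilon>"
    have "d\<^sup>2 \<le> (exp (\<beta> * u y / 2) - exp (\<beta> * w y / 2))\<^sup>2" if y: "y \<in> ball x \<rho>" for y
    proof -
      have xy: "norm (x - y) \<le> \<rho>" using y by (simp add: dist_norm)
      then have Lxy: "L * norm (x - y) \<le> \<epsilon> / 4" using L_pos \<rho>(2) by (metis less_imp_le mult_left_mono)
      have uw: "u y - w y \<ge> \<epsilon> / 2"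
        using lipschitz[OF u(1), of x y] lipschitz[OF u(2), of x y] Lxy \<open>\<not> u x - w x \<le> \<epsilon>\<close> by linarith
      have "norm y \<le> R + \<rho>" using x xy norm_triangle_ineq4[of x "x - y"] by simp
      then have "L * norm y \<le> L * (R + \<rho>)" using L_pos by simp
      then have w: "- (C + L * (R + \<rho>)) \<le> w y" using lipschitz[OF u(2), of y 0] u(3) by simp
      then have 1: "exp (- \<beta> * (C + L * (R + \<rho>)) / 2) \<le> exp (\<beta> * w y / 2)"
        using mult_left_mono[OF w less_imp_le[OF beta_pos]]
        by (simp only: exp_le_cancel_iff mult_minus_left mult_minus_right divide_right_mono)
      have 2: "exp (\<beta> * \<epsilon> / 4) - 1 \<le> exp (\<beta> * (u y - w y) / 2) - 1"
        using mult_left_mono[OF uw, of \<beta>] beta_pos by simp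
      have "d \<le> exp (\<beta> * w y / 2) * (exp (\<beta> * (u y - w y) / 2) - 1)"
        unfolding d_def using 1 2 beta_pos assms by (intro mult_mono) auto
      also have "\<dots> = exp (\<beta> * u y / 2) - exp (\<beta> * w y / 2)"
        by (simp add: right_diff_distrib exp_add[symmetric] add_divide_distrib[symmetric])
      finally show ?thesis using d by (intro power_mono) auto
    qed
    then have "(\<integral>\<^sup>+y. ennreal (d\<^sup>2) * indicator (ball x \<rho>) y \<partial>\<nu>)
        \<le> (\<integral>\<^sup>+x. ennreal ((exp (\<beta> * u x / 2) - exp (\<beta> * w x / 2))\<^sup>2) \<partial>\<nu>)"
      by (intro nn_integral_mono) (auto split: split_indicator intro!: ennreal_leI)
    also have "\<dots> \<le> ennreal \<delta>" by (rule int)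
    also have "\<dots> < ennreal (d\<^sup>2) * \<kappa>" using \<delta>' \<delta> by simp
    also have "\<dots> \<le> ennreal (d\<^sup>2) * emeasure \<nu> (ball x \<rho>)" using \<kappa>(2)[OF x] by (intro mult_left_mono) auto
    also have "\<dots> = (\<integral>\<^sup>+y. ennreal (d\<^sup>2) * indicator (ball x \<rho>) y \<partial>\<nu>)"
      by (subst nn_integral_cmult_indicator) auto
    finally show False by simp
  qed
  show ?thesis
  proof (intro exI[of _ \<delta>] conjI allI impI ballI)
    show "0 < \<delta>" using \<delta>' \<delta> by auto
    fix u w :: "real^'n \<Rightarrow> real" and x :: "real^'n"
    assume *: "PLip P u \<and> PLip P w \<and> - C \<le> u 0 \<and> - C \<le> w 0 \<and>
      (\<integral>\<^sup>+x. ennreal ((exp (\<beta> * u x / 2) - exp (\<beta> * w x / 2))\<^sup>2) \<partial>\<nu>) \<le> ennreal \<delta>" "x \<in> cball 0 R"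
    have "(\<integral>\<^sup>+x. ennreal ((exp (\<beta> * w x / 2) - exp (\<beta> * u x / 2))\<^sup>2) \<partial>\<nu>) \<le> ennreal \<delta>"
      using * by (simp add: power2_commute)
    then show "\<bar>u x - w x\<bar> \<le> \<epsilon>" using one_sided[of u w x] one_sided[of w u x] * by (auto simp: abs_le_iff)
  qed
qed

section \<open>Solutions and the comparison principle\<close>

definition is_solution :: "(real^'n \<Rightarrow> real) \<Rightarrow> bool" where
  "is_solution \<phi> \<longleftrightarrow> convex_on UNIV \<phi> \<and> (\<forall>x. subgradients \<phi> x \<subseteq> P) \<and>
     emeasure (MA \<phi>) UNIV = 1 \<and> MA \<phi> = wt \<phi>"

lemma solution_continuous: "is_solution \<phi> \<Longrightarrow> continuous_on UNIV \<phi>"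
  by (auto simp: is_solution_def intro: convex_on_continuous)

text \<open>The subgradient range is contained in \<open>P\<close> and has measure 1, which is also
  the volume of \<open>P\<close>; only a null set can be missing.\<close>

lemma subgrad_range_null:
  assumes "is_solution \<psi>"
  shows "P - (\<Union>x. subgradients \<psi> x) \<in> null_sets lebesgue"
proof -
  let ?S = "\<Union>x\<in>UNIV. subgradients \<psi> x"
  have cont: "continuous_on UNIV \<psi>" by (rule solution_continuous[OF assms])
  have meas: "?S \<in> sets lebesgue" by (intro sets_subgradients_image cont) simp
  have S1: "emeasure lebesgue ?S = 1"
    using assms emeasure_MA[OF cont, of UNIV] by (simp only: is_solution_def) auto
  have P1: "emeasure lebesgue P = 1" using volume_P by simp
  have "?S \<subseteq> P" using assms by (auto simp: is_solution_def)
  then have "emeasure lebesgue (P - ?S) = 0" using meas S1 P1 by (subst emeasure_Diff) auto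
  then show ?thesis using meas P_borel by (intro null_setsI sets.Diff) auto
qed

text \<open>Comparison: where \<open>\<psi> < \<phi>\<close>, subgradients of \<open>\<phi>\<close> are also subgradients of \<open>\<psi>\<close>, because a
  minimiser of \<open>\<psi> - \<langle>y, \<cdot>\<rangle>\<close> must lie in the set \<open>{\<psi> < \<phi>}\<close>.\<close>
lemma solution_le:
  assumes "is_solution \<phi>" "is_solution \<psi>"
  shows "\<phi> x \<le> \<psi> x"
proof (rule ccontr)
  assume nle: "\<not> \<phi> x \<le> \<psi> x"
  have cont: "continuous_on UNIV \<phi>" "continuous_on UNIV \<psi>" by (rule solution_continuous[OF assms(1)], rule solution_continuous[OF assms(2)])
  note [measurable] = borel_measurable_continuous_onI[OF cont(1)] borel_measurable_continuous_onI[OF cont(2)]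
  define U where "U = {x. \<psi> x < \<phi> x}"
  have U: "open U" "U \<noteq> {}" unfolding U_def using nle cont by (auto intro!: open_Collect_less simp: not_le)
  have [measurable]: "U \<in> sets borel" using U by simp
  let ?S = "\<lambda>\<phi> E. (\<Union>x\<in>E. subgradients \<phi> x)"
  have null: "P - ?S \<psi> UNIV \<in> null_sets lebesgue" by (rule subgrad_range_null[OF assms(2)])
  have sub: "?S \<phi> U \<subseteq> P" using assms by (auto simp: is_solution_def)
  have meas: "?S \<psi> U \<in> sets lebesgue" by (intro sets_subgradients_image cont) measurable
  have "?S \<phi> U \<subseteq> ?S \<psi> U \<union> (P - ?S \<psi> UNIV)"
  proof
    fix y assume y: "y \<in> ?S \<phi> U"
    show "y \<in> ?S \<psi> U \<union> (P - ?S \<psi> UNIV)"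
    proof (cases "y \<in> ?S \<psi> UNIV")
      case True
      then obtain a where a: "y \<in> subgradients \<psi> a" by blast
      obtain b where b: "b \<in> U" "y \<in> subgradients \<phi> b" using y by blast
      have "\<psi> a + y \<bullet> (b - a) \<le> \<psi> b" "\<phi> b + y \<bullet> (a - b) \<le> \<phi> a" "\<psi> b < \<phi> b"
        using a b by (auto simp: U_def dest: subgradientsD)
      then have "a \<in> U" by (simp add: U_def inner_diff_right)
      then show ?thesis using a by blast
    qed (use sub y in blast)
  qed
  then have "emeasure lebesgue (?S \<phi> U) \<le> emeasure lebesgue (?S \<psi> U \<union> (P - ?S \<psi> UNIV))"
    using meas null by (intro emeasure_mono sets.Un) (auto intro: null_setsD2)
  also have "\<dots> = emeasure lebesgue (?S \<psi> U)"
    by (intro emeasure_Un_null_set null meas)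
  finally have "emeasure (MA \<phi>) U \<le> emeasure (MA \<psi>) U"
    using emeasure_MA[OF cont(1), of U] emeasure_MA[OF cont(2), of U] by simp
  \<comment> \<open>The equation turns the comparison of images into one of densities. But on
    \<open>U\<close> the density of \<open>\<phi>\<close> is strictly larger than that of
    \<open>\<psi>\<close>, so the integrals can only agree if \<open>U\<close> is
    \<open>\<nu>\<close>-null, and a nonempty open set is not.\<close>
  then have le: "(\<integral>\<^sup>+x. ennreal (exp (\<beta> * \<phi> x)) * indicator U x \<partial>\<nu>)
      \<le> (\<integral>\<^sup>+x. ennreal (exp (\<beta> * \<psi> x)) * indicator U x \<partial>\<nu>)"
    using assms by (simp add: is_solution_def wt_def emeasure_density)
  have "emeasure (wt \<psi>) U \<le> emeasure (wt \<psi>) UNIV" by (intro emeasure_mono) auto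
  then have fin: "(\<integral>\<^sup>+x. ennreal (exp (\<beta> * \<psi> x)) * indicator U x \<partial>\<nu>) \<noteq> \<infinity>"
    using assms(2) by (auto simp: is_solution_def wt_def emeasure_density top_unique)
  have "(\<integral>\<^sup>+x. (ennreal (exp (\<beta> * \<phi> x)) * indicator U x - ennreal (exp (\<beta> * \<psi> x)) * indicator U x) \<partial>\<nu>)
      = (\<integral>\<^sup>+x. ennreal (exp (\<beta> * \<phi> x)) * indicator U x \<partial>\<nu>)
        - (\<integral>\<^sup>+x. ennreal (exp (\<beta> * \<psi> x)) * indicator U x \<partial>\<nu>)"
    using fin beta_pos
    by (intro nn_integral_diff) (auto simp: U_def split: split_indicator intro!: AE_I2 ennreal_leI)
  also have "\<dots> = 0" using le fin by (subst diff_eq_0_iff_ennreal) (auto simp: less_top intro: le_less_trans)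
  finally have "AE x in \<nu>. ennreal (exp (\<beta> * \<phi> x)) * indicator U x - ennreal (exp (\<beta> * \<psi> x)) * indicator U x = 0"
    by (subst (asm) nn_integral_0_iff_AE) auto
  moreover have "ennreal (exp (\<beta> * \<phi> x)) * indicator U x - ennreal (exp (\<beta> * \<psi> x)) * indicator U x \<noteq> 0"
    if "x \<in> U" for x
    using that beta_pos by (auto simp: U_def ennreal_minus ennreal_eq_0_iff)
  ultimately have "AE x in \<nu>. x \<notin> U" by auto
  then have "U \<in> null_sets \<nu>" by (subst AE_iff_null_sets) auto
  with nu_open_pos[OF U] show False by auto
qed

end

lemma convex_on_diff_const: "convex_on UNIV \<psi> \<Longrightarrow> convex_on UNIV (\<lambda>x. \<psi> x - c)" for c :: real
proof (rule convex_onI)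
  fix t :: real and x y assume "convex_on UNIV \<psi>" "0 < t" "t < 1"
  then have "\<psi> ((1 - t) *\<^sub>R x + t *\<^sub>R y) \<le> (1 - t) * \<psi> x + t * \<psi> y" by (intro convex_onD) auto
  then show "\<psi> ((1 - t) *\<^sub>R x + t *\<^sub>R y) - c \<le> (1 - t) * (\<psi> x - c) + t * (\<psi> y - c)"
    by (simp add: algebra_simps)
qed simp

lemma convex_on_midpoint:
  fixes \<phi> \<psi> :: "'a::real_vector \<Rightarrow> real"
  assumes "convex_on UNIV \<phi>" "convex_on UNIV \<psi>"
  shows "convex_on UNIV (\<lambda>x. (\<phi> x + \<psi> x) / 2)"
  using convex_on_cmul[OF _ convex_on_add[OF assms], of "1/2"] by (simp add: divide_simps mult.commute)

context ma_equation
begin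

section \<open>Existence\<close>

text \<open>The Legendre transform shifted by \<open>M_bound\<close>. For normalised
  \<open>\<psi>\<close> the term at \<open>x = 0\<close> is already nonnegative, so the cut-off at 0
  hidden in \<open>ennreal\<close> changes nothing, while the value infinity stays available on the
  boundary of \<open>P\<close>.\<close>

definition H :: "(real^'n \<Rightarrow> real) \<Rightarrow> real^'n \<Rightarrow> ennreal" where
  "H \<psi> p = (SUP x. ennreal (x \<bullet> p - \<psi> x + M_bound))"

text \<open>The functional \<open>\<integral>\<^sub>P \<psi>\<^sup>* + const\<close>, where \<open>\<psi>\<^sup>*\<close> is the Legendre transform.\<close>
definition J :: "(real^'n \<Rightarrow> real) \<Rightarrow> ennreal" where
  "J \<psi> = (\<integral>\<^sup>+p. H \<psi> p * indicator P p \<partial>lborel)"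

definition normalized :: "(real^'n \<Rightarrow> real) \<Rightarrow> bool" where
  "normalized \<psi> \<longleftrightarrow> convex_on UNIV \<psi> \<and> PLip P \<psi> \<and> M \<psi> = 1"

lemma normalized_PLip: "normalized \<psi> \<Longrightarrow> PLip P \<psi>"
  by (simp add: normalized_def)

lemma normalized_le: "normalized \<psi> \<Longrightarrow> \<psi> 0 \<le> M_bound"
  by (simp add: normalized_def normalized_bounds)

lemma normalized_diff:
  assumes "convex_on UNIV \<psi>" "PLip P \<psi>"
  shows "normalized (\<lambda>x. \<psi> x - ln (M \<psi>) / \<beta>)"
  unfolding normalized_def M_diff_const
  using M_pos[OF assms(2)] beta_pos assms
  by (auto intro: convex_on_diff_const PLip_diff_const simp: exp_minus)

lemma H_measurable [measurable]: "H \<psi> \<in> borel_measurable borel"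
proof (rule borel_measurableI_greater)
  fix y
  have "{p. y < H \<psi> p} = (\<Union>x. {p. y < ennreal (x \<bullet> p - \<psi> x + M_bound)})"
    by (auto simp: H_def less_SUP_iff)
  moreover have "open {p. y < ennreal (x \<bullet> p - \<psi> x + M_bound)}" for x
    by (intro open_Collect_less continuous_on_ennreal continuous_intros)
  ultimately show "{p \<in> space borel. y < H \<psi> p} \<in> sets borel"
    by (auto intro!: borel_open open_UN)
qed

lemma H_leI: "(\<And>x. x \<bullet> p - \<psi> x + M_bound \<le> a) \<Longrightarrow> H \<psi> p \<le> ennreal a"
  unfolding H_def by (intro SUP_least ennreal_leI)

lemma H_upper: "ennreal (x \<bullet> p - \<psi> x + M_bound) \<le> H \<psi> p"
  unfolding H_def by (rule SUP_upper) simp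

lemma J_support_finite: "J (\<lambda>x. support_fun P x - c) < \<infinity>"
proof -
  have "J (\<lambda>x. support_fun P x - c) \<le> (\<integral>\<^sup>+p. ennreal (c + M_bound) * indicator P p \<partial>lborel)"
    unfolding J_def
  proof (intro nn_integral_mono)
    fix p
    have "H (\<lambda>x. support_fun P x - c) p \<le> ennreal (c + M_bound)" if "p \<in> P"
      using inner_le_support_fun[OF compact_P that] by (intro H_leI) (simp add: algebra_simps)
    then show "H (\<lambda>x. support_fun P x - c) p * indicator P p \<le> ennreal (c + M_bound) * indicator P p"
      by (auto split: split_indicator)
  qed
  also have "\<dots> = ennreal (c + M_bound)" by (subst nn_integral_cmult_indicator) (auto simp: volume_P)
  finally show ?thesis by (simp add: le_less_trans)
qed

text \<open>The integrand equals \<open>exp (\<beta> * u x) + exp (\<beta> * w x) - 2 * exp (\<beta>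
  * v x)\<close> with \<open>v\<close> the midpoint, so the integral is \<open>2 - 2 * M v\<close>.
  Normalising \<open>v\<close> means subtracting \<open>c = ln (M v) / \<beta> \<le> 0\<close>,
  which lowers the transform by \<open>- c\<close>. Since the infimum \<open>m\<close> cannot be
  undercut, \<open>- c \<le> e\<close>, and
  \<open>1 - M v \<le> - ln (M v) \<le> \<beta> * e\<close>.\<close>

lemma midpoint_M:
  assumes u: "normalized u" and w: "normalized w"
    and min: "\<And>\<psi>. normalized \<psi> \<Longrightarrow> m \<le> J \<psi>" and m: "m < \<infinity>"
    and e: "0 \<le> e" "J u \<le> m + ennreal e" "J w \<le> m + ennreal e"
  shows "(\<integral>\<^sup>+x. ennreal ((exp (\<beta> * u x / 2) - exp (\<beta> * w x / 2))\<^sup>2) \<partial>\<nu>) \<le> ennreal (2 * \<beta> * e)"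
proof -
  define v where "v = (\<lambda>x. (u x + w x) / 2)"
  define c where "c = ln (M v) / \<beta>"
  note U = u[unfolded normalized_def] and W = w[unfolded normalized_def]
  have v: "convex_on UNIV v" "PLip P v"
    unfolding v_def using U W by (auto intro: convex_on_midpoint PLip_midpoint)
  have int: "integrable \<nu> (\<lambda>x. exp (\<beta> * u x))" "integrable \<nu> (\<lambda>x. exp (\<beta> * w x))"
      "integrable \<nu> (\<lambda>x. exp (\<beta> * v x))"
    using U W v by (auto intro: integrable_exp)
  have sq: "(exp (\<beta> * u x / 2) - exp (\<beta> * w x / 2))\<^sup>2 = exp (\<beta> * u x) + exp (\<beta> * w x) - 2 * exp (\<beta> * v x)" for x
    by (simp add: power2_diff v_def exp_double[symmetric] exp_add[symmetric] field_simps)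
  have eq: "(\<integral>\<^sup>+x. ennreal ((exp (\<beta> * u x / 2) - exp (\<beta> * w x / 2))\<^sup>2) \<partial>\<nu>) = ennreal (2 - 2 * M v)"
    and "0 \<le> 2 - 2 * M v"
  proof -
    have *: "(\<integral>x. (exp (\<beta> * u x / 2) - exp (\<beta> * w x / 2))\<^sup>2 \<partial>\<nu>) = 2 - 2 * M v"
      unfolding sq using int U W by (simp add: M_def)
    have "integrable \<nu> (\<lambda>x. (exp (\<beta> * u x / 2) - exp (\<beta> * w x / 2))\<^sup>2)"
      unfolding sq using int by simp
    then show "(\<integral>\<^sup>+x. ennreal ((exp (\<beta> * u x / 2) - exp (\<beta> * w x / 2))\<^sup>2) \<partial>\<nu>) = ennreal (2 - 2 * M v)"
      by (subst nn_integral_eq_integral) (auto simp: *)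
    show "0 \<le> 2 - 2 * M v" unfolding *[symmetric] by simp
  qed
  have c: "c \<le> 0" unfolding c_def using \<open>0 \<le> 2 - 2 * M v\<close> M_pos[OF v(2)] beta_pos
    by (simp add: divide_le_0_iff)
  have nv: "normalized (\<lambda>x. v x - c)" unfolding c_def by (rule normalized_diff[OF v])
  \<comment> \<open>The gain \<open>- c\<close> stands on the left as a nonnegative summand because
    subtraction in \<open>ennreal\<close> truncates.\<close>
  have pt: "2 * H (\<lambda>x. v x - c) p + 2 * ennreal (- c) \<le> H u p + H w p" for p
  proof (cases "H u p = top \<or> H w p = top")
    case False
    define a b where "a = enn2real (H u p)" and "b = enn2real (H w p)"
    have ab: "H u p = ennreal a" "H w p = ennreal b" "0 \<le> a" "0 \<le> b"
      using False by (simp_all add: a_def b_def less_top)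
    have le: "x \<bullet> p - u x + M_bound \<le> a" "x \<bullet> p - w x + M_bound \<le> b" for x
      using H_upper[of x p u] H_upper[of x p w] ab by (auto simp: ennreal_le_iff)
    have le2: "x \<bullet> p - (v x - c) + M_bound \<le> (a + b) / 2 + c" for x
      using le[of x] by (simp add: v_def field_simps)
    have "0 \<le> (a + b) / 2 + c" using order_trans[OF _ le2[of 0], of 0] normalized_le[OF nv] by simp
    have "2 * H (\<lambda>x. v x - c) p + 2 * ennreal (- c) \<le> 2 * ennreal ((a + b) / 2 + c) + 2 * ennreal (- c)"
      by (intro add_mono mult_left_mono H_leI le2) auto
    also have "\<dots> = 2 * ennreal ((a + b) / 2 + c + (- c))"
      using \<open>0 \<le> (a + b) / 2 + c\<close> c by (subst ennreal_plus) (auto simp: distrib_left)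
    also have "\<dots> = ennreal (a + b)" 
    proof -
      have "2 * ennreal z = ennreal (2 * z)" for z by (metis ennreal_mult' ennreal_numeral zero_le_numeral)
      moreover have "2 * ((a + b) / 2 + c + - c) = a + b" by simp
      ultimately show ?thesis by metis
    qed
    also have "\<dots> = H u p + H w p" using ab by (simp add: ennreal_plus[symmetric] del: ennreal_plus)
    finally show ?thesis .
  qed auto
  have "2 * J (\<lambda>x. v x - c) + 2 * ennreal (- c)
      = (\<integral>\<^sup>+p. (2 * H (\<lambda>x. v x - c) p) * indicator P p \<partial>lborel) + (\<integral>\<^sup>+p. (2 * ennreal (- c)) * indicator P p \<partial>lborel)"
    unfolding J_def by (simp add: nn_integral_cmult nn_integral_cmult_indicator volume_P mult.assoc)
  also have "\<dots> = (\<integral>\<^sup>+p. (2 * H (\<lambda>x. v x - c) p + 2 * ennreal (- c)) * indicator P p \<partial>lborel)"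
    by (subst nn_integral_add[symmetric]) (auto simp: distrib_right)
  also have "\<dots> \<le> (\<integral>\<^sup>+p. (H u p + H w p) * indicator P p \<partial>lborel)"
    by (intro nn_integral_mono mult_right_mono pt) auto
  also have "\<dots> = J u + J w"
    unfolding J_def distrib_right by (subst nn_integral_add) auto
  also have "\<dots> \<le> (m + ennreal e) + (m + ennreal e)" by (intro add_mono e)
  finally have "2 * J (\<lambda>x. v x - c) + 2 * ennreal (- c) \<le> (m + ennreal e) + (m + ennreal e)" .
  then have "2 * m + 2 * ennreal (- c) \<le> (m + ennreal e) + (m + ennreal e)"
    using min[OF nv] by (meson add_mono_thms_linordered_semiring(3) mult_left_mono order_trans zero_le)
  moreover define m' where "m' = enn2real m"
  have "m = ennreal m'" "0 \<le> m'" using m by (auto simp: m'_def)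
  ultimately have "ennreal (2 * m' + 2 * (- c)) \<le> ennreal (2 * m' + 2 * e)"
    using c e(1) by (simp add: ennreal_plus[symmetric] ennreal_mult[symmetric] ennreal_numeral[symmetric] 
        del: ennreal_plus ennreal_numeral)
  then have "- c \<le> e" using \<open>0 \<le> m'\<close> e(1) by (subst (asm) ennreal_le_iff) auto
  then have "- (\<beta> * e) \<le> ln (M v)" using beta_pos by (simp add: c_def field_simps)
  then have "1 - M v \<le> \<beta> * e" using ln_le_minus_one[OF M_pos[OF v(2)]] by simp
  then show ?thesis unfolding eq by (intro ennreal_leI) simp
qed

text \<open>A minimising sequence converges pointwise by \<open>midpoint_M\<close> and
  \<open>hellinger_control\<close>. Since \<open>normalized_bounds\<close> controls the values at 0,
  a multiple of the exponential of the support function dominates, so the mass 1 survives in the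
  limit. Fatou's lemma gives lower semicontinuity of \<open>J\<close>, because every affine term in
  the supremum converges.\<close>

lemma minimiser_exists:
  "\<exists>\<psi>. normalized \<psi> \<and> J \<psi> < \<infinity> \<and> (\<forall>\<psi>'. normalized \<psi>' \<longrightarrow> J \<psi> \<le> J \<psi>')"
proof -
  define m where "m = (INF \<psi>\<in>Collect normalized. J \<psi>)"
  have min: "m \<le> J \<psi>" if "normalized \<psi>" for \<psi> unfolding m_def using that by (intro INF_lower) auto
  have "normalized (\<lambda>x. support_fun P x - ln (M (support_fun P)) / \<beta>)"
    by (intro normalized_diff PLip_support convex_support_fun compact_P P_nonempty)
  then have m: "m < \<infinity>" using min J_support_finite by (meson le_less_trans)
  have "\<exists>\<psi>. normalized \<psi> \<and> J \<psi> \<le> m + ennreal (1 / real (Suc j))" for j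
  proof -
    have "m < m + ennreal (1 / real (Suc j))" using m by (cases m) (auto simp: ennreal_plus[symmetric] ennreal_less_iff simp del: ennreal_plus)
    then show ?thesis unfolding m_def INF_less_iff by (auto intro: less_imp_le)
  qed
  then obtain f where f: "\<And>j. normalized (f j)" "\<And>j. J (f j) \<le> m + ennreal (1 / real (Suc j))"
    by metis
  have Pf: "PLip P (f j)" for j using f(1) by (rule normalized_PLip)
  have bd: "- M_bound \<le> f j 0" "f j 0 \<le> M_bound" for j using f(1)[of j] normalized_bounds by (auto simp: normalized_def)
  have "Cauchy (\<lambda>j. f j x)" for x
  proof (rule CauchyI)
    fix \<epsilon> :: real assume "0 < \<epsilon>"
    then obtain \<delta> where \<delta>: "0 < \<delta>" "\<And>u w. PLip P u \<and> PLip P w \<and> - M_bound \<le> u 0 \<and> - M_bound \<le> w 0 \<and>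
        (\<integral>\<^sup>+x. ennreal ((exp (\<beta> * u x / 2) - exp (\<beta> * w x / 2))\<^sup>2) \<partial>\<nu>) \<le> ennreal \<delta>
        \<longrightarrow> (\<forall>y\<in>cball 0 (norm x). \<bar>u y - w y\<bar> \<le> \<epsilon> / 2)"
      using hellinger_control[of "\<epsilon> / 2" M_bound "norm x"] by auto
    \<comment> \<open>An excess of at most \<open>1 / (k + 1)\<close> bounds the squared Hellinger
      integral by \<open>2 * \<beta> / (k + 1)\<close>, which has to be at most
      \<open>\<delta>\<close>.\<close>
    obtain k :: nat where k: "real k > 2 * \<beta> / \<delta>" using reals_Archimedean2 by blast
    have "norm (f i x - f j x) < \<epsilon>" if ij: "i \<ge> k" "j \<ge> k" for i j
    proof -
      have "1 / real (Suc i) \<le> 1 / real (Suc k)" "1 / real (Suc j) \<le> 1 / real (Suc k)"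
        using ij by (auto simp: frac_le)
      then have "J (f i) \<le> m + ennreal (1 / real (Suc k))" "J (f j) \<le> m + ennreal (1 / real (Suc k))"
        using f(2)[of i] f(2)[of j] by (meson add_left_mono ennreal_leI order_trans)+
      then have "(\<integral>\<^sup>+x. ennreal ((exp (\<beta> * f i x / 2) - exp (\<beta> * f j x / 2))\<^sup>2) \<partial>\<nu>) \<le> ennreal (2 * \<beta> * (1 / real (Suc k)))"
        by (intro midpoint_M[OF f(1) f(1) min m]) auto
      also have "2 * \<beta> * (1 / real (Suc k)) \<le> \<delta>"
      proof -
        have "2 * \<beta> < real k * \<delta>" using k \<delta>(1) by (simp add: field_simps)
        also have "\<dots> \<le> real (Suc k) * \<delta>" using \<delta>(1) by simp
        finally show ?thesis by (simp add: field_simps)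
      qed
      finally have "\<bar>f i x - f j x\<bar> \<le> \<epsilon> / 2"
        using \<delta>(2)[of "f i" "f j"] Pf bd by (auto simp: ennreal_leI)
      then show ?thesis using \<open>0 < \<epsilon>\<close> by simp
    qed
    then show "\<exists>k. \<forall>i\<ge>k. \<forall>j\<ge>k. norm (f i x - f j x) < \<epsilon>" by blast
  qed
  then have "convergent (\<lambda>j. f j x)" for x by (rule Cauchy_convergent)
  then obtain \<psi> where \<psi>: "\<And>x. (\<lambda>j. f j x) \<longlonglongrightarrow> \<psi> x" unfolding convergent_def by metis
  have PL: "PLip P \<psi>"
    unfolding PLip_def
  proof (intro allI)
    fix x y
    show "\<psi> x - \<psi> y \<le> support_fun P (x - y)"
      by (rule LIMSEQ_le_const2[OF tendsto_diff[OF \<psi> \<psi>]]) (auto intro: PLipD[OF Pf])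
  qed
  have cv: "convex_on UNIV \<psi>"
  proof (rule convex_onI)
    fix t :: real and x y assume t: "0 < t" "t < 1"
    show "\<psi> ((1 - t) *\<^sub>R x + t *\<^sub>R y) \<le> (1 - t) * \<psi> x + t * \<psi> y"
    proof (rule LIMSEQ_le[OF \<psi>])
      show "(\<lambda>j. (1 - t) * f j x + t * f j y) \<longlonglongrightarrow> (1 - t) * \<psi> x + t * \<psi> y"
        by (intro tendsto_intros \<psi>)
      show "\<exists>N. \<forall>n\<ge>N. f n ((1 - t) *\<^sub>R x + t *\<^sub>R y) \<le> (1 - t) * f n x + t * f n y"
        using f(1) t by (intro exI[of _ 0] allI impI convex_onD) (auto simp: normalized_def)
    qed
  qed simp
  have "(\<lambda>j. M (f j)) \<longlonglongrightarrow> M \<psi>"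
    unfolding M_def
  proof (rule integral_dominated_convergence[where w = "\<lambda>x. exp (\<beta> * M_bound) * exp (\<beta> * support_fun P x)"])
    show "AE x in \<nu>. (\<lambda>i. exp (\<beta> * f i x)) \<longlonglongrightarrow> exp (\<beta> * \<psi> x)"
      by (intro AE_I2 tendsto_intros \<psi>)
    show "AE x in \<nu>. norm (exp (\<beta> * f i x)) \<le> exp (\<beta> * M_bound) * exp (\<beta> * support_fun P x)" for i
    proof (rule AE_I2)
      fix x
      have "exp (\<beta> * f i x) \<le> exp (\<beta> * f i 0) * exp (\<beta> * support_fun P x)" by (rule exp_le_support[OF Pf])
      also have "\<dots> \<le> exp (\<beta> * M_bound) * exp (\<beta> * support_fun P x)"
        using bd(2)[of i] beta_pos by (intro mult_right_mono) auto
      finally show "norm (exp (\<beta> * f i x)) \<le> exp (\<beta> * M_bound) * exp (\<beta> * support_fun P x)" by simp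
    qed
  qed (use borel[OF PL] borel[OF Pf] integrable_support in auto)
  moreover have "M (f j) = 1" for j using f(1) by (simp add: normalized_def)
  ultimately have "M \<psi> = 1" by (simp add: LIMSEQ_const_iff)
  then have n\<psi>: "normalized \<psi>" using PL cv by (simp add: normalized_def)
  have Hle: "H \<psi> p \<le> liminf (\<lambda>j. H (f j) p)" for p
    unfolding H_def[of \<psi>]
  proof (rule SUP_least)
    fix x
    have "(\<lambda>j. ennreal (x \<bullet> p - f j x + M_bound)) \<longlonglongrightarrow> ennreal (x \<bullet> p - \<psi> x + M_bound)"
      by (intro tendsto_ennrealI tendsto_intros \<psi>)
    then have "ennreal (x \<bullet> p - \<psi> x + M_bound) = liminf (\<lambda>j. ennreal (x \<bullet> p - f j x + M_bound))"
      by (intro lim_imp_Liminf[symmetric]) auto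
    also have "\<dots> \<le> liminf (\<lambda>j. H (f j) p)" by (intro Liminf_mono always_eventually allI H_upper)
    finally show "ennreal (x \<bullet> p - \<psi> x + M_bound) \<le> liminf (\<lambda>j. H (f j) p)" .
  qed
  have "J \<psi> \<le> (\<integral>\<^sup>+p. liminf (\<lambda>j. H (f j) p * indicator P p) \<partial>lborel)"
    unfolding J_def using Hle by (intro nn_integral_mono) (auto split: split_indicator)
  also have "\<dots> \<le> liminf (\<lambda>j. J (f j))" unfolding J_def by (rule nn_integral_liminf) auto
  also have "\<dots> \<le> liminf (\<lambda>j. m + ennreal (1 / real (Suc j)))"
    by (intro Liminf_mono always_eventually allI f)
  also have "\<dots> = m"
  proof (rule lim_imp_Liminf)
    have "(\<lambda>j. m + ennreal (1 / real (Suc j))) \<longlonglongrightarrow> m + ennreal 0"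
      by (intro tendsto_intros tendsto_ennrealI LIMSEQ_Suc[OF lim_1_over_n])
    then show "(\<lambda>j. m + ennreal (1 / real (Suc j))) \<longlonglongrightarrow> m" by simp
  qed simp
  finally show ?thesis using n\<psi> m min by (meson le_less_trans order_trans)
qed

end

section \<open>First variation of the functional at its minimiser\<close>

context ma_equation
begin

definition fdom :: "(real^'n \<Rightarrow> real) \<Rightarrow> (real^'n) set" where
  "fdom \<psi> = {p \<in> P. H \<psi> p < \<infinity>}"

text \<open>The Legendre transform of \<open>\<psi>\<close> on \<open>fdom \<psi>\<close>; junk value \<open>- M_bound\<close> elsewhere.\<close>
definition leg :: "(real^'n \<Rightarrow> real) \<Rightarrow> real^'n \<Rightarrow> real" where
  "leg \<psi> p = enn2real (H \<psi> p) - M_bound"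

lemma leg_measurable [measurable]: "leg \<psi> \<in> borel_measurable borel"
  unfolding leg_def by measurable

lemma fdom_borel [measurable]: "fdom \<psi> \<in> sets borel"
proof -
  have "fdom \<psi> = P \<inter> {p \<in> space borel. H \<psi> p < \<infinity>}" by (auto simp: fdom_def)
  also have "\<dots> \<in> sets borel" by measurable
  finally show ?thesis .
qed

lemma H_eq_leg: "p \<in> fdom \<psi> \<Longrightarrow> H \<psi> p = ennreal (leg \<psi> p + M_bound)"
  by (simp add: leg_def fdom_def)

lemma leg_ge_bound: "- M_bound \<le> leg \<psi> p"
  by (simp add: leg_def)

lemma leg_upper: "p \<in> fdom \<psi> \<Longrightarrow> x \<bullet> p - \<psi> x \<le> leg \<psi> p"
  using H_upper[of x p \<psi>] leg_ge_bound[of \<psi> p] by (simp add: H_eq_leg ennreal_le_iff)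

text \<open>The bound on \<open>\<psi> 0\<close> gives \<open>0 \<le> a + M_bound\<close>, through
  the term at \<open>x = 0\<close>; without a nonnegative bound the estimate in
  \<open>ennreal\<close> would not translate back to real numbers.\<close>

lemma leg_lower:
  assumes "\<psi> 0 \<le> M_bound" "p \<in> P" "\<And>x. x \<bullet> p - \<psi> x \<le> a"
  shows "p \<in> fdom \<psi>" "leg \<psi> p \<le> a"
proof -
  have H: "H \<psi> p \<le> ennreal (a + M_bound)" by (rule H_leI) (use assms(3) in simp)
  then show "p \<in> fdom \<psi>" using assms(2) by (auto simp: fdom_def intro: le_less_trans)
  have "0 \<le> a + M_bound" using assms(1) assms(3)[of 0] by simp
  then have "enn2real (H \<psi> p) \<le> a + M_bound" using enn2real_mono[OF H] by simp
  then show "leg \<psi> p \<le> a" by (simp add: leg_def)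
qed

lemma AE_fdom:
  assumes "J \<psi> < \<infinity>" shows "AE p in lborel. p \<in> P \<longrightarrow> p \<in> fdom \<psi>"
proof -
  have "AE p in lborel. H \<psi> p * indicator P p \<noteq> \<infinity>"
    using assms by (intro nn_integral_PInf_AE) (auto simp: J_def)
  then show ?thesis
    by (rule eventually_mono) (auto simp: fdom_def less_top)
qed

lemma volume_P_measure: "measure lborel P = 1"
  using volume_P by (simp add: measure_def)

lemma integrable_P: "integrable lborel (indicator P :: _ \<Rightarrow> real)"
  using volume_P by (intro integrable_real_indicator) auto

lemma leg_integrable:
  assumes "J \<psi> < \<infinity>"
  shows "integrable lborel (\<lambda>p. indicator P p * leg \<psi> p)"
    and "J \<psi> = ennreal ((\<integral>p. indicator P p * leg \<psi> p \<partial>lborel) + M_bound)"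
    and "0 \<le> (\<integral>p. indicator P p * leg \<psi> p \<partial>lborel) + M_bound"
proof -
  have J: "J \<psi> = (\<integral>\<^sup>+p. ennreal (indicator P p * (leg \<psi> p + M_bound)) \<partial>lborel)"
    unfolding J_def
  proof (rule nn_integral_cong_AE)
    show "AE p in lborel. H \<psi> p * indicator P p = ennreal (indicator P p * (leg \<psi> p + M_bound))"
      using AE_fdom[OF assms] by (rule eventually_mono) (auto simp: H_eq_leg split: split_indicator)
  qed
  have nn: "0 \<le> indicator P p * (leg \<psi> p + M_bound)" for p
    using leg_ge_bound[of \<psi> p] by simp
  have int: "integrable lborel (\<lambda>p. indicator P p * (leg \<psi> p + M_bound))"
    using assms nn unfolding J by (intro integrableI_nonneg) auto
  have "integrable lborel (\<lambda>p. indicator P p * (leg \<psi> p + M_bound) - M_bound * indicator P p)"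
    using int integrable_P by (intro Bochner_Integration.integrable_diff integrable_mult_right) auto
  then show I: "integrable lborel (\<lambda>p. indicator P p * leg \<psi> p)" by (simp add: algebra_simps)
  have "(\<integral>p. indicator P p * (leg \<psi> p + M_bound) \<partial>lborel)
      = (\<integral>p. indicator P p * leg \<psi> p + M_bound * indicator P p \<partial>lborel)"
    by (simp add: algebra_simps)
  also have "\<dots> = (\<integral>p. indicator P p * leg \<psi> p \<partial>lborel) + M_bound"
    using I integrable_P volume_P_measure by (subst Bochner_Integration.integral_add) auto
  finally have eq: "(\<integral>p. indicator P p * (leg \<psi> p + M_bound) \<partial>lborel)
      = (\<integral>p. indicator P p * leg \<psi> p \<partial>lborel) + M_bound" .
  show "J \<psi> = ennreal ((\<integral>p. indicator P p * leg \<psi> p \<partial>lborel) + M_bound)"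
    unfolding J eq[symmetric] using int nn by (intro nn_integral_eq_integral) auto
  show "0 \<le> (\<integral>p. indicator P p * leg \<psi> p \<partial>lborel) + M_bound"
    unfolding eq[symmetric] using nn by (intro integral_nonneg_AE) auto
qed

lemma fdom_nonempty:
  assumes "J \<psi> < \<infinity>" shows "fdom \<psi> \<noteq> {}"
proof
  assume "fdom \<psi> = {}"
  then have "AE p in lborel. p \<notin> P" using AE_fdom[OF assms] by auto
  then have "P \<in> null_sets lborel" by (subst AE_iff_null_sets) auto
  then show False using volume_P by (simp add: null_sets_def)
qed

text \<open>The slopes for which some point of \<open>F\<close> is optimal up to \<open>t\<close> in
  the supremum defining the transform. It is a Borel stand-in for the subgradient image of
  \<open>F\<close>, into which it shrinks as \<open>t\<close> tends to 0.\<close>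

definition contact :: "(real^'n \<Rightarrow> real) \<Rightarrow> (real^'n) set \<Rightarrow> real \<Rightarrow> (real^'n) set" where
  "contact \<psi> F t = {p \<in> fdom \<psi>. \<exists>x\<in>F. leg \<psi> p - t < x \<bullet> p - \<psi> x}"

lemma contact_borel [measurable]:
  assumes "PLip P \<psi>" "compact F"
  shows "contact \<psi> F t \<in> sets borel"
proof (cases "F = {}")
  case False
  define k where "k p = (SUP x\<in>F. x \<bullet> p - \<psi> x)" for p
  have bdd: "bdd_above ((\<lambda>x. x \<bullet> p - \<psi> x) ` F)" for p
    using assms continuous[OF assms(1)]
    by (intro bounded_imp_bdd_above compact_imp_bounded compact_continuous_image continuous_intros)
      (auto intro: continuous_on_subset)
  have [measurable]: "k \<in> borel_measurable borel"
  proof (rule borel_measurableI_greater)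
    fix y
    have "{p \<in> space borel. y < k p} = (\<Union>x\<in>F. {p. y < x \<bullet> p - \<psi> x})"
      unfolding k_def using less_cSUP_iff[OF False bdd] by auto
    moreover have "open {p. y < x \<bullet> p - \<psi> x}" for x
      by (intro open_Collect_less continuous_intros)
    ultimately show "{p \<in> space borel. y < k p} \<in> sets borel" by (auto intro!: borel_open open_UN)
  qed
  have "contact \<psi> F t = fdom \<psi> \<inter> {p \<in> space borel. leg \<psi> p - t < k p}"
    unfolding contact_def k_def using less_cSUP_iff[OF False bdd] by auto
  also have "\<dots> \<in> sets borel" by measurable
  finally show ?thesis .
qed (simp add: contact_def)

lemma contact_subset_P: "contact \<psi> F t \<subseteq> P"
  by (auto simp: contact_def fdom_def)

text \<open>Compactness of \<open>F\<close> supplies one maximiser of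
  \<open>x \<bullet> p - \<psi> x\<close> over \<open>F\<close>. Being optimal up to every
  \<open>1 / (n + 1)\<close>, it attains the transform, and this is the subgradient inequality
  there.\<close>

lemma contact_Inter:
  assumes "PLip P \<psi>" "compact F"
  shows "(\<Inter>n. contact \<psi> F (1 / real (Suc n))) \<subseteq> (\<Union>x\<in>F. subgradients \<psi> x)"
proof
  fix p assume p: "p \<in> (\<Inter>n. contact \<psi> F (1 / real (Suc n)))"
  then have pd: "p \<in> fdom \<psi>" and "F \<noteq> {}" by (auto simp: contact_def)
  have "continuous_on F (\<lambda>x. x \<bullet> p - \<psi> x)"
    using continuous[OF assms(1)] by (intro continuous_intros) (auto intro: continuous_on_subset)
  then obtain a where a: "a \<in> F" "\<And>x. x \<in> F \<Longrightarrow> x \<bullet> p - \<psi> x \<le> a \<bullet> p - \<psi> a"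
    using continuous_attains_sup[OF assms(2) \<open>F \<noteq> {}\<close>] by blast
  have "leg \<psi> p - 1 / real (Suc n) \<le> a \<bullet> p - \<psi> a" for n
  proof -
    obtain x where "x \<in> F" "leg \<psi> p - 1 / real (Suc n) < x \<bullet> p - \<psi> x"
      using p unfolding contact_def by blast
    then show ?thesis using a(2)[of x] by linarith
  qed
  moreover have "(\<lambda>n. leg \<psi> p - 1 / real (Suc n)) \<longlonglongrightarrow> leg \<psi> p - 0"
    by (intro tendsto_intros LIMSEQ_Suc[OF lim_1_over_n])
  ultimately have "leg \<psi> p \<le> a \<bullet> p - \<psi> a" by (auto intro: LIMSEQ_le_const2)
  then have le: "z \<bullet> p - \<psi> z \<le> a \<bullet> p - \<psi> a" for z using leg_upper[OF pd, of z] by linarith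
  have "\<psi> a + p \<bullet> (z - a) \<le> \<psi> z" for z
    using le[of z] by (simp add: inner_diff_right inner_commute[of p])
  then have "p \<in> subgradients \<psi> a" by (simp add: subgradients_def)
  then show "p \<in> (\<Union>x\<in>F. subgradients \<psi> x)" using a by blast
qed

text \<open>The competitor is the Legendre transform of \<open>\<psi>\<^sup>* + t\<close> on the contact set and \<open>\<psi>\<^sup>*\<close> elsewhere;
  it lies below \<open>\<psi> - t\<close> on \<open>F\<close>.\<close>
lemma variation:
  assumes n: "normalized \<psi>" and J: "J \<psi> < \<infinity>" and min: "\<And>\<psi>'. normalized \<psi>' \<Longrightarrow> J \<psi> \<le> J \<psi>'"
    and F: "compact F" and t: "0 < t"
  shows "exp (- \<beta> * t) * (\<integral>x. indicator F x * exp (\<beta> * \<psi> x) \<partial>\<nu>) \<le> measure lborel (contact \<psi> F t)"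
proof -
  define A where "A = contact \<psi> F t"
  define D where "D = fdom \<psi>"
  define q where "q = (\<lambda>x. SUP p\<in>D. x \<bullet> p - leg \<psi> p - t * indicator A p)"
  define W where "W = (\<integral>x. indicator F x * exp (\<beta> * \<psi> x) \<partial>\<nu>)"
  have PL: "PLip P \<psi>" by (rule normalized_PLip[OF n])
  have [measurable]: "A \<in> sets borel" "F \<in> sets borel" "\<psi> \<in> borel_measurable borel"
    unfolding A_def using PL F borel by (auto simp: compact_imp_closed intro: contact_borel)
  have D: "D \<noteq> {}" "D \<subseteq> P" using fdom_nonempty[OF J] by (auto simp: D_def fdom_def)
  have AD: "A \<subseteq> D" by (auto simp: A_def D_def contact_def)
  \<comment> \<open>For \<open>p\<close> in \<open>A\<close> the transform itself is raised by
    \<open>t\<close>. For \<open>p\<close> outside \<open>A\<close> and \<open>x\<close> in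
    \<open>F\<close>, failing the contact condition says exactly that the pairing already falls
    short of the transform by at least \<open>t\<close>.\<close>
  have up: "x \<bullet> p - leg \<psi> p - t * indicator A p \<le> \<psi> x - t * indicator F x" if "p \<in> D" for x p
    using leg_upper[of p \<psi> x] that t unfolding D_def A_def contact_def by (auto split: split_indicator)
  have bdd: "bdd_above ((\<lambda>p. x \<bullet> p - leg \<psi> p - t * indicator A p) ` D)" for x
    using up by (auto intro!: bdd_aboveI)
  have q_upper: "x \<bullet> p - leg \<psi> p - t * indicator A p \<le> q x" if "p \<in> D" for x p
    unfolding q_def by (rule cSUP_upper[OF that bdd])
  have q_least: "q x \<le> a" if "\<And>p. p \<in> D \<Longrightarrow> x \<bullet> p - leg \<psi> p - t * indicator A p \<le> a" for x a
    unfolding q_def by (rule cSUP_least[OF D(1) that])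
  have q_le: "q x \<le> \<psi> x - t * indicator F x" for x by (rule q_least[OF up])
  have qP: "PLip P q"
    unfolding PLip_def
  proof (intro allI)
    fix x y
    have "q x \<le> q y + support_fun P (x - y)"
    proof (rule q_least)
      fix p assume p: "p \<in> D"
      then have "(x - y) \<bullet> p \<le> support_fun P (x - y)"
        using D by (intro inner_le_support_fun compact_P) auto
      then show "x \<bullet> p - leg \<psi> p - t * indicator A p \<le> q y + support_fun P (x - y)"
        using q_upper[OF p, of y] by (simp add: inner_diff_left)
    qed
    then show "q x - q y \<le> support_fun P (x - y)" by simp
  qed
  have qc: "convex_on UNIV q"
  proof (rule convex_onI)
    fix s :: real and x y assume s: "0 < s" "s < 1"
    show "q ((1 - s) *\<^sub>R x + s *\<^sub>R y) \<le> (1 - s) * q x + s * q y"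
    proof (rule q_least)
      fix p assume p: "p \<in> D"
      have "(1 - s) * (x \<bullet> p - leg \<psi> p - t * indicator A p) + s * (y \<bullet> p - leg \<psi> p - t * indicator A p)
          \<le> (1 - s) * q x + s * q y"
        using s q_upper[OF p] by (intro add_mono mult_left_mono) auto
      then show "((1 - s) *\<^sub>R x + s *\<^sub>R y) \<bullet> p - leg \<psi> p - t * indicator A p \<le> (1 - s) * q x + s * q y"
        by (simp add: inner_add_left algebra_simps)
    qed
  qed simp
  define c where "c = ln (M q) / \<beta>"
  have nq: "normalized (\<lambda>x. q x - c)" unfolding c_def by (rule normalized_diff[OF qc qP])
  have lin: "x \<bullet> p - (q x - c) + M_bound \<le> leg \<psi> p + t * indicator A p + c + M_bound" if "p \<in> D" for x p
    using q_upper[OF that, of x] by simp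
  have nn: "0 \<le> leg \<psi> p + t * indicator A p + c + M_bound" if "p \<in> D" for p
    using order_trans[OF _ lin[OF that, of 0], of 0] normalized_le[OF nq] by simp
  define G where "G = (\<integral>p. indicator P p * leg \<psi> p \<partial>lborel)"
  note leg_int = leg_integrable[OF J, folded G_def]
  have intA: "integrable lborel (indicator A :: _ \<Rightarrow> real)"
    using D AD by (intro Bochner_Integration.integrable_bound[OF integrable_P] AE_I2)
      (auto split: split_indicator)
  have eq: "indicator P p * (leg \<psi> p + t * indicator A p + c + M_bound)
      = indicator P p * leg \<psi> p + t * indicator A p + (c + M_bound) * indicator P p" for p
    using AD D by (auto split: split_indicator)
  have aenn: "AE p in lborel. 0 \<le> indicator P p * leg \<psi> p + t * indicator A p + (c + M_bound) * indicator P p"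
    unfolding eq[symmetric] using AE_fdom[OF J]
  proof (rule eventually_mono)
    fix p assume "p \<in> P \<longrightarrow> p \<in> fdom \<psi>"
    then show "0 \<le> indicator P p * (leg \<psi> p + t * indicator A p + c + M_bound)"
      using nn[of p] by (cases "p \<in> P") (auto simp: D_def)
  qed
  have inteq: "(\<integral>p. indicator P p * leg \<psi> p + t * indicator A p + (c + M_bound) * indicator P p \<partial>lborel)
      = G + t * measure lborel A + (c + M_bound)"
    using leg_int(1) intA integrable_P volume_P_measure by (simp add: G_def)
  have nnint: "0 \<le> G + t * measure lborel A + (c + M_bound)"
    unfolding inteq[symmetric] by (rule integral_nonneg_AE[OF aenn])
  have "J (\<lambda>x. q x - c) \<le> (\<integral>\<^sup>+p. ennreal (indicator P p * (leg \<psi> p + t * indicator A p + c + M_bound)) \<partial>lborel)"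
    unfolding J_def
  proof (intro nn_integral_mono_AE)
    show "AE p in lborel. H (\<lambda>x. q x - c) p * indicator P p
        \<le> ennreal (indicator P p * (leg \<psi> p + t * indicator A p + c + M_bound))"
      using AE_fdom[OF J]
    proof (rule eventually_mono)
      fix p assume "p \<in> P \<longrightarrow> p \<in> fdom \<psi>"
      then show "H (\<lambda>x. q x - c) p * indicator P p
        \<le> ennreal (indicator P p * (leg \<psi> p + t * indicator A p + c + M_bound))"
        using H_leI[OF lin[of p]] by (auto simp: D_def split: split_indicator)
    qed
  qed
  also have "\<dots> = ennreal (\<integral>p. indicator P p * leg \<psi> p + t * indicator A p + (c + M_bound) * indicator P p \<partial>lborel)"
    unfolding eq using leg_int(1) intA integrable_P aenn by (intro nn_integral_eq_integral) auto
  also note inteq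
  finally have "J \<psi> \<le> ennreal (G + t * measure lborel A + (c + M_bound))"
    using min[OF nq] by simp
  \<comment> \<open>Minimality: raising the transform on \<open>A\<close> costs
    \<open>t * measure lborel A\<close>, the renormalisation of \<open>q\<close> contributes
    \<open>c\<close>, and the total change cannot be negative.\<close>
  then have "0 \<le> t * measure lborel A + c"
    using leg_int(2) nnint by (simp add: ennreal_le_iff)
  \<comment> \<open>Being at most \<open>\<psi> - t\<close> on \<open>F\<close>, the competitor
    loses there at least the fraction \<open>1 - exp (- \<beta> * t)\<close> of the mass; through
    \<open>ln x \<le> x - 1\<close> this bounds \<open>c\<close> from above.\<close>
  moreover have "M q \<le> 1 - (1 - exp (- \<beta> * t)) * W"
  proof -
    have iF: "integrable \<nu> (\<lambda>x. indicator F x * exp (\<beta> * \<psi> x))"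
      using integrable_real_mult_indicator[of F \<nu> "\<lambda>x. exp (\<beta> * \<psi> x)"] integrable_exp[OF PL]
      by (auto simp: mult.commute)
    have "M q \<le> (\<integral>x. exp (\<beta> * \<psi> x) - (1 - exp (- \<beta> * t)) * (indicator F x * exp (\<beta> * \<psi> x)) \<partial>\<nu>)"
      unfolding M_def
    proof (intro integral_mono integrable_exp[OF qP])
      fix x
      have "exp (\<beta> * q x) \<le> exp (\<beta> * (\<psi> x - t * indicator F x))" using q_le beta_pos by simp
      also have "\<dots> = exp (\<beta> * \<psi> x) - (1 - exp (- \<beta> * t)) * (indicator F x * exp (\<beta> * \<psi> x))"
        by (auto split: split_indicator simp: algebra_simps exp_diff exp_minus divide_simps)
      finally show "exp (\<beta> * q x) \<le> exp (\<beta> * \<psi> x) - (1 - exp (- \<beta> * t)) * (indicator F x * exp (\<beta> * \<psi> x))" .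
    qed (use integrable_exp[OF PL] iF in auto)
    also have "\<dots> = 1 - (1 - exp (- \<beta> * t)) * W"
      using integrable_exp[OF PL] iF n by (simp add: W_def normalized_def M_def)
    finally show ?thesis .
  qed
  moreover have "\<beta> * c \<le> M q - 1"
    unfolding c_def using ln_le_minus_one[OF M_pos[OF qP]] beta_pos by simp
  ultimately have "(1 - exp (- \<beta> * t)) * W \<le> \<beta> * t * measure lborel A"
    using beta_pos mult_left_mono[of 0 "t * measure lborel A + c" \<beta>] by (simp add: algebra_simps)
  \<comment> \<open>Makes the factor \<open>\<beta> * t\<close> common to both sides, to be
    cancelled at the end; the remaining factor \<open>exp (- \<beta> * t)\<close> tends to 1 with
    \<open>t\<close>.\<close>
  moreover have "\<beta> * t * exp (- \<beta> * t) \<le> 1 - exp (- \<beta> * t)"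
  proof -
    have "\<beta> * t \<le> exp (\<beta> * t) - 1" using exp_ge_add_one_self[of "\<beta> * t"] by linarith
    then have "\<beta> * t * exp (- \<beta> * t) \<le> (exp (\<beta> * t) - 1) * exp (- \<beta> * t)" by (rule mult_right_mono) simp
    then show ?thesis by (simp add: left_diff_distrib exp_add[symmetric])
  qed
  moreover have "0 \<le> W" unfolding W_def by (intro integral_nonneg_AE) auto
  ultimately have "\<beta> * t * exp (- \<beta> * t) * W \<le> \<beta> * t * measure lborel A"
    by (meson mult_right_mono order_trans)
  then have "(\<beta> * t) * (exp (- \<beta> * t) * W) \<le> (\<beta> * t) * measure lborel A" by (simp add: mult.assoc)
  then show ?thesis using beta_pos t unfolding A_def W_def by (subst (asm) mult_le_cancel_left_pos) auto
qed

text \<open>Taking \<open>t = 1 / (n + 1)\<close> in \<open>variation\<close> and intersecting the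
  decreasing contact sets gives the inequality between the two measures on compact sets; inner
  regularity of the finite measure \<open>wt \<psi>\<close> carries it to Borel sets.\<close>

lemma minimiser_solution:
  assumes n: "normalized \<psi>" and J: "J \<psi> < \<infinity>" and min: "\<And>\<psi>'. normalized \<psi>' \<Longrightarrow> J \<psi> \<le> J \<psi>'"
  shows "is_solution \<psi>"
proof -
  have PL: "PLip P \<psi>" by (rule normalized_PLip[OF n])
  have cont: "continuous_on UNIV \<psi>" by (rule continuous[OF PL])
  have sub: "subgradients \<psi> x \<subseteq> P" for x
    by (rule PLip_subgradients[OF compact_P convex_P P_nonempty PL])
  have wt1: "emeasure (wt \<psi>) UNIV = 1"
    using n by (simp add: emeasure_wt_UNIV[OF PL] normalized_def)
  have compact_le: "emeasure (wt \<psi>) F \<le> emeasure (MA \<psi>) F" if F: "compact F" for F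
  proof -
    let ?A = "\<lambda>n. contact \<psi> F (1 / real (Suc n))"
    define W where "W = (\<integral>x. indicator F x * exp (\<beta> * \<psi> x) \<partial>\<nu>)"
    have meas: "?A n \<in> sets borel" for n by (rule contact_borel[OF PL F])
    have fin: "emeasure lborel (?A n) \<noteq> \<infinity>" for n
      using emeasure_mono[OF contact_subset_P[of \<psi> F "1 / real (Suc n)"], of lborel] volume_P
      by (auto simp: top_unique)
    have dec: "decseq ?A"
    proof (rule decseq_SucI)
      fix n show "?A (Suc n) \<subseteq> ?A n"
      proof
        fix p assume "p \<in> ?A (Suc n)"
        moreover have "1 / real (Suc (Suc n)) \<le> 1 / real (Suc n)" by (simp add: frac_le)
        ultimately show "p \<in> ?A n" unfolding contact_def
          by (smt (verit, best) mem_Collect_eq)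
      qed
    qed
    have l1: "(\<lambda>n. measure lborel (?A n)) \<longlonglongrightarrow> measure lborel (\<Inter>n. ?A n)"
      using meas dec fin by (intro Lim_measure_decseq) auto
    have l2: "(\<lambda>n. exp (- \<beta> * (1 / real (Suc n))) * W) \<longlonglongrightarrow> exp (- \<beta> * 0) * W"
      by (intro tendsto_intros LIMSEQ_Suc[OF lim_1_over_n])
    have "exp (- \<beta> * (1 / real (Suc n))) * W \<le> measure lborel (?A n)" for n
      unfolding W_def by (rule variation[OF n J min F]) auto
    then have "exp (- \<beta> * 0) * W \<le> measure lborel (\<Inter>n. ?A n)" by (intro LIMSEQ_le[OF l2 l1]) blast
    then have "ennreal W \<le> ennreal (measure lborel (\<Inter>n. ?A n))" by (simp add: ennreal_leI)
    also have "\<dots> = emeasure lborel (\<Inter>n. ?A n)"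
    proof (rule emeasure_eq_ennreal_measure[symmetric])
      have "emeasure lborel (\<Inter>n. ?A n) \<le> emeasure lborel (?A 0)"
        using meas[of 0] by (intro emeasure_mono INT_lower) (simp_all only: sets_lborel UNIV_I)
      then show "emeasure lborel (\<Inter>n. ?A n) \<noteq> top" using fin[of 0] by (auto simp: top_unique)
    qed
    also have "\<dots> = emeasure lebesgue (\<Inter>n. ?A n)" 
      using sets.countable_INT[of ?A UNIV lborel] meas by auto
    also have "\<dots> \<le> emeasure lebesgue (\<Union>x\<in>F. subgradients \<psi> x)"
    proof (rule emeasure_mono[OF contact_Inter[OF PL F]])
      show "(\<Union>x\<in>F. subgradients \<psi> x) \<in> sets lebesgue"
        using F by (intro sets_subgradients_image cont) (simp add: compact_imp_closed)
    qed
    also have "\<dots> = emeasure (MA \<psi>) F" using F by (intro emeasure_MA[OF cont, symmetric]) (simp add: compact_imp_closed)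
    finally show ?thesis using F by (simp add: emeasure_wt[OF PL] compact_imp_closed W_def)
  qed
  have le: "emeasure (wt \<psi>) E \<le> emeasure (MA \<psi>) E" if E: "E \<in> sets borel" for E
  proof -
    have "emeasure (wt \<psi>) E = (SUP K\<in>{K. K \<subseteq> E \<and> compact K}. emeasure (wt \<psi>) K)"
      using E wt1 by (intro inner_regular) auto
    also have "\<dots> \<le> emeasure (MA \<psi>) E"
    proof (rule SUP_least, clarify)
      fix K assume "K \<subseteq> E" "compact K"
      then have "emeasure (MA \<psi>) K \<le> emeasure (MA \<psi>) E" using E by (intro emeasure_mono) (auto simp: sets_MA)
      then show "emeasure (wt \<psi>) K \<le> emeasure (MA \<psi>) E" using compact_le[OF \<open>compact K\<close>] by simp
    qed
    finally show ?thesis .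
  qed
  have "emeasure (MA \<psi>) UNIV = emeasure lebesgue (\<Union>x\<in>UNIV. subgradients \<psi> x)"
    by (rule emeasure_MA[OF cont]) simp
  also have "\<dots> \<le> emeasure lebesgue P" using sub by (intro emeasure_mono) auto
  also have "\<dots> = 1" using volume_P by simp
  finally have MA1: "emeasure (MA \<psi>) UNIV = 1" using le[of UNIV] wt1 by simp
  have "MA \<psi> = wt \<psi>"
  proof (rule measure_eqI)
    fix E assume "E \<in> sets (MA \<psi>)"
    then have E: "E \<in> sets borel" by (simp add: sets_MA)
    have fin: "emeasure (wt \<psi>) (- E) \<noteq> top" "emeasure (MA \<psi>) (-E) \<noteq> top"
      using emeasure_mono[of "- E" UNIV "wt \<psi>"] emeasure_mono[of "- E" UNIV "MA \<psi>"] wt1 MA1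
      by (auto simp: sets_MA top_unique)
    \<comment> \<open>An excess of \<open>MA \<psi>\<close> on \<open>E\<close> would have to be
      compensated on the complement, where \<open>wt \<psi>\<close> is also the smaller measure;
      equal finite total masses exclude this.\<close>
    have "emeasure (MA \<psi>) E + emeasure (wt \<psi>) (- E) \<le> emeasure (MA \<psi>) E + emeasure (MA \<psi>) (- E)"
      using E le[of "- E"] by (intro add_left_mono) auto
    also have "\<dots> = emeasure (MA \<psi>) UNIV"
      using E by (subst plus_emeasure) (auto simp: sets_MA)
    also have "\<dots> = emeasure (wt \<psi>) UNIV" using wt1 MA1 by simp
    also have "\<dots> = emeasure (wt \<psi>) E + emeasure (wt \<psi>) (- E)"
      using E by (subst plus_emeasure) auto
    finally have "emeasure (MA \<psi>) E \<le> emeasure (wt \<psi>) E"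
      using fin by (simp add: ennreal_add_left_cancel_le add.commute)
    then show "emeasure (MA \<psi>) E = emeasure (wt \<psi>) E" using le[OF E] by simp
  qed (simp add: sets_MA)
  then show ?thesis
    using n sub MA1 by (simp add: is_solution_def normalized_def)
qed

end

section \<open>Riemann sums over lattice points\<close>

definition int_vecs :: "(real^'n) set" where
  "int_vecs = {a. \<forall>i. a $ i \<in> \<int>}"

text \<open>Half-open, so that for \<open>k > 0\<close> the cubes of side \<open>1 / k\<close> with
  corners in \<open>int_vecs\<close> scaled by \<open>1 / k\<close> partition the space exactly;
  \<open>vfloor k x\<close> names the cube that contains \<open>x\<close>.\<close>

definition cell :: "nat \<Rightarrow> real^'n \<Rightarrow> (real^'n) set" where
  "cell k a = {x. \<forall>i. a $ i \<le> real k * x $ i \<and> real k * x $ i < a $ i + 1}"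

definition vfloor :: "nat \<Rightarrow> real^'n \<Rightarrow> real^'n" where
  "vfloor k x = (\<chi> i. of_int \<lfloor>real k * x $ i\<rfloor>)"

lemma vfloor_int_vecs: "vfloor k x \<in> int_vecs"
  by (simp add: vfloor_def int_vecs_def)

lemma mem_cell_iff:
  assumes "a \<in> int_vecs" shows "x \<in> cell k a \<longleftrightarrow> vfloor k x = a"
proof -
  have "(a $ i \<le> real k * x $ i \<and> real k * x $ i < a $ i + 1) \<longleftrightarrow> of_int \<lfloor>real k * x $ i\<rfloor> = a $ i" for i
  proof -
    obtain z where "a $ i = of_int z" using assms by (auto simp: int_vecs_def elim: Ints_cases)
    then show ?thesis by (auto simp: floor_eq_iff)
  qed
  then show ?thesis by (simp add: cell_def vfloor_def vec_eq_iff)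
qed

lemma finite_int_vecs:
  assumes "bounded S" shows "finite (S \<inter> int_vecs)"
proof -
  obtain B where B: "\<And>x. x \<in> S \<Longrightarrow> norm x \<le> B" using assms by (auto simp: bounded_iff)
  define f :: "('a \<Rightarrow> int) \<Rightarrow> real^'a" where "f g = (\<chi> i. of_int (g i))" for g
  have "S \<inter> int_vecs \<subseteq> f ` (UNIV \<rightarrow>\<^sub>E {- \<lceil>B\<rceil>..\<lceil>B\<rceil>})"
  proof
    fix x assume x: "x \<in> S \<inter> int_vecs"
    have 1: "x $ i = of_int \<lfloor>x $ i\<rfloor>" for i using x by (auto simp: int_vecs_def elim: Ints_cases)
    have 2: "\<bar>x $ i\<bar> \<le> B" for i using B[of x] component_le_norm_cart[of x i] x by auto
    have "\<lfloor>x $ i\<rfloor> \<in> {- \<lceil>B\<rceil>..\<lceil>B\<rceil>}" for i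
    proof -
      have "of_int \<lfloor>x $ i\<rfloor> \<le> B" "- B \<le> of_int \<lfloor>x $ i\<rfloor>" using 1[of i] 2[of i] by auto
      then show ?thesis by simp linarith
    qed
    then have "(\<lambda>i. \<lfloor>x $ i\<rfloor>) \<in> UNIV \<rightarrow>\<^sub>E {- \<lceil>B\<rceil>..\<lceil>B\<rceil>}" by (auto simp: PiE_def extensional_def)
    moreover have "x = f (\<lambda>i. \<lfloor>x $ i\<rfloor>)" using 1 by (simp add: f_def vec_eq_iff)
    ultimately show "x \<in> f ` (UNIV \<rightarrow>\<^sub>E {- \<lceil>B\<rceil>..\<lceil>B\<rceil>})" by blast
  qed
  then show ?thesis by (rule finite_subset) (auto intro!: finite_imageI finite_PiE)
qed

lemma cell_eq_Inter:
  "cell k a = (\<Inter>i. {x. a $ i \<le> real k * x $ i}) \<inter> (\<Inter>i. {x. real k * x $ i < a $ i + 1})"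
  by (auto simp: cell_def)

lemma cell_borel [measurable]: "cell k a \<in> sets borel"
  unfolding cell_eq_Inter
  by (intro sets.Int borel_closed[OF closed_INT] borel_open[OF open_INT] ballI
      closed_Collect_le open_Collect_less continuous_intros) auto

lemma convex_cell: "convex (cell k (a::real^'n))"
proof -
  have "convex {x::real^'n. a $ i \<le> real k * x $ i}" "convex {x::real^'n. real k * x $ i < a $ i + 1}" for i
  proof -
    have "{x::real^'n. a $ i \<le> real k * x $ i} = {x. (real k *\<^sub>R axis i 1) \<bullet> x \<ge> a $ i}"
      "{x::real^'n. real k * x $ i < a $ i + 1} = {x. (real k *\<^sub>R axis i 1) \<bullet> x < a $ i + 1}"
      by (auto simp: inner_axis')
    then show "convex {x::real^'n. a $ i \<le> real k * x $ i}" "convex {x::real^'n. real k * x $ i < a $ i + 1}"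
      by (simp_all only: convex_halfspace_ge convex_halfspace_lt)
  qed
  then show ?thesis unfolding cell_eq_Inter by (intro convex_Int convex_INT) auto
qed

lemma emeasure_cell:
  fixes a :: "real^'n"
  assumes "0 < k" shows "emeasure lborel (cell k a) = ennreal (1 / real k ^ CARD('n))"
proof -
  define u where "u = (1 / real k) *\<^sub>R a"
  define v where "v = (1 / real k) *\<^sub>R (a + (\<chi> i. 1))"
  have uv: "(v - u) \<bullet> b = 1 / real k" if "b \<in> Basis" for b
    using that by (auto simp: u_def v_def Basis_vec_def inner_axis algebra_simps)
  have le: "u \<bullet> b \<le> v \<bullet> b" if "b \<in> Basis" for b
  proof -
    have "0 \<le> 1 / real k" by simp
    then show ?thesis unfolding uv[OF that, symmetric] by (simp add: inner_diff_left)
  qed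
  have prod: "(\<Prod>b\<in>Basis. (v - u) \<bullet> b) = 1 / real k ^ CARD('n)"
    using uv by (simp add: power_one_over)
  have 1: "box u v \<subseteq> cell k a" "cell k a \<subseteq> cbox u v"
    using assms by (auto simp: cell_def mem_box_cart u_def v_def field_simps less_imp_le)
  have "emeasure lborel (box u v) \<le> emeasure lborel (cell k a)"
    using 1 by (intro emeasure_mono) auto
  moreover have "emeasure lborel (cell k a) \<le> emeasure lborel (cbox u v)"
    using 1 by (intro emeasure_mono) auto
  ultimately show ?thesis
    using emeasure_lborel_box[of u v] emeasure_lborel_cbox[of u v] le prod by simp
qed

lemma measure_cell:
  fixes a :: "real^'n"
  shows "0 < k \<Longrightarrow> measure lborel (cell k a) = 1 / real k ^ CARD('n)"
  by (simp add: measure_def emeasure_cell)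

lemma norm_vfloor_diff:
  fixes x :: "real^'n"
  assumes "0 < k" shows "norm (x - (1 / real k) *\<^sub>R vfloor k x) \<le> real CARD('n) / real k"
proof -
  have "\<bar>(x - (1 / real k) *\<^sub>R vfloor k x) $ i\<bar> \<le> 1 / real k" for i
  proof -
    have "0 \<le> real k * x $ i - of_int \<lfloor>real k * x $ i\<rfloor>" "real k * x $ i - of_int \<lfloor>real k * x $ i\<rfloor> \<le> 1"
      by linarith+
    moreover have "(x - (1 / real k) *\<^sub>R vfloor k x) $ i = (real k * x $ i - of_int \<lfloor>real k * x $ i\<rfloor>) / real k"
      using assms by (simp add: vfloor_def field_simps)
    ultimately show ?thesis using assms by (auto simp: divide_right_mono)
  qed
  then have "(\<Sum>i\<in>UNIV. \<bar>(x - (1 / real k) *\<^sub>R vfloor k x) $ i\<bar>) \<le> (\<Sum>i\<in>(UNIV::'n set). 1 / real k)"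
    by (intro sum_mono)
  also have "\<dots> = real CARD('n) / real k" by simp
  finally show ?thesis using norm_le_l1_cart order_trans by blast
qed

lemma vfloor_tendsto:
  fixes x :: "real^'n"
  shows "(\<lambda>k. (1 / real (Suc k)) *\<^sub>R vfloor (Suc k) x) \<longlonglongrightarrow> x"
proof -
  have "(\<lambda>k. real CARD('n) * (1 / real (Suc k))) \<longlonglongrightarrow> real CARD('n) * 0"
    by (intro tendsto_intros LIMSEQ_Suc[OF lim_1_over_n])
  then have "(\<lambda>k. real CARD('n) / real (Suc k)) \<longlonglongrightarrow> 0" by simp
  then have "(\<lambda>k. x - (1 / real (Suc k)) *\<^sub>R vfloor (Suc k) x) \<longlonglongrightarrow> 0"
    by (rule Lim_null_comparison[OF always_eventually, rotated]) (intro allI norm_vfloor_diff, simp)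
  from tendsto_diff[OF tendsto_const[of x] this] show ?thesis by simp
qed

lemma lattice_points_eq:
  "0 < k \<Longrightarrow> lattice_points k P = {y \<in> int_vecs. (1 / real k) *\<^sub>R y \<in> P}"
  by (force simp: lattice_points_def int_vecs_def image_iff)

lemma finite_lattice_points:
  assumes "bounded P" shows "finite (lattice_points k P)"
proof -
  have "lattice_points k P = (\<lambda>x. real k *\<^sub>R x) ` P \<inter> int_vecs"
    by (simp add: lattice_points_def int_vecs_def)
  then show ?thesis using finite_int_vecs[OF bounded_scaling[OF assms]] by simp
qed

text \<open>The function rounded to the grid is a finite combination of indicators of cells, since
  only lattice points of \<open>k P\<close> carry a nonzero value. Its integral is the Riemann
  sum.\<close>

lemma vfloor_sum:
  fixes f :: "real^'n \<Rightarrow> real"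
  assumes "bounded P" "0 < k" "\<And>x. x \<notin> P \<Longrightarrow> f x = 0"
  shows "f ((1 / real k) *\<^sub>R vfloor k x)
     = (\<Sum>y\<in>lattice_points k P. f ((1 / real k) *\<^sub>R y) * indicator (cell k y) x)"
proof -
  have "(\<Sum>y\<in>lattice_points k P. f ((1 / real k) *\<^sub>R y) * indicator (cell k y) x)
      = (\<Sum>y\<in>lattice_points k P. if y = vfloor k x then f ((1 / real k) *\<^sub>R y) else 0)"
    using assms(2) by (intro sum.cong) (auto simp: lattice_points_eq mem_cell_iff indicator_def)
  also have "\<dots> = f ((1 / real k) *\<^sub>R vfloor k x)"
    using assms(2,3) finite_lattice_points[OF assms(1)]
    by (simp add: sum.delta' sum.delta) (auto simp: lattice_points_eq vfloor_int_vecs)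
  finally show ?thesis by simp
qed

text \<open>Dominated convergence for the functions rounded to the grid: rounding moves a point by
  at most \<open>CARD('n) / k\<close>, so they converge at every continuity point of
  \<open>f\<close>.\<close>

theorem riemann_lattice:
  fixes f :: "real^'n \<Rightarrow> real"
  assumes "bounded P" "\<And>x. x \<notin> P \<Longrightarrow> f x = 0" "\<And>x. \<bar>f x\<bar> \<le> B" "f \<in> borel_measurable borel"
    and "AE x in lborel. isCont f x"
  shows "(\<lambda>k. (\<Sum>y\<in>lattice_points k P. f ((1 / real k) *\<^sub>R y)) / real k ^ CARD('n))
    \<longlonglongrightarrow> (\<integral>x. f x \<partial>lborel)"
proof -
  obtain b where b: "\<And>x. x \<in> P \<Longrightarrow> norm x \<le> b" using assms(1) by (auto simp: bounded_iff)
  \<comment> \<open>Indexed by \<open>Suc k\<close> to keep the mesh \<open>1 / k\<close>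
    meaningful; the shift is undone at the end.\<close>
  define g where "g k x = f ((1 / real (Suc k)) *\<^sub>R vfloor (Suc k) x)" for k x
  have g: "g k x = (\<Sum>y\<in>lattice_points (Suc k) P. f ((1 / real (Suc k)) *\<^sub>R y) * indicator (cell (Suc k) y) x)" for k x
    unfolding g_def by (rule vfloor_sum[OF assms(1) _ assms(2)]) simp_all
  have int: "integrable lborel (indicator (cell (Suc k) y) :: real^'n \<Rightarrow> real)" for k y
    by (intro integrable_real_indicator) (auto simp: emeasure_cell)
  have intg: "(\<integral>x. g k x \<partial>lborel) = (\<Sum>y\<in>lattice_points (Suc k) P. f ((1 / real (Suc k)) *\<^sub>R y)) / real (Suc k) ^ CARD('n)" for k
    unfolding g using int by (subst Bochner_Integration.integral_sum) (auto simp: measure_cell sum_divide_distrib simp del: of_nat_Suc)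
  have "(\<lambda>k. \<integral>x. g k x \<partial>lborel) \<longlonglongrightarrow> (\<integral>x. f x \<partial>lborel)"
  \<comment> \<open>A nonzero value at \<open>x\<close> forces the rounded point into
    \<open>P\<close>; since it is at most \<open>CARD('n)\<close> away, \<open>x\<close> lies in
    this ball for every \<open>k\<close>.\<close>
  proof (rule integral_dominated_convergence[where w = "\<lambda>x. B * indicator (cball 0 (b + real CARD('n))) x"])
    show "f \<in> borel_measurable lborel" using assms(4) by simp
    show "g k \<in> borel_measurable lborel" for k unfolding g[abs_def] by measurable
    show "integrable lborel (\<lambda>x. B * indicator (cball (0::real^'n) (b + real CARD('n))) x)"
      using emeasure_bounded_finite[OF bounded_cball, of "0::real^'n" "b + real CARD('n)"]
      by (intro integrable_mult_right integrable_real_indicator) auto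
    show "AE x in lborel. (\<lambda>k. g k x) \<longlonglongrightarrow> f x"
      using assms(5)
    proof (rule eventually_mono)
      fix x assume "isCont f x"
      then show "(\<lambda>k. g k x) \<longlonglongrightarrow> f x"
        unfolding g_def by (rule isCont_tendsto_compose[OF _ vfloor_tendsto])
    qed
    show "AE x in lborel. norm (g k x) \<le> B * indicator (cball 0 (b + real CARD('n))) x" for k
    proof (rule AE_I2)
      fix x :: "real^'n"
      show "norm (g k x) \<le> B * indicator (cball 0 (b + real CARD('n))) x"
      proof (cases "(1 / real (Suc k)) *\<^sub>R vfloor (Suc k) x \<in> P")
        case True
        have "norm x \<le> norm ((1 / real (Suc k)) *\<^sub>R vfloor (Suc k) x) + norm (x - (1 / real (Suc k)) *\<^sub>R vfloor (Suc k) x)"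
          by (rule norm_triangle_sub)
        also have "\<dots> \<le> b + real CARD('n) / real (Suc k)"
          by (intro add_mono b True norm_vfloor_diff) simp
        also have "\<dots> \<le> b + real CARD('n)" by (simp add: divide_le_eq del: of_nat_Suc)
        finally show ?thesis using assms(3) by (simp add: g_def)
      next
        case False
        have "0 \<le> B" using assms(3)[of 0] by simp
        then show ?thesis using False assms(2) by (simp add: g_def)
      qed
    qed
  qed
  then show ?thesis
    unfolding intg by (subst (asm) filterlim_sequentially_Suc)
qed

lemma AE_not_frontier_convex:
  fixes Q :: "'a::euclidean_space set"
  assumes "convex Q" shows "AE x in lborel. x \<notin> frontier Q"
proof -
  have "frontier Q \<in> null_sets lebesgue"
    using negligible_convex_frontier[OF assms] by (simp add: negligible_iff_null_sets)
  then have "frontier Q \<in> null_sets lborel" by (subst (asm) null_sets_completion_iff) auto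
  then show ?thesis by (rule AE_not_in)
qed

lemma isCont_indicator_mult:
  fixes h :: "'a::euclidean_space \<Rightarrow> real"
  assumes "continuous_on (interior Q) h" "x \<notin> frontier Q"
  shows "isCont (\<lambda>x. indicator Q x * h x) x"
proof (cases "x \<in> interior Q")
  case True
  have "eventually (\<lambda>y. y \<in> interior Q) (nhds x)" using True by (intro eventually_nhds_in_open) auto
  then have ev: "eventually (\<lambda>y. indicator Q y * h y = h y) (nhds x)"
    by (rule eventually_mono) (use interior_subset[of Q] in \<open>auto simp: subset_iff\<close>)
  have "isCont h x" using assms(1) True by (simp add: continuous_on_eq_continuous_at)
  then show ?thesis by (subst isCont_cong[OF ev])
next
  case False
  then have "x \<in> - closure Q" using assms(2) by (auto simp: frontier_def)
  then have "eventually (\<lambda>y. y \<in> - closure Q) (nhds x)" by (intro eventually_nhds_in_open) auto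
  then have ev: "eventually (\<lambda>y. indicator Q y * h y = 0) (nhds x)"
    by (rule eventually_mono) (use closure_subset[of Q] in \<open>auto simp: indicator_def\<close>)
  show ?thesis by (subst isCont_cong[OF ev]) simp
qed

text \<open>Discontinuities can occur only on the frontier of \<open>Q\<close>, and the frontier of
  a convex set is null.\<close>

lemma riemann_convex:
  fixes h :: "real^'n \<Rightarrow> real"
  assumes "bounded P" "Q \<subseteq> P" "convex Q" "Q \<in> sets borel" "h \<in> borel_measurable borel"
    "continuous_on (interior Q) h" "\<And>x. x \<in> Q \<Longrightarrow> \<bar>h x\<bar> \<le> B"
  shows "(\<lambda>k. (\<Sum>y\<in>lattice_points k P. indicator Q ((1 / real k) *\<^sub>R y) * h ((1 / real k) *\<^sub>R y)) / real k ^ CARD('n))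
    \<longlonglongrightarrow> (\<integral>x. indicator Q x * h x \<partial>lborel)"
proof (rule riemann_lattice[OF assms(1), where B = "\<bar>B\<bar>"])
  show "AE x in lborel. isCont (\<lambda>x. indicator Q x * h x) x"
    using AE_not_frontier_convex[OF assms(3)] by (rule eventually_mono) (rule isCont_indicator_mult[OF assms(6)])
  show "\<bar>indicator Q x * h x\<bar> \<le> \<bar>B\<bar>" for x
    using assms(7)[of x] by (auto split: split_indicator)
qed (use assms(2,4,5) in \<open>auto split: split_indicator\<close>)

context ma_equation
begin

section \<open>The Legendre transform of the solution\<close>

lemma leg_convex_comb:
  assumes "\<psi> 0 \<le> M_bound" "p \<in> fdom \<psi>" "q \<in> fdom \<psi>" "0 \<le> u" "0 \<le> v" "u + v = 1"
  shows "u *\<^sub>R p + v *\<^sub>R q \<in> fdom \<psi>" "leg \<psi> (u *\<^sub>R p + v *\<^sub>R q) \<le> u * leg \<psi> p + v * leg \<psi> q"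
proof -
  have P: "u *\<^sub>R p + v *\<^sub>R q \<in> P"
    using assms convex_P by (auto simp: fdom_def convex_def)
  have "x \<bullet> (u *\<^sub>R p + v *\<^sub>R q) - \<psi> x \<le> u * leg \<psi> p + v * leg \<psi> q" for x
  proof -
    have "u * (x \<bullet> p - \<psi> x) + v * (x \<bullet> q - \<psi> x) \<le> u * leg \<psi> p + v * leg \<psi> q"
      using assms by (intro add_mono mult_left_mono leg_upper) auto
    moreover have "u * (x \<bullet> p - \<psi> x) + v * (x \<bullet> q - \<psi> x) = x \<bullet> (u *\<^sub>R p + v *\<^sub>R q) - (u + v) * \<psi> x"
      by (simp add: inner_add_right algebra_simps)
    ultimately show ?thesis using assms(6) by simp
  qed
  from leg_lower[where \<psi> = \<psi>, OF assms(1) P this]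
  show "u *\<^sub>R p + v *\<^sub>R q \<in> fdom \<psi>" "leg \<psi> (u *\<^sub>R p + v *\<^sub>R q) \<le> u * leg \<psi> p + v * leg \<psi> q" by auto
qed

text \<open>\<open>fdom \<psi>\<close> is convex and fills \<open>P\<close> up to a null set, so the
  open set left over by its closure is empty. A convex set and its closure have the same
  interior.\<close>

lemma interior_subset_fdom:
  assumes "\<psi> 0 \<le> M_bound" "J \<psi> < \<infinity>"
  shows "interior P \<subseteq> fdom \<psi>"
proof -
  have "convex (fdom \<psi>)" unfolding convex_def using leg_convex_comb[where \<psi> = \<psi>, OF assms(1)] by blast
  define U where "U = interior P - closure (fdom \<psi>)"
  have "open U" unfolding U_def by (intro open_Diff) auto
  have "AE p in lborel. p \<notin> U"
    using AE_fdom[OF assms(2)] by (rule eventually_mono)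
      (use interior_subset[of P] closure_subset[of "fdom \<psi>"] in \<open>auto simp: U_def\<close>)
  then have "U \<in> null_sets lborel" using \<open>open U\<close> by (subst AE_iff_null_sets) auto
  then have "negligible U" by (simp add: negligible_iff_null_sets null_sets_completionI)
  then have "U = {}" using open_not_negligible[OF \<open>open U\<close>] by blast
  then have "interior P \<subseteq> interior (closure (fdom \<psi>))" by (intro interior_maximal) (auto simp: U_def)
  also have "\<dots> = interior (fdom \<psi>)" by (rule convex_interior_closure[OF \<open>convex (fdom \<psi>)\<close>])
  finally show ?thesis using interior_subset by blast
qed

lemma leg_continuous:
  assumes "\<psi> 0 \<le> M_bound" "J \<psi> < \<infinity>"
  shows "continuous_on (interior P) (leg \<psi>)"
proof (rule convex_on_continuous)
  have sub: "p \<in> interior P \<Longrightarrow> p \<in> fdom \<psi>" for p using interior_subset_fdom[OF assms] by blast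
  show "convex_on (interior P) (leg \<psi>)"
    unfolding convex_on_def using convex_P
    by (auto intro!: leg_convex_comb(2)[where \<psi> = \<psi>, OF assms(1)] sub convex_interior)
qed simp

text \<open>The subgradient inequality says that \<open>x\<close> attains the supremum defining the
  transform: this is the equality case of the Young inequality.\<close>

lemma leg_subgrad:
  assumes "normalized \<psi>" "p \<in> subgradients \<psi> x"
  shows "p \<in> fdom \<psi>" "leg \<psi> p = x \<bullet> p - \<psi> x"
proof -
  have "p \<in> P" using PLip_subgradients[OF compact_P convex_P P_nonempty normalized_PLip[OF assms(1)]] assms(2) by blast
  moreover have "z \<bullet> p - \<psi> z \<le> x \<bullet> p - \<psi> x" for z
    using subgradientsD[OF assms(2), of z] by (simp add: inner_diff_right inner_commute[of p])
  ultimately have *: "p \<in> fdom \<psi>" "leg \<psi> p \<le> x \<bullet> p - \<psi> x"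
    using leg_lower[where \<psi> = \<psi>, OF normalized_le[OF assms(1)]] by blast+
  then show "p \<in> fdom \<psi>" "leg \<psi> p = x \<bullet> p - \<psi> x" using leg_upper[OF *(1), of x] by auto
qed

lemma compact_nbhd:
  fixes K :: "(real^'n) set"
  assumes "compact K" "K \<subseteq> interior P"
  shows "\<exists>e>0. \<exists>K'. compact K' \<and> K' \<subseteq> interior P \<and> (\<forall>x\<in>K. cball x e \<subseteq> K')"
proof -
  obtain e where e: "e > 0" "(\<Union>x\<in>K. cball x e) \<subseteq> interior P"
    using compact_subset_open_imp_cball_epsilon_subset[OF assms(1) open_interior assms(2)] by blast
  have "(\<Union>x\<in>K. cball x e) = (\<Union>x\<in>K. \<Union>y\<in>cball 0 e. {x + y})"
  proof (intro set_eqI iffI)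
    fix z assume "z \<in> (\<Union>x\<in>K. cball x e)"
    then obtain x where "x \<in> K" "z \<in> cball x e" by blast
    then have "z - x \<in> cball 0 e" "z = x + (z - x)" by (auto simp: dist_norm norm_minus_commute)
    then show "z \<in> (\<Union>x\<in>K. \<Union>y\<in>cball 0 e. {x + y})" using \<open>x \<in> K\<close> by blast
  qed (force simp: dist_norm)
  then have "compact (\<Union>x\<in>K. cball x e)" using compact_sums'[OF assms(1) compact_cball] by simp
  then show ?thesis using e by (intro exI[of _ e] conjI exI[of _ "\<Union>x\<in>K. cball x e"]) auto
qed

lemma leg_bounded:
  assumes "\<psi> 0 \<le> M_bound" "J \<psi> < \<infinity>" "compact K" "K \<subseteq> interior P"
  shows "\<exists>B. \<forall>p\<in>K. \<bar>leg \<psi> p\<bar> \<le> B"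
proof -
  have "compact (leg \<psi> ` K)"
    using leg_continuous[OF assms(1,2)] assms(3,4) by (intro compact_continuous_image) (auto intro: continuous_on_subset)
  then show ?thesis using compact_imp_bounded by (fastforce simp: bounded_iff)
qed

text \<open>Moving from \<open>p\<close> by \<open>e\<close> in the direction of \<open>x\<close>
  raises the transform by at least \<open>e * norm x\<close>, but on the slightly larger compact set
  \<open>K'\<close> the transform is bounded.\<close>

lemma subgrad_bounded:
  assumes "normalized \<psi>" "J \<psi> < \<infinity>" "compact K" "K \<subseteq> interior P"
  shows "\<exists>R. \<forall>p\<in>K. \<forall>x. p \<in> subgradients \<psi> x \<longrightarrow> norm x \<le> R"
proof -
  obtain e K' where e: "e > 0" "compact K'" "K' \<subseteq> interior P" "\<And>x. x \<in> K \<Longrightarrow> cball x e \<subseteq> K'"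
    using compact_nbhd[OF assms(3,4)] by metis
  obtain B where B: "\<And>p. p \<in> K' \<Longrightarrow> \<bar>leg \<psi> p\<bar> \<le> B"
    using leg_bounded[OF normalized_le[OF assms(1)] assms(2) e(2,3)] by blast
  have "norm x \<le> 2 * B / e" if p: "p \<in> K" "p \<in> subgradients \<psi> x" for p x
  proof -
    define q where "q = p + e *\<^sub>R sgn x"
    have "dist p q \<le> e" using e(1) by (simp add: q_def dist_norm norm_sgn)
    then have q: "q \<in> K'" and pK: "p \<in> K'" using e(1,4) p(1) by (auto dest!: e(4))
    have "q \<in> fdom \<psi>" using q e(3) interior_subset_fdom[OF normalized_le[OF assms(1)] assms(2)] by blast
    from leg_upper[OF this, of x] leg_subgrad[OF assms(1) p(2)]
    have "leg \<psi> p + e * (x \<bullet> sgn x) \<le> leg \<psi> q" by (simp add: q_def inner_add_right)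
    moreover have "x \<bullet> sgn x = norm x"
      by (simp add: sgn_div_norm power2_norm_eq_inner[symmetric] power2_eq_square field_simps)
    ultimately have "e * norm x \<le> 2 * B" using B[OF q] B[OF pK] by auto
    then show ?thesis using e(1) by (simp add: field_simps)
  qed
  then show ?thesis by blast
qed

text \<open>The attained slopes have full measure in \<open>P\<close>, hence are dense near
  \<open>p\<close>. Slopes near \<open>p\<close> are attained only within a fixed ball, and the
  subgradient image of a compact ball is closed, so \<open>p\<close> itself is attained.\<close>

lemma subgrad_exists:
  assumes "is_solution \<psi>" "normalized \<psi>" "J \<psi> < \<infinity>" "p \<in> interior P"
  shows "\<exists>x. p \<in> subgradients \<psi> x"
proof -
  have PL: "PLip P \<psi>" by (rule normalized_PLip[OF assms(2)])
  obtain e K' where e: "e > 0" "compact K'" "K' \<subseteq> interior P" "cball p e \<subseteq> K'"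
    using compact_nbhd[of "{p}"] assms(4) by auto
  obtain R where R: "\<And>q x. q \<in> K' \<Longrightarrow> q \<in> subgradients \<psi> x \<Longrightarrow> norm x \<le> R"
    using subgrad_bounded[OF assms(2,3) e(2,3)] by blast
  let ?T = "subgrad_rel \<psi> `` cball 0 R"
  have "closed ?T" by (intro closed_Image_compact closed_subgrad_rel continuous[OF PL] compact_cball)
  moreover have "p \<in> closure ?T"
    unfolding closure_approachable
  proof (intro allI impI)
    fix \<epsilon> :: real assume "0 < \<epsilon>"
    define d where "d = min \<epsilon> e"
    have "d > 0" using e(1) \<open>0 < \<epsilon>\<close> by (simp add: d_def)
    have "\<not> ball p d \<subseteq> P - (\<Union>x. subgradients \<psi> x)"
    proof
      assume "ball p d \<subseteq> P - (\<Union>x. subgradients \<psi> x)"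
      then have "negligible (ball p d)"
        using subgrad_range_null[OF assms(1)] null_sets_lebesgue_subset by (auto simp: negligible_iff_null_sets)
      then show False using open_not_negligible[of "ball p d"] \<open>d > 0\<close> by auto
    qed
    moreover have "ball p d \<subseteq> P"
      using e interior_subset[of P] by (auto simp: d_def subset_iff)
    ultimately obtain q x where q: "q \<in> ball p d" "q \<in> subgradients \<psi> x" by blast
    then have "q \<in> K'" using e(4) by (auto simp: d_def)
    then have "q \<in> ?T" using R[of q x] q(2) by (auto simp: subgrad_rel_iff)
    moreover have "dist q p < \<epsilon>" using q(1) by (auto simp: d_def dist_commute)
    ultimately show "\<exists>y\<in>?T. dist y p < \<epsilon>" by blast
  qed
  ultimately show ?thesis by (auto simp: subgrad_rel_iff)
qed

text \<open>A Borel substitute for the preimage of \<open>Q\<close> under the gradient map.\<close>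
lemma preimage_source:
  assumes "is_solution \<psi>" "PLip P \<psi>" "Q \<in> sets borel" "\<And>q. q \<in> Q \<Longrightarrow> \<exists>x. q \<in> subgradients \<psi> x"
  shows "\<exists>V\<in>sets borel. (\<forall>x\<in>V. \<exists>q\<in>Q. subgradients \<psi> x = {q}) \<and> emeasure lborel Q \<le> emeasure (wt \<psi>) V"
proof -
  let ?R = "subgrad_rel \<psi>"
  have cont: "continuous_on UNIV \<psi>" by (rule continuous[OF assms(2)])
  define Z where "Z = {x. \<exists>y y'. y \<noteq> y' \<and> y \<in> subgradients \<psi> x \<and> y' \<in> subgradients \<psi> x}"
  have Z: "Z \<in> null_sets lebesgue" unfolding Z_def by (rule subgradients_not_unique_null[OF cont])
  define T where "T = ?R\<inverse> `` Q - Z"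
  have "?R\<inverse> `` Q \<in> sets lebesgue"
    by (intro Image_Borel_lebesgue closed_converse monotone_rel_converse closed_subgrad_rel
        monotone_subgrad_rel cont assms(3))
  then have T: "T \<in> sets lebesgue" unfolding T_def using Z by (intro sets.Diff) auto
  \<comment> \<open>\<open>T\<close> is only Lebesgue measurable. Its Borel main part leaves out a
    null set, which joins the points with several subgradients in the Borel null set
    \<open>N\<close>.\<close>
  define V where "V = main_part lborel T"
  have TV: "T = V \<union> null_part lborel T" unfolding V_def by (rule main_part_null_part_Un[OF T, symmetric])
  have V: "V \<in> sets borel" "V \<subseteq> T"
    using main_part_sets[OF T] TV unfolding V_def by (simp, blast)
  obtain N1 where N1: "N1 \<in> null_sets lborel" "null_part lborel T \<subseteq> N1" using null_part[OF T] by blast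
  obtain N2 where N2: "N2 \<in> null_sets lborel" "Z \<subseteq> N2"
    using Z unfolding null_sets_completion_iff2 by blast
  define N where "N = N1 \<union> N2"
  have N: "N \<in> null_sets lborel" unfolding N_def by (intro null_sets.Un N1(1) N2(1))
  have Nb: "N \<in> sets borel" using null_setsD2[OF N] by simp
  have cover: "?R\<inverse> `` Q \<subseteq> V \<union> N"
  proof -
    have "?R\<inverse> `` Q \<subseteq> T \<union> Z" by (auto simp: T_def)
    then show ?thesis using TV N1(2) N2(2) unfolding N_def by blast
  qed
  have "Q \<subseteq> (\<Union>x\<in>V \<union> N. subgradients \<psi> x)"
  proof
    fix q assume "q \<in> Q"
    then obtain x where "q \<in> subgradients \<psi> x" using assms(4) by blast
    moreover from this have "x \<in> ?R\<inverse> `` Q" using \<open>q \<in> Q\<close> by (auto simp: subgrad_rel_iff)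
    then have "x \<in> V \<union> N" using cover by blast
    ultimately show "q \<in> (\<Union>x\<in>V \<union> N. subgradients \<psi> x)" by blast
  qed
  then have "emeasure lebesgue Q \<le> emeasure lebesgue (\<Union>x\<in>V \<union> N. subgradients \<psi> x)"
    using V(1) Nb by (intro emeasure_mono sets_subgradients_image cont sets.Un)
  also have "\<dots> = emeasure (MA \<psi>) (V \<union> N)" using V Nb by (intro emeasure_MA[OF cont, symmetric]) auto
  \<comment> \<open>Here the equation converts the volume of a subgradient image into mass at the
    points; as \<open>\<nu>\<close> has a density, the exceptional set \<open>N\<close> then
    contributes nothing.\<close>
  also have "\<dots> = emeasure (wt \<psi>) (V \<union> N)" using assms(1) by (simp add: is_solution_def)
  also have "\<dots> \<le> emeasure (wt \<psi>) V + emeasure (wt \<psi>) N"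
    using V Nb by (intro emeasure_subadditive) auto
  also have "emeasure (wt \<psi>) N = 0"
  proof -
    have "AE x in \<nu>. x \<notin> N" using null_nu[OF N] by (rule AE_not_in)
    then have "N \<in> null_sets (wt \<psi>)"
      unfolding wt_def using borel[OF assms(2)] Nb by (subst null_sets_density_iff) (auto elim: eventually_mono)
    then show ?thesis by (rule null_setsD1)
  qed
  finally have "emeasure lborel Q \<le> emeasure (wt \<psi>) V" using assms(3) by simp
  moreover have "\<exists>q\<in>Q. subgradients \<psi> x = {q}" if "x \<in> V" for x
  proof -
    have "x \<in> T" using that V by blast
    then obtain q where "q \<in> Q" "q \<in> subgradients \<psi> x" "x \<notin> Z" by (auto simp: T_def subgrad_rel_iff)
    then show ?thesis unfolding Z_def by blast
  qed
  ultimately show ?thesis using V by blast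
qed

text \<open>Inner regularity of the finite measure with density
  \<open>1 + \<bar>leg \<psi> p\<bar>\<close> on \<open>P\<close>, whose frontier is null. The
  weight controls the lost volume and the lost part of the transform integral at once.\<close>

lemma compact_exhaustion:
  assumes "J \<psi> < \<infinity>" "0 < \<eta>"
  shows "\<exists>K. compact K \<and> K \<subseteq> interior P \<and>
    (\<integral>p. indicator (P - K) p * (1 + \<bar>leg \<psi> p\<bar>) \<partial>lborel) \<le> \<eta>"
proof -
  define w where "w p = indicator P p * (1 + \<bar>leg \<psi> p\<bar>)" for p
  have "integrable lborel (\<lambda>p. indicator P p + \<bar>indicator P p * leg \<psi> p\<bar>)"
    by (intro Bochner_Integration.integrable_add integrable_P integrable_abs leg_integrable(1)[OF assms(1)])
  moreover have "(\<lambda>p. indicator P p + \<bar>indicator P p * leg \<psi> p\<bar>) = w"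
    by (auto simp: w_def fun_eq_iff split: split_indicator)
  ultimately have int: "integrable lborel w" by simp
  have [measurable]: "w \<in> borel_measurable borel" unfolding w_def by measurable
  have w0: "0 \<le> w p" for p by (simp add: w_def)
  have iint: "integrable lborel (\<lambda>p. indicator A p * w p)" if "A \<in> sets borel" for A
    using integrable_real_mult_indicator[of A lborel w] int that by (simp add: mult.commute)
  define \<mu> where "\<mu> = density lborel (\<lambda>p. ennreal (w p))"
  have em: "emeasure \<mu> A = ennreal (\<integral>p. indicator A p * w p \<partial>lborel)" if [measurable]: "A \<in> sets borel" for A
  proof -
    have "emeasure \<mu> A = (\<integral>\<^sup>+p. ennreal (indicator A p * w p) \<partial>lborel)"
      unfolding \<mu>_def by (subst emeasure_density) (auto intro!: nn_integral_cong split: split_indicator)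
    then show ?thesis using iint[OF that] w0 by (subst (asm) nn_integral_eq_integral) auto
  qed
  define W where "W = (\<integral>p. indicator (interior P) p * w p \<partial>lborel)"
  have Weq: "W = (\<integral>p. w p \<partial>lborel)"
    unfolding W_def
  proof (rule integral_cong_AE)
    show "AE p in lborel. indicator (interior P) p * w p = w p"
      using AE_not_frontier_convex[OF convex_P]
      by (rule eventually_mono) (use closed_P in \<open>auto simp: frontier_def w_def indicator_def\<close>)
  qed auto
  have "1 \<le> W"
  proof -
    have "(\<integral>p. indicator P p \<partial>lborel) \<le> (\<integral>p. w p \<partial>lborel)"
      by (intro integral_mono integrable_P int) (auto simp: w_def split: split_indicator)
    then show ?thesis using Weq volume_P_measure by simp
  qed
  then have "ennreal (W - \<eta>) < ennreal W" using assms(2) by (simp add: ennreal_less_iff ennreal_lessI)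
  also have "\<dots> = emeasure \<mu> (interior P)" by (simp add: em W_def)
  also have "\<dots> = (SUP K\<in>{K. K \<subseteq> interior P \<and> compact K}. emeasure \<mu> K)"
    using em[of UNIV] by (intro inner_regular) (auto simp: \<mu>_def)
  finally obtain K where K: "K \<subseteq> interior P" "compact K" "ennreal (W - \<eta>) < emeasure \<mu> K"
    unfolding less_SUP_iff by blast
  have Kb: "K \<in> sets borel" using K(2) by (simp add: compact_imp_closed)
  have "W - \<eta> \<le> (\<integral>p. indicator K p * w p \<partial>lborel)"
    using K(3) w0 unfolding em[OF Kb] by (cases "0 \<le> W - \<eta>") (auto simp: ennreal_less_iff intro: order_trans[OF _ integral_nonneg_AE])
  moreover have "(\<integral>p. indicator (P - K) p * (1 + \<bar>leg \<psi> p\<bar>) \<partial>lborel) = (\<integral>p. w p - indicator K p * w p \<partial>lborel)"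
    by (intro Bochner_Integration.integral_cong refl)
      (use K(1) interior_subset[of P] in \<open>auto simp: w_def split: split_indicator\<close>)
  moreover have "\<dots> = W - (\<integral>p. indicator K p * w p \<partial>lborel)"
    unfolding Weq using int iint[OF Kb] by (intro Bochner_Integration.integral_diff) auto
  ultimately show ?thesis using K by (intro exI[of _ K]) auto
qed

text \<open>On \<open>V a \<times> Q a\<close> the Young inequality \<open>\<langle>x, p\<rangle> \<le> \<psi> x + \<psi>\<^sup>* p\<close> is an equality up to \<open>\<eta>\<close>.\<close>
lemma cells_exist:
  assumes sol: "is_solution \<psi>" and n: "normalized \<psi>" and J: "J \<psi> < \<infinity>" and \<eta>: "0 < \<eta>"
  obtains C :: "(real^'n) set" and Q V v B where
    "finite C" "0 < v" "1 - \<eta> \<le> v * real (card C)" "v * real (card C) \<le> 1"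
    "\<And>a. a \<in> C \<Longrightarrow> convex (Q a)" "\<And>a. a \<in> C \<Longrightarrow> Q a \<in> sets borel"
    "\<And>a. a \<in> C \<Longrightarrow> Q a \<subseteq> interior P" "\<And>a. a \<in> C \<Longrightarrow> measure lborel (Q a) = v"
    "\<And>a p. a \<in> C \<Longrightarrow> p \<in> Q a \<Longrightarrow> \<bar>leg \<psi> p\<bar> \<le> B"
    "disjoint_family_on Q C" "disjoint_family_on V C" "\<And>a. a \<in> C \<Longrightarrow> V a \<in> sets borel"
    "\<And>a p. a \<in> C \<Longrightarrow> p \<in> Q a \<Longrightarrow>
      ennreal (exp (\<beta> * (leg \<psi> p - \<eta>)) * v) \<le> (\<integral>\<^sup>+x. ennreal (exp (\<beta> * (x \<bullet> p))) * indicator (V a) x \<partial>\<nu>)"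
    "(\<integral>p. indicator P p * leg \<psi> p \<partial>lborel) - \<eta> \<le> (\<Sum>a\<in>C. \<integral>p. indicator (Q a) p * leg \<psi> p \<partial>lborel)"
proof -
  have PL: "PLip P \<psi>" by (rule normalized_PLip[OF n])
  note [measurable] = borel[OF PL]
  note le0 = normalized_le[OF n]
  obtain K where K: "compact K" "K \<subseteq> interior P"
    "(\<integral>p. indicator (P - K) p * (1 + \<bar>leg \<psi> p\<bar>) \<partial>lborel) \<le> \<eta>"
    using compact_exhaustion[OF J \<eta>] by blast
  obtain e K' where e: "e > 0" "compact K'" "K' \<subseteq> interior P" "\<And>x. x \<in> K \<Longrightarrow> cball x e \<subseteq> K'"
    using compact_nbhd[OF K(1,2)] by metis
  obtain R0 where R0: "\<And>q x. q \<in> K' \<Longrightarrow> q \<in> subgradients \<psi> x \<Longrightarrow> norm x \<le> R0"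
    using subgrad_bounded[OF n J e(2,3)] by blast
  define R where "R = max R0 1"
  have R: "norm x \<le> R" "0 < R" if "q \<in> K'" "q \<in> subgradients \<psi> x" for q x using R0[OF that] by (auto simp: R_def)
  have "0 < R" by (simp add: R_def)
  obtain B where B: "\<And>p. p \<in> K' \<Longrightarrow> \<bar>leg \<psi> p\<bar> \<le> B" using leg_bounded[OF le0 J e(2,3)] by blast
  \<comment> \<open>The bound \<open>e\<close> keeps every cube meeting \<open>K\<close> inside
    \<open>K'\<close>; the bound \<open>\<eta> / (2 * R)\<close> makes the Young gap at most
    \<open>2 * R * d \<le> \<eta>\<close>.\<close>
  define d where "d = min e (\<eta> / (2 * R))"
  have "0 < d" using e \<eta> \<open>0 < R\<close> by (simp add: d_def)
  obtain m :: nat where m: "real m > 2 * real CARD('n) / d" using reals_Archimedean2 by blast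
  have m0: "0 < m" using m \<open>0 < d\<close> by (metis divide_nonneg_pos gr0I mult_nonneg_nonneg not_less of_nat_0 of_nat_0_le_iff zero_le_numeral)
  have diam: "norm (x - y) \<le> d" if "x \<in> cell m a" "y \<in> cell m a" "a \<in> int_vecs" for x y :: "real^'n" and a
  proof -
    have "vfloor m x = a" "vfloor m y = a" using that mem_cell_iff by blast+
    then have "norm (x - (1 / real m) *\<^sub>R a) \<le> real CARD('n) / real m" "norm (y - (1 / real m) *\<^sub>R a) \<le> real CARD('n) / real m"
      using norm_vfloor_diff[OF m0, of x] norm_vfloor_diff[OF m0, of y] by auto
    then have "norm (x - y) \<le> 2 * real CARD('n) / real m"
      using norm_triangle_ineq4[of "x - (1 / real m) *\<^sub>R a" "y - (1 / real m) *\<^sub>R a"] by simp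
    also have "\<dots> \<le> d" using m m0 \<open>0 < d\<close> by (simp add: field_simps)
    finally show ?thesis .
  qed
  \<comment> \<open>Cubes that meet \<open>K\<close>, not only those inside it: they cover
    \<open>K\<close>, so whatever they miss of \<open>P\<close> lies in
    \<open>P - K\<close>.\<close>
  define C where "C = {a \<in> int_vecs. cell m a \<inter> K \<noteq> {}}"
  define Q where "Q = (\<lambda>a::real^'n. cell m a)"
  define v where "v = 1 / real m ^ CARD('n)"
  have v: "0 < v" using m0 by (simp add: v_def)
  have C_int: "a \<in> int_vecs" if "a \<in> C" for a using that by (simp add: C_def)
  have QK': "Q a \<subseteq> K'" if aC: "a \<in> C" for a
  proof
    fix p assume p: "p \<in> Q a"
    have "cell m a \<inter> K \<noteq> {}" using aC by (simp add: C_def)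
    then obtain x where x: "x \<in> cell m a" "x \<in> K" by blast
    have "norm (x - p) \<le> d" using x(1) p C_int[OF aC] unfolding Q_def by (rule diam)
    then have "p \<in> cball x e" by (simp add: dist_norm d_def)
    then show "p \<in> K'" using e(4)[OF x(2)] by blast
  qed
  have finC: "finite C"
  proof -
    obtain b where b: "\<And>x. x \<in> K \<Longrightarrow> norm x \<le> b" using compact_imp_bounded[OF K(1)] by (auto simp: bounded_iff)
    have "C \<subseteq> cball 0 (real m * (b + real CARD('n) / real m)) \<inter> int_vecs"
    proof
      fix a assume a: "a \<in> C"
      then obtain x where x: "x \<in> cell m a" "x \<in> K" by (auto simp: C_def)
      then have "vfloor m x = a" using mem_cell_iff C_int[OF a] by blast
      then have "norm ((1 / real m) *\<^sub>R a) \<le> norm x + norm (x - (1 / real m) *\<^sub>R a)"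
        and "norm (x - (1 / real m) *\<^sub>R a) \<le> real CARD('n) / real m"
        using norm_vfloor_diff[OF m0, of x] norm_triangle_sub[of "(1 / real m) *\<^sub>R a" x]
        by (auto simp: norm_minus_commute)
      then have "norm ((1 / real m) *\<^sub>R a) \<le> b + real CARD('n) / real m" using b[OF x(2)] by linarith
      then have "real m * norm ((1 / real m) *\<^sub>R a) \<le> real m * (b + real CARD('n) / real m)" by (rule mult_left_mono) simp
      then show "a \<in> cball 0 (real m * (b + real CARD('n) / real m)) \<inter> int_vecs"
        using m0 C_int[OF a] by simp
    qed
    then show ?thesis by (rule finite_subset) (intro finite_int_vecs bounded_cball)
  qed
  have disjQ: "disjoint_family_on Q C"
    unfolding disjoint_family_on_def Q_def
  proof (intro ballI impI equals0I)
    fix a b x assume "a \<in> C" "b \<in> C" "a \<noteq> b" "x \<in> cell m a \<inter> cell m b"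
    then have "vfloor m x = a" "vfloor m x = b"
      using mem_cell_iff[OF C_int[of a], of x m] mem_cell_iff[OF C_int[of b], of x m] by blast+
    then show False using \<open>a \<noteq> b\<close> by simp
  qed
  have KU: "K \<subseteq> (\<Union>a\<in>C. Q a)"
  proof
    fix x assume "x \<in> K"
    have x: "x \<in> cell m (vfloor m x)" by (simp add: mem_cell_iff vfloor_int_vecs)
    then have "vfloor m x \<in> C" using \<open>x \<in> K\<close> by (auto simp: C_def vfloor_int_vecs)
    then show "x \<in> (\<Union>a\<in>C. Q a)" using x unfolding Q_def by blast
  qed
  have UP: "(\<Union>a\<in>C. Q a) \<subseteq> P" using QK' e(3) interior_subset[of P] by blast
  have indU: "indicator (\<Union>a\<in>C. Q a) p = (\<Sum>a\<in>C. indicator (Q a) p :: real)" for p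
    by (rule indicator_UN_disjoint[OF finC disjQ])
  have intQ: "integrable lborel (indicator (Q a) :: _ \<Rightarrow> real)" for a
    unfolding Q_def using m0 by (intro integrable_real_indicator) (auto simp: emeasure_cell)
  have measQ: "measure lborel (Q a) = v" for a by (simp add: Q_def v_def measure_cell m0)
  have intQleg: "integrable lborel (\<lambda>p. indicator (Q a) p * leg \<psi> p)" if "a \<in> C" for a
  proof -
    have "(\<lambda>p. indicator (Q a) p * leg \<psi> p) = (\<lambda>p. indicator (Q a) p * (indicator P p * leg \<psi> p))"
      using QK'[OF that] e(3) interior_subset[of P] by (auto simp: fun_eq_iff split: split_indicator)
    then show ?thesis
      using integrable_real_mult_indicator[of "Q a" lborel "\<lambda>p. indicator P p * leg \<psi> p"] leg_integrable(1)[OF J]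
      by (simp add: Q_def mult.commute)
  qed
  have Kb: "K \<in> sets borel" using K(1) by (simp add: compact_imp_closed)
  have iw: "integrable lborel (\<lambda>p. indicator (P - K) p * (1 + \<bar>leg \<psi> p\<bar>))"
  proof -
    have "integrable lborel (\<lambda>p. (indicator P p + \<bar>indicator P p * leg \<psi> p\<bar>) * indicator (P - K) p)"
      using Kb by (intro integrable_real_mult_indicator Bochner_Integration.integrable_add integrable_P integrable_abs
          leg_integrable(1)[OF J]) auto
    moreover have "(\<lambda>p. (indicator P p + \<bar>indicator P p * leg \<psi> p\<bar>) * indicator (P - K) p)
        = (\<lambda>p. indicator (P - K) p * (1 + \<bar>leg \<psi> p\<bar>))"
      by (auto simp: fun_eq_iff split: split_indicator)
    ultimately show ?thesis by simp
  qed
  have volC: "(\<integral>p. indicator (\<Union>a\<in>C. Q a) p \<partial>lborel) = v * real (card C)"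
    unfolding indU using intQ measQ by (subst Bochner_Integration.integral_sum) auto
  have intU: "integrable lborel (indicator (\<Union>a\<in>C. Q a) :: _ \<Rightarrow> real)"
    unfolding indU[abs_def] using intQ by auto
  have vol_le: "v * real (card C) \<le> 1"
  proof -
    have "(\<integral>p. indicator (\<Union>a\<in>C. Q a) p \<partial>lborel) \<le> (\<integral>p. indicator P p \<partial>lborel :: real)"
      using UP by (intro integral_mono intU integrable_P) (auto split: split_indicator)
    then show ?thesis using volC volume_P_measure by simp
  qed
  have vol_ge: "1 - \<eta> \<le> v * real (card C)"
  proof -
    have "(\<integral>p. indicator P p - indicator (\<Union>a\<in>C. Q a) p \<partial>lborel) \<le> (\<integral>p. indicator (P - K) p * (1 + \<bar>leg \<psi> p\<bar>) \<partial>lborel)"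
      using KU UP by (intro integral_mono Bochner_Integration.integrable_diff intU integrable_P iw) (auto split: split_indicator)
    also have "(\<integral>p. indicator P p - indicator (\<Union>a\<in>C. Q a) p \<partial>lborel :: real) = 1 - v * real (card C)"
      using intU integrable_P volume_P_measure volC by (subst Bochner_Integration.integral_diff) auto
    finally show ?thesis using K(3) by simp
  qed
  have leg_ge: "(\<integral>p. indicator P p * leg \<psi> p \<partial>lborel) - \<eta> \<le> (\<Sum>a\<in>C. \<integral>p. indicator (Q a) p * leg \<psi> p \<partial>lborel)"
  proof -
    have eq: "(\<Sum>a\<in>C. \<integral>p. indicator (Q a) p * leg \<psi> p \<partial>lborel) = (\<integral>p. indicator (\<Union>a\<in>C. Q a) p * leg \<psi> p \<partial>lborel)"
      unfolding indU sum_distrib_right using intQleg by (subst Bochner_Integration.integral_sum) auto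
    have iUl: "integrable lborel (\<lambda>p. indicator (\<Union>a\<in>C. Q a) p * leg \<psi> p)"
      unfolding indU sum_distrib_right using intQleg by auto
    have "(\<integral>p. indicator P p * leg \<psi> p - indicator (\<Union>a\<in>C. Q a) p * leg \<psi> p \<partial>lborel)
        \<le> (\<integral>p. indicator (P - K) p * (1 + \<bar>leg \<psi> p\<bar>) \<partial>lborel)"
      using KU UP by (intro integral_mono Bochner_Integration.integrable_diff iUl leg_integrable(1)[OF J] iw)
        (auto split: split_indicator)
    also have "(\<integral>p. indicator P p * leg \<psi> p - indicator (\<Union>a\<in>C. Q a) p * leg \<psi> p \<partial>lborel)
        = (\<integral>p. indicator P p * leg \<psi> p \<partial>lborel) - (\<integral>p. indicator (\<Union>a\<in>C. Q a) p * leg \<psi> p \<partial>lborel)"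
      by (intro Bochner_Integration.integral_diff iUl leg_integrable(1)[OF J])
    finally show ?thesis using K(3) eq by simp
  qed
  have "\<exists>V. V \<in> sets borel \<and> (\<forall>x\<in>V. \<exists>q\<in>Q a. subgradients \<psi> x = {q}) \<and> emeasure lborel (Q a) \<le> emeasure (wt \<psi>) V"
    if "a \<in> C" for a
  proof -
    have "\<exists>x. q \<in> subgradients \<psi> x" if "q \<in> Q a" for q
      using QK'[OF \<open>a \<in> C\<close>] that e(3) by (intro subgrad_exists[OF sol n J]) blast
    moreover have "Q a \<in> sets borel" unfolding Q_def by measurable
    ultimately show ?thesis using preimage_source[OF sol PL] by blast
  qed
  then obtain V where V: "\<And>a. a \<in> C \<Longrightarrow> V a \<in> sets borel"
    "\<And>a x. a \<in> C \<Longrightarrow> x \<in> V a \<Longrightarrow> \<exists>q\<in>Q a. subgradients \<psi> x = {q}"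
    "\<And>a. a \<in> C \<Longrightarrow> emeasure lborel (Q a) \<le> emeasure (wt \<psi>) (V a)"
    by metis
  have disjV: "disjoint_family_on V C"
    unfolding disjoint_family_on_def
  proof (intro ballI impI equals0I)
    fix a b x assume ab: "a \<in> C" "b \<in> C" "a \<noteq> b" and x: "x \<in> V a \<inter> V b"
    obtain q q' where "q \<in> Q a" "subgradients \<psi> x = {q}" "q' \<in> Q b" "subgradients \<psi> x = {q'}"
      using V(2)[OF ab(1), of x] V(2)[OF ab(2), of x] x by blast
    then have "q \<in> Q a \<inter> Q b" by auto
    then show False using disjQ ab by (auto simp: disjoint_family_on_def)
  qed
  have main: "ennreal (exp (\<beta> * (leg \<psi> p - \<eta>)) * v) \<le> (\<integral>\<^sup>+x. ennreal (exp (\<beta> * (x \<bullet> p))) * indicator (V a) x \<partial>\<nu>)"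
    if a: "a \<in> C" and p: "p \<in> Q a" for a p
  proof -
    have pK: "p \<in> K'" using QK'[OF a] p by blast
    obtain y where y: "p \<in> subgradients \<psi> y" using subgrad_exists[OF sol n J, of p] pK e(3) by blast
    \<comment> \<open>With \<open>p\<close> a subgradient at \<open>y\<close> and \<open>q\<close>
      one at \<open>x\<close>, the Young gap is at most \<open>(y - x) \<bullet> (p - q)\<close>.
      Both points have norm at most \<open>R\<close>, and both slopes lie in the same cube.\<close>
    have gap: "leg \<psi> p - \<eta> + \<psi> x \<le> x \<bullet> p" if x: "x \<in> V a" for x
    proof -
      obtain q where q: "q \<in> Q a" "subgradients \<psi> x = {q}" using V(2)[OF a x] by blast
      have qs: "q \<in> subgradients \<psi> x" using q(2) by simp
      have qK: "q \<in> K'" using QK'[OF a] q by blast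
      have "\<psi> x + q \<bullet> (y - x) \<le> \<psi> y" using qs by (rule subgradientsD)
      then have "leg \<psi> p \<le> x \<bullet> p - \<psi> x + (y - x) \<bullet> (p - q)"
        using leg_subgrad(2)[OF n y] by (simp add: inner_diff_left inner_diff_right inner_commute[of q])
      moreover have "(y - x) \<bullet> (p - q) \<le> norm (y - x) * norm (p - q)" by (rule norm_cauchy_schwarz)
      moreover have "norm (y - x) * norm (p - q) \<le> (2 * R) * d"
        using R(1)[OF pK y] R(1)[OF qK qs] norm_triangle_ineq4[of y x] diam[of p a q] p q(1) C_int[OF a] \<open>0 < R\<close>
        by (intro mult_mono) (auto simp: Q_def)
      moreover have "(2 * R) * d \<le> \<eta>"
      proof -
        have "(2 * R) * d \<le> (2 * R) * (\<eta> / (2 * R))" using \<open>0 < R\<close> by (intro mult_left_mono) (auto simp: d_def)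
        then show ?thesis using \<open>0 < R\<close> by simp
      qed
      ultimately show ?thesis by linarith
    qed
    have "ennreal (exp (\<beta> * (leg \<psi> p - \<eta>)) * v) = ennreal (exp (\<beta> * (leg \<psi> p - \<eta>))) * emeasure lborel (Q a)"
      using v m0 by (simp add: Q_def emeasure_cell v_def ennreal_mult[symmetric])
    also have "\<dots> \<le> ennreal (exp (\<beta> * (leg \<psi> p - \<eta>))) * emeasure (wt \<psi>) (V a)"
      by (intro mult_left_mono V(3) a) simp
    also have "\<dots> = (\<integral>\<^sup>+x. ennreal (exp (\<beta> * (leg \<psi> p - \<eta>))) * (ennreal (exp (\<beta> * \<psi> x)) * indicator (V a) x) \<partial>\<nu>)"
      unfolding wt_def using V(1)[OF a] by (subst emeasure_density) (auto simp: nn_integral_cmult)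
    also have "\<dots> \<le> (\<integral>\<^sup>+x. ennreal (exp (\<beta> * (x \<bullet> p))) * indicator (V a) x \<partial>\<nu>)"
    proof (intro nn_integral_mono)
      fix x
      show "ennreal (exp (\<beta> * (leg \<psi> p - \<eta>))) * (ennreal (exp (\<beta> * \<psi> x)) * indicator (V a) x)
          \<le> ennreal (exp (\<beta> * (x \<bullet> p))) * indicator (V a) x"
      proof (cases "x \<in> V a")
        case True
        have "exp (\<beta> * (leg \<psi> p - \<eta>)) * exp (\<beta> * \<psi> x) = exp (\<beta> * (leg \<psi> p - \<eta> + \<psi> x))"
          by (simp add: exp_add[symmetric] distrib_left)
        also have "\<dots> \<le> exp (\<beta> * (x \<bullet> p))" using gap[OF True] beta_pos by simp
        finally show ?thesis using True by (simp add: ennreal_mult[symmetric] ennreal_leI)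
      qed simp
    qed
    finally show ?thesis .
  qed
  show thesis
  proof (rule that[of C v Q B V])
    show "\<And>a. a \<in> C \<Longrightarrow> convex (Q a)" by (simp add: Q_def convex_cell)
    show "\<And>a. a \<in> C \<Longrightarrow> Q a \<in> sets borel" by (simp add: Q_def)
    show "\<And>a. a \<in> C \<Longrightarrow> Q a \<subseteq> interior P" using QK' e(3) by blast
    show "\<And>a p. a \<in> C \<Longrightarrow> p \<in> Q a \<Longrightarrow> \<bar>leg \<psi> p\<bar> \<le> B" using QK' B by blast
  qed (use finC v vol_ge vol_le measQ disjQ disjV V main leg_ge in auto)
qed

end

section \<open>Permanents\<close>

lemma Per_pos: "0 < Per N p x"
proof -
  have "id permutes {1..N}" by (rule permutes_id)
  then show ?thesis
    unfolding Per_def by (intro sum_pos prod_pos) (auto simp: finite_permutations intro: exI[of _ id])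
qed

lemma Per_compose:
  assumes "\<tau> permutes {1..N}"
  shows "Per N p (x \<circ> \<tau>) = Per N p x"
proof -
  have "(\<Prod>i=1..N. exp ((x \<circ> \<tau>) i \<bullet> p (\<sigma> i))) = (\<Prod>i=1..N. exp (x i \<bullet> p ((\<sigma> \<circ> inv \<tau>) i)))" for \<sigma>
    by (subst prod.permute[OF permutes_inv[OF assms]])
      (auto intro!: prod.cong simp: permutes_inverses[OF assms] comp_def)
  then have "Per N p (x \<circ> \<tau>) = (\<Sum>\<sigma> | \<sigma> permutes {1..N}. \<Prod>i=1..N. exp (x i \<bullet> p ((\<sigma> \<circ> inv \<tau>) i)))"
    unfolding Per_def by simp
  also have "\<dots> = Per N p x"
    unfolding Per_def by (rule sum_permutations_compose_right[OF permutes_inv[OF assms], symmetric])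
  finally show ?thesis .
qed

text \<open>Applied to every factor, the Young inequality produces a sum of \<open>l\<close> over
  all indices, which does not depend on the permutation; so all N! terms obey the same
  bound.\<close>

lemma Per_le_Young:
  assumes k: "0 < k" and Y: "\<And>i z. i \<in> {1..N} \<Longrightarrow> z \<bullet> ((1 / real k) *\<^sub>R p i) \<le> \<psi> z + l i"
  shows "Per N p x \<le> fact N * exp (real k * ((\<Sum>i=1..N. \<psi> (x i)) + (\<Sum>i=1..N. l i)))"
proof -
  have "(\<Prod>i=1..N. exp (x i \<bullet> p (\<sigma> i))) \<le> exp (real k * ((\<Sum>i=1..N. \<psi> (x i)) + (\<Sum>i=1..N. l i)))"
    if \<sigma>: "\<sigma> permutes {1..N}" for \<sigma>
  proof -
    have "x i \<bullet> p (\<sigma> i) \<le> real k * (\<psi> (x i) + l (\<sigma> i))" if "i \<in> {1..N}" for i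
    proof -
      have "\<sigma> i \<in> {1..N}" using permutes_in_image[OF \<sigma>] that by blast
      then have "real k * (x i \<bullet> ((1 / real k) *\<^sub>R p (\<sigma> i))) \<le> real k * (\<psi> (x i) + l (\<sigma> i))"
        by (intro mult_left_mono Y) auto
      then show ?thesis using k by simp
    qed
    then have "(\<Sum>i=1..N. x i \<bullet> p (\<sigma> i)) \<le> (\<Sum>i=1..N. real k * (\<psi> (x i) + l (\<sigma> i)))" by (rule sum_mono)
    also have "\<dots> = real k * ((\<Sum>i=1..N. \<psi> (x i)) + (\<Sum>i=1..N. (l \<circ> \<sigma>) i))"
      by (simp add: sum_distrib_left[symmetric] sum.distrib)
    also have "(\<Sum>i=1..N. (l \<circ> \<sigma>) i) = (\<Sum>i=1..N. l i)" by (rule sum.permute[OF \<sigma>, symmetric])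
    finally show ?thesis by (simp add: exp_sum[symmetric])
  qed
  then have "Per N p x \<le> (\<Sum>\<sigma> | \<sigma> permutes {1..N}. exp (real k * ((\<Sum>i=1..N. \<psi> (x i)) + (\<Sum>i=1..N. l i))))"
    unfolding Per_def by (intro sum_mono) auto
  also have "\<dots> = fact N * exp (real k * ((\<Sum>i=1..N. \<psi> (x i)) + (\<Sum>i=1..N. l i)))"
    by (simp add: card_permutations)
  finally show ?thesis .
qed

text \<open>Such a permutation is determined by its restrictions to the label classes, each of which
  is a permutation of the class.\<close>

lemma card_label_preserving_permutations:
  assumes "finite I"
  shows "card {\<tau>. \<tau> permutes I \<and> (\<forall>i\<in>I. lab (\<tau> i) = lab i)} \<le> (\<Prod>c\<in>lab ` I. fact (card {i\<in>I. lab i = c}))"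
proof -
  define fib where "fib c = {i\<in>I. lab i = c}" for c
  define S where "S = {\<tau>. \<tau> permutes I \<and> (\<forall>i\<in>I. lab (\<tau> i) = lab i)}"
  define G where "G \<tau> = (\<lambda>c\<in>lab ` I. \<lambda>i. if i \<in> fib c then \<tau> i else i)" for \<tau> :: "'a \<Rightarrow> 'a"
  have fin: "finite (fib c)" for c using assms by (simp add: fib_def)
  have perm: "(\<lambda>i. if i \<in> fib c then \<tau> i else i) permutes fib c" if "\<tau> \<in> S" for \<tau> c
  proof (rule bij_imp_permutes)
    have "inj_on \<tau> (fib c)" using that by (auto simp: S_def intro: inj_on_subset[OF permutes_inj])
    moreover have "\<tau> ` fib c \<subseteq> fib c" using that by (auto simp: S_def fib_def permutes_in_image)
    ultimately have "bij_betw \<tau> (fib c) (fib c)"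
      using fin by (simp add: bij_betw_def endo_inj_surj)
    then show "bij_betw (\<lambda>i. if i \<in> fib c then \<tau> i else i) (fib c) (fib c)"
      by (rule bij_betw_cong[THEN iffD1, rotated]) simp
  qed simp
  have "G ` S \<subseteq> (\<Pi>\<^sub>E c\<in>lab ` I. {\<pi>. \<pi> permutes fib c})" using perm by (auto simp: G_def)
  moreover have "inj_on G S"
  proof (rule inj_onI)
    fix \<tau> \<tau>' assume *: "\<tau> \<in> S" "\<tau>' \<in> S" "G \<tau> = G \<tau>'"
    show "\<tau> = \<tau>'"
    proof
      fix i show "\<tau> i = \<tau>' i"
      proof (cases "i \<in> I")
        case True
        have "G \<tau> (lab i) i = G \<tau>' (lab i) i" using *(3) by simp
        then show ?thesis using True by (simp add: G_def fib_def)
      next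
        case False
        then show ?thesis using *(1,2) by (auto simp: S_def permutes_not_in)
      qed
    qed
  qed
  moreover have "finite (\<Pi>\<^sub>E c\<in>lab ` I. {\<pi>. \<pi> permutes fib c})"
    using assms fin by (intro finite_PiE finite_permutations) auto
  ultimately have "card S \<le> card (\<Pi>\<^sub>E c\<in>lab ` I. {\<pi>. \<pi> permutes fib c})" by (intro card_inj_on_le[of G])
  also have "\<dots> = (\<Prod>c\<in>lab ` I. fact (card (fib c)))"
    using assms fin by (simp add: card_PiE card_permutations)
  finally show ?thesis by (simp add: S_def fib_def)
qed

text \<open>Disjointness of the sets \<open>V c\<close> means that each point \<open>x i\<close>
  determines the label it must receive. Composing with the inverse of one fixed matching turns every
  other matching into a label-preserving permutation.\<close>

lemma card_matching_permutations:
  assumes "finite I" and disj: "disjoint_family_on V (lab ` I)"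
  shows "card {\<sigma>. \<sigma> permutes I \<and> (\<forall>i\<in>I. x i \<in> V (lab (\<sigma> i)))} \<le> (\<Prod>c\<in>lab ` I. fact (card {i\<in>I. lab i = c}))"
proof -
  define S where "S = {\<sigma>. \<sigma> permutes I \<and> (\<forall>i\<in>I. x i \<in> V (lab (\<sigma> i)))}"
  define T where "T = {\<tau>. \<tau> permutes I \<and> (\<forall>i\<in>I. lab (\<tau> i) = lab i)}"
  have "card S \<le> card T"
  proof (cases "S = {}")
    case False
    then obtain \<sigma>0 where s0: "\<sigma>0 permutes I" "\<And>i. i \<in> I \<Longrightarrow> x i \<in> V (lab (\<sigma>0 i))" by (auto simp: S_def)
    have "(\<lambda>\<sigma>. \<sigma> \<circ> inv \<sigma>0) ` S \<subseteq> T"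
    proof clarify
      fix \<sigma> assume "\<sigma> \<in> S"
      then have s: "\<sigma> permutes I" "\<And>i. i \<in> I \<Longrightarrow> x i \<in> V (lab (\<sigma> i))" by (auto simp: S_def)
      have "lab (\<sigma> i) = lab (\<sigma>0 i)" if "i \<in> I" for i
      proof (rule ccontr)
        assume "lab (\<sigma> i) \<noteq> lab (\<sigma>0 i)"
        moreover have "lab (\<sigma> i) \<in> lab ` I" "lab (\<sigma>0 i) \<in> lab ` I"
          using that permutes_in_image[OF s(1)] permutes_in_image[OF s0(1)] by auto
        ultimately have "V (lab (\<sigma> i)) \<inter> V (lab (\<sigma>0 i)) = {}" using disj unfolding disjoint_family_on_def by blast
        then show False using s(2)[OF that] s0(2)[OF that] by blast
      qed
      note eq = this
      have "lab ((\<sigma> \<circ> inv \<sigma>0) i) = lab i" if "i \<in> I" for i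
        using eq[of "inv \<sigma>0 i"] permutes_in_image[OF permutes_inv[OF s0(1)], of i] that
        by (simp add: permutes_inverses[OF s0(1)])
      then show "\<sigma> \<circ> inv \<sigma>0 \<in> T"
        using permutes_compose[OF permutes_inv[OF s0(1)] s(1)] by (auto simp: T_def)
    qed
    moreover have "inj_on (\<lambda>\<sigma>. \<sigma> \<circ> inv \<sigma>0) S"
    proof (rule inj_onI)
      fix \<sigma> \<sigma>' assume "\<sigma> \<circ> inv \<sigma>0 = \<sigma>' \<circ> inv \<sigma>0"
      then have "\<sigma> \<circ> (inv \<sigma>0 \<circ> \<sigma>0) = \<sigma>' \<circ> (inv \<sigma>0 \<circ> \<sigma>0)" by (metis comp_assoc)
      then show "\<sigma> = \<sigma>'" by (simp add: permutes_inv_o[OF s0(1)])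
    qed
    moreover have "finite T" unfolding T_def using finite_permutations[OF assms(1)] by auto
    ultimately show ?thesis by (intro card_inj_on_le)
  qed simp
  then show ?thesis
    using card_label_preserving_permutations[OF assms(1), of lab] by (simp add: S_def T_def)
qed

section \<open>Finite powers of the reference measure\<close>

context ma_equation
begin

sublocale prodnu: product_sigma_finite "\<lambda>_::nat. \<nu>"
  by (simp add: product_sigma_finite_def sigma_finite_nu)

abbreviation (input) piM :: "nat set \<Rightarrow> (nat \<Rightarrow> real^'n) measure" where
  "piM I \<equiv> Pi\<^sub>M I (\<lambda>_. \<nu>)"

lemma measurable_Per [measurable]: "(\<lambda>x. Per N p x) \<in> borel_measurable (piM {1..N})"
  unfolding Per_def by measurable

lemma measurable_Per_upd [measurable]: "(\<lambda>y. Per N p (y(1 := x))) \<in> borel_measurable (piM {2..N})"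
proof -
  have "(\<lambda>y. Per N p (y(1 := x)))
     = (\<lambda>y. \<Sum>\<sigma> | \<sigma> permutes {1..N}. \<Prod>i=1..N. if i = 1 then exp (x \<bullet> p (\<sigma> i)) else exp (y i \<bullet> p (\<sigma> i)))"
    unfolding Per_def by (intro ext sum.cong prod.cong) auto
  also have "\<dots> \<in> borel_measurable (piM {2..N})"
  proof (intro borel_measurable_sum borel_measurable_prod)
    fix \<sigma> i assume "i \<in> {1..N}"
    then show "(\<lambda>y. if i = 1 then exp (x \<bullet> p (\<sigma> i)) else exp (y i \<bullet> p (\<sigma> i))) \<in> borel_measurable (piM {2..N})"
      by (cases "i = 1") auto
  qed
  finally show ?thesis .
qed

lemma piM_nonnull: "finite I \<Longrightarrow> emeasure (piM I) (space (piM I)) \<noteq> 0"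
  using nu_open_pos[of UNIV] by (auto simp: space_PiM prodnu.emeasure_PiM prod_zero_iff)

lemma integral_piM_pos:
  fixes f :: "(nat \<Rightarrow> real^'n) \<Rightarrow> real"
  assumes "finite I" "integrable (piM I) f" "\<And>x. 0 < f x"
  shows "0 < (\<integral>x. f x \<partial>(piM I))"
proof -
  have "(\<integral>x. f x \<partial>(piM I)) \<noteq> 0"
  proof
    assume "(\<integral>x. f x \<partial>(piM I)) = 0"
    then have "AE x in piM I. f x = 0"
      using integral_nonneg_eq_0_iff_AE[OF assms(2)] assms(3) by (simp add: less_imp_le)
    then have "AE x in piM I. x \<notin> space (piM I)" using assms(3) by (auto elim!: eventually_mono simp: less_le)
    then have "space (piM I) \<in> null_sets (piM I)" by (subst AE_iff_null_sets) auto
    then show False using piM_nonnull[OF assms(1)] by (auto simp: null_sets_def)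
  qed
  moreover have "0 \<le> (\<integral>x. f x \<partial>(piM I))" using assms(3) by (intro integral_nonneg_AE) (auto simp: less_imp_le)
  ultimately show ?thesis by simp
qed

lemma distr_piM_permute:
  assumes "finite I" "\<sigma> permutes I"
  shows "distr (piM I) (piM I) (\<lambda>x. x \<circ> \<sigma>) = piM I"
proof (rule prodnu.PiM_eqI[OF assms(1)])
  have ext: "x \<circ> \<sigma> = restrict (\<lambda>i. x (\<sigma> i)) I" if "x \<in> space (piM I)" for x
    using that assms(2) by (auto simp: space_PiM PiE_def extensional_def fun_eq_iff permutes_not_in)
  have inI: "\<sigma> i \<in> I" if "i \<in> I" for i using that permutes_in_image[OF assms(2)] by simp
  have "(\<lambda>x. restrict (\<lambda>i. x (\<sigma> i)) I) \<in> piM I \<rightarrow>\<^sub>M piM I"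
    by (intro measurable_restrict measurable_component_singleton inI)
  then have meas: "(\<lambda>x. x \<circ> \<sigma>) \<in> piM I \<rightarrow>\<^sub>M piM I"
    by (subst measurable_cong[OF ext])
  fix A :: "nat \<Rightarrow> (real^'n) set" assume A: "\<And>i. i \<in> I \<Longrightarrow> A i \<in> sets \<nu>"
  have "emeasure (distr (piM I) (piM I) (\<lambda>x. x \<circ> \<sigma>)) (Pi\<^sub>E I A)
      = emeasure (piM I) ((\<lambda>x. x \<circ> \<sigma>) -` Pi\<^sub>E I A \<inter> space (piM I))"
    using A assms(1) by (intro emeasure_distr meas sets_PiM_I_finite) auto
  also have "(\<lambda>x. x \<circ> \<sigma>) -` Pi\<^sub>E I A \<inter> space (piM I) = Pi\<^sub>E I (\<lambda>i. A (inv \<sigma> i))"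
  proof (intro set_eqI iffI)
    fix x assume "x \<in> (\<lambda>x. x \<circ> \<sigma>) -` Pi\<^sub>E I A \<inter> space (piM I)"
    then have x: "\<And>i. i \<in> I \<Longrightarrow> x (\<sigma> i) \<in> A i" "x \<in> extensional I" by (auto simp: space_PiM PiE_def)
    have "x i \<in> A (inv \<sigma> i)" if "i \<in> I" for i
      using x(1)[of "inv \<sigma> i"] that permutes_in_image[OF permutes_inv[OF assms(2)], of i]
      by (simp add: permutes_inverses[OF assms(2)])
    then show "x \<in> Pi\<^sub>E I (\<lambda>i. A (inv \<sigma> i))" using x(2) by (auto simp: PiE_def)
  next
    fix x assume "x \<in> Pi\<^sub>E I (\<lambda>i. A (inv \<sigma> i))"
    then have x: "\<And>i. i \<in> I \<Longrightarrow> x i \<in> A (inv \<sigma> i)" "x \<in> extensional I" by (auto simp: PiE_def)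
    have "x (\<sigma> i) \<in> A i" if "i \<in> I" for i
      using x(1)[OF inI[OF that]] by (simp add: permutes_inverses[OF assms(2)])
    moreover have "x \<circ> \<sigma> \<in> extensional I"
      using x(2) assms(2) by (auto simp: extensional_def permutes_not_in)
    ultimately show "x \<in> (\<lambda>x. x \<circ> \<sigma>) -` Pi\<^sub>E I A \<inter> space (piM I)" using x(2) by (auto simp: space_PiM PiE_def)
  qed
  also have "emeasure (piM I) (Pi\<^sub>E I (\<lambda>i. A (inv \<sigma> i))) = (\<Prod>i\<in>I. emeasure \<nu> (A (inv \<sigma> i)))"
    using A permutes_in_image[OF permutes_inv[OF assms(2)]] by (intro prodnu.emeasure_PiM assms(1)) auto
  also have "\<dots> = (\<Prod>i\<in>I. emeasure \<nu> (A i))"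
    by (subst (2) prod.permute[OF permutes_inv[OF assms(2)]]) (simp add: comp_def)
  finally show "emeasure (distr (piM I) (piM I) (\<lambda>x. x \<circ> \<sigma>)) (Pi\<^sub>E I A) = (\<Prod>i\<in>I. emeasure \<nu> (A i))" .
qed simp

end

section \<open>The Gibbs measure and its one-point marginal\<close>

locale gibbs = ma_equation P \<beta> r
  for P :: "(real^'n) set" and \<beta> :: real and r :: "real^'n \<Rightarrow> real" +
  fixes k N :: nat and p :: "nat \<Rightarrow> real^'n"
  assumes k_pos: "0 < k" and N_pos: "0 < N"
    and p_in: "\<And>i. i \<in> {1..N} \<Longrightarrow> (1 / real k) *\<^sub>R p i \<in> P"
begin

definition s :: real where "s = \<beta> / real k"

definition Z :: real where "Z = (\<integral>x. Per N p x powr s \<partial>(piM {1..N}))"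

text \<open>The unnormalised density of the one-point marginal with respect to \<open>\<nu>\<close>.
  Thus \<open>exp (\<beta> * phi x) = Fm x / Z\<close> is a probability density, of the same form as
  the density of a solution.\<close>

definition Fm :: "real^'n \<Rightarrow> real" where
  "Fm x = (\<integral>y. Per N p (y(1 := x)) powr s \<partial>(piM {2..N}))"

definition phi :: "real^'n \<Rightarrow> real" where "phi x = ln (Fm x / Z) / \<beta>"

lemma s_pos: "0 < s" using beta_pos k_pos by (simp add: s_def)

lemma s_k: "s * real k = \<beta>" using k_pos by (simp add: s_def)

lemma powr_Per_le_Young:
  assumes "\<And>i z. i \<in> {1..N} \<Longrightarrow> z \<bullet> ((1 / real k) *\<^sub>R p i) \<le> \<psi> z + l i"
  shows "Per N p x powr s \<le> fact N powr s * exp (\<beta> * (\<Sum>i=1..N. l i)) * (\<Prod>i=1..N. exp (\<beta> * \<psi> (x i)))"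
proof -
  have "Per N p x powr s \<le> (fact N * exp (real k * ((\<Sum>i=1..N. \<psi> (x i)) + (\<Sum>i=1..N. l i)))) powr s"
    using Per_le_Young[OF k_pos assms, where x = x] Per_pos[of N p x] s_pos by (intro powr_mono2) auto
  also have "\<dots> = fact N powr s * exp (s * (real k * ((\<Sum>i=1..N. \<psi> (x i)) + (\<Sum>i=1..N. l i))))"
    by (subst powr_mult) (auto simp: powr_def)
  also have "s * (real k * ((\<Sum>i=1..N. \<psi> (x i)) + (\<Sum>i=1..N. l i)))
      = \<beta> * (\<Sum>i=1..N. l i) + (\<Sum>i=1..N. \<beta> * \<psi> (x i))"
    unfolding mult.assoc[symmetric] s_k by (simp add: sum_distrib_left[symmetric] distrib_left)
  finally show ?thesis by (simp add: exp_add exp_sum mult.assoc)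
qed

text \<open>The support function is dual to the zero function on \<open>P\<close>. This crude pair
  in the Young bound already yields all the integrability needed.\<close>

lemma support_Young: "i \<in> {1..N} \<Longrightarrow> z \<bullet> ((1 / real k) *\<^sub>R p i) \<le> support_fun P z + 0"
  using inner_le_support_fun[OF compact_P p_in] by simp

lemmas powr_Per_le = powr_Per_le_Young[where \<psi> = "support_fun P" and l = "\<lambda>_. 0", OF support_Young]

lemma split_index: "{1..N} = insert 1 {2..N}" using N_pos by auto

lemma integrable_Per: "integrable (piM {1..N}) (\<lambda>x. Per N p x powr s)"
proof (rule Bochner_Integration.integrable_bound)
  show "integrable (piM {1..N}) (\<lambda>x. fact N powr s * (\<Prod>i=1..N. exp (\<beta> * support_fun P (x i))))"
    by (intro integrable_mult_right prodnu.product_integrable_prod integrable_support) auto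
  show "AE x in piM {1..N}. norm (Per N p x powr s) \<le> norm (fact N powr s * (\<Prod>i=1..N. exp (\<beta> * support_fun P (x i))))"
    using powr_Per_le by (intro AE_I2) (auto simp: abs_mult abs_prod)
qed measurable

lemma integrable_Per_upd: "integrable (piM {2..N}) (\<lambda>y. Per N p (y(1 := x)) powr s)"
proof (rule Bochner_Integration.integrable_bound)
  show "integrable (piM {2..N}) (\<lambda>y. (fact N powr s * exp (\<beta> * support_fun P x)) * (\<Prod>i=2..N. exp (\<beta> * support_fun P (y i))))"
    by (intro integrable_mult_right prodnu.product_integrable_prod integrable_support) auto
  have "Per N p (y(1 := x)) powr s
      \<le> (fact N powr s * exp (\<beta> * support_fun P x)) * (\<Prod>i=2..N. exp (\<beta> * support_fun P (y i)))" for y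
  proof -
    have "(\<Prod>i=1..N. exp (\<beta> * support_fun P ((y(1 := x)) i)))
        = exp (\<beta> * support_fun P x) * (\<Prod>i=2..N. exp (\<beta> * support_fun P (y i)))"
      unfolding split_index by (subst prod.insert) (auto intro!: prod.cong)
    then show ?thesis using powr_Per_le[of "y(1 := x)"] by (simp add: mult.assoc)
  qed
  then show "AE y in piM {2..N}. norm (Per N p (y(1 := x)) powr s)
      \<le> norm ((fact N powr s * exp (\<beta> * support_fun P x)) * (\<Prod>i=2..N. exp (\<beta> * support_fun P (y i))))"
    by (intro AE_I2) (auto simp: abs_mult abs_prod)
qed measurable

lemma Z_pos: "0 < Z"
  unfolding Z_def using Per_pos by (intro integral_piM_pos integrable_Per) (auto simp: less_le)

lemma Fm_pos: "0 < Fm x"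
  unfolding Fm_def using Per_pos by (intro integral_piM_pos integrable_Per_upd) (auto simp: less_le)

lemma exp_phi: "exp (\<beta> * phi x) = Fm x / Z"
  using Fm_pos[of x] Z_pos beta_pos by (simp add: phi_def)

text \<open>The crucial Lipschitz property \<open>\<nabla> phi \<in> P\<close> holds already at the level of each term of the permanent.\<close>
lemma Per_upd_le:
  "Per N p (y(1 := x)) \<le> exp (real k * support_fun P (x - x')) * Per N p (y(1 := x'))"
  unfolding Per_def sum_distrib_left
proof (rule sum_mono)
  fix \<sigma> assume "\<sigma> \<in> {\<sigma>. \<sigma> permutes {1..N}}"
  then have "\<sigma> 1 \<in> {1..N}" using permutes_in_image[of \<sigma> "{1..N}" 1] N_pos by auto
  from support_Young[OF this, of "x - x'"]
  have "real k * ((x - x') \<bullet> ((1 / real k) *\<^sub>R p (\<sigma> 1))) \<le> real k * support_fun P (x - x')" by (intro mult_left_mono) auto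
  then have 1: "x \<bullet> p (\<sigma> 1) \<le> real k * support_fun P (x - x') + x' \<bullet> p (\<sigma> 1)" using k_pos by (simp add: inner_diff_left)
  have eq: "(\<Prod>i=1..N. exp ((y(1 := u)) i \<bullet> p (\<sigma> i))) = exp (u \<bullet> p (\<sigma> 1)) * (\<Prod>i=2..N. exp (y i \<bullet> p (\<sigma> i)))" for u
    unfolding split_index by (subst prod.insert) (auto intro!: prod.cong)
  have "exp (x \<bullet> p (\<sigma> 1)) \<le> exp (real k * support_fun P (x - x')) * exp (x' \<bullet> p (\<sigma> 1))"
    using 1 by (simp add: exp_add[symmetric])
  then show "(\<Prod>i=1..N. exp ((y(1 := x)) i \<bullet> p (\<sigma> i)))
      \<le> exp (real k * support_fun P (x - x')) * (\<Prod>i=1..N. exp ((y(1 := x')) i \<bullet> p (\<sigma> i)))"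
    unfolding eq mult.assoc[symmetric] by (intro mult_right_mono prod_nonneg) auto
qed

lemma powr_Per_upd_le:
  "Per N p (y(1 := x)) powr s \<le> exp (\<beta> * support_fun P (x - x')) * Per N p (y(1 := x')) powr s"
proof -
  have "Per N p (y(1 := x)) powr s \<le> (exp (real k * support_fun P (x - x')) * Per N p (y(1 := x'))) powr s"
    using Per_upd_le[of y x x'] Per_pos[of N p "y(1 := x)"] s_pos by (intro powr_mono2) auto
  also have "\<dots> = exp (s * (real k * support_fun P (x - x'))) * Per N p (y(1 := x')) powr s"
    using Per_pos[of N p "y(1 := x')"] by (subst powr_mult) (auto simp: powr_def)
  finally show ?thesis unfolding mult.assoc[symmetric] s_k .
qed

lemma PLip_phi: "PLip P phi"
  unfolding PLip_def
proof (intro allI)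
  fix x x'
  have "Fm x \<le> (\<integral>y. exp (\<beta> * support_fun P (x - x')) * Per N p (y(1 := x')) powr s \<partial>(piM {2..N}))"
    unfolding Fm_def by (intro integral_mono integrable_Per_upd integrable_mult_right powr_Per_upd_le)
  then have "Fm x \<le> exp (\<beta> * support_fun P (x - x')) * Fm x'" by (simp add: Fm_def)
  then have "Fm x / Z \<le> exp (\<beta> * support_fun P (x - x')) * (Fm x' / Z)"
    using Z_pos by (simp add: divide_right_mono)
  then have "exp (\<beta> * phi x) \<le> exp (\<beta> * (support_fun P (x - x') + phi x'))"
    unfolding exp_phi[symmetric] by (simp add: exp_add[symmetric] distrib_left)
  then show "phi x - phi x' \<le> support_fun P (x - x')" using beta_pos by simp
qed

lemma measurable_marginal:
  assumes "i \<in> {1..N}" "h \<in> borel_measurable borel"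
  shows "(\<lambda>x. h (x i) * ennreal (Per N p x powr s)) \<in> borel_measurable (piM {1..N})"
proof (rule borel_measurable_times_ennreal)
  show "(\<lambda>x. h (x i)) \<in> borel_measurable (piM {1..N})"
    by (rule measurable_compose[OF measurable_component_singleton[OF assms(1)]]) (use assms(2) in simp)
qed measurable

lemma nn_marginal_1:
  assumes [measurable]: "h \<in> borel_measurable borel"
  shows "(\<integral>\<^sup>+x. h (x 1) * ennreal (Per N p x powr s) \<partial>(piM {1..N})) = (\<integral>\<^sup>+z. h z * ennreal (Fm z) \<partial>\<nu>)"
proof -
  have "(\<lambda>x. h (x 1) * ennreal (Per N p x powr s)) \<in> borel_measurable (piM {1..N})"
    using N_pos by (intro measurable_marginal assms) auto
  then have "(\<integral>\<^sup>+x. h (x 1) * ennreal (Per N p x powr s) \<partial>(piM {1..N}))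
      = (\<integral>\<^sup>+z. (\<integral>\<^sup>+y. h z * ennreal (Per N p (y(1 := z)) powr s) \<partial>(piM {2..N})) \<partial>\<nu>)"
    unfolding split_index by (subst prodnu.product_nn_integral_insert_rev) auto
  also have "\<dots> = (\<integral>\<^sup>+z. h z * ennreal (Fm z) \<partial>\<nu>)"
  proof (intro nn_integral_cong)
    fix z
    have "(\<integral>\<^sup>+y. h z * ennreal (Per N p (y(1 := z)) powr s) \<partial>(piM {2..N}))
        = h z * (\<integral>\<^sup>+y. ennreal (Per N p (y(1 := z)) powr s) \<partial>(piM {2..N}))"
      by (rule nn_integral_cmult) measurable
    also have "(\<integral>\<^sup>+y. ennreal (Per N p (y(1 := z)) powr s) \<partial>(piM {2..N})) = ennreal (Fm z)"
      unfolding Fm_def by (intro nn_integral_eq_integral integrable_Per_upd) auto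
    finally show "(\<integral>\<^sup>+y. h z * ennreal (Per N p (y(1 := z)) powr s) \<partial>(piM {2..N})) = h z * ennreal (Fm z)" .
  qed
  finally show ?thesis .
qed

text \<open>Transposing the coordinates 1 and \<open>i\<close> preserves the product measure and the
  permanent, so all one-point marginals agree with the first, where Fubini applies.\<close>

lemma nn_marginal:
  assumes i: "i \<in> {1..N}" and [measurable]: "h \<in> borel_measurable borel"
  shows "(\<integral>\<^sup>+x. h (x i) * ennreal (Per N p x powr s) \<partial>(piM {1..N})) = (\<integral>\<^sup>+z. h z * ennreal (Fm z) \<partial>\<nu>)"
proof -
  define \<tau> where "\<tau> = Transposition.transpose 1 i"
  have \<tau>: "\<tau> permutes {1..N}" unfolding \<tau>_def using i N_pos by (intro permutes_swap_id) auto
  have [measurable]: "(\<lambda>x. h (x i) * ennreal (Per N p x powr s)) \<in> borel_measurable (piM {1..N})"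
    by (rule measurable_marginal[OF i assms(2)])
  have meas: "(\<lambda>x. x \<circ> \<tau>) \<in> piM {1..N} \<rightarrow>\<^sub>M piM {1..N}"
  proof -
    have ext: "x \<circ> \<tau> = restrict (\<lambda>i. x (\<tau> i)) {1..N}" if "x \<in> space (piM {1..N})" for x
      using that \<tau> by (auto simp: space_PiM PiE_def extensional_def fun_eq_iff permutes_not_in)
    have "(\<lambda>x. restrict (\<lambda>i. x (\<tau> i)) {1..N}) \<in> piM {1..N} \<rightarrow>\<^sub>M piM {1..N}"
      using permutes_in_image[OF \<tau>] by (intro measurable_restrict measurable_component_singleton) auto
    then show ?thesis by (subst measurable_cong[OF ext])
  qed
  have "(\<integral>\<^sup>+x. h (x i) * ennreal (Per N p x powr s) \<partial>(piM {1..N}))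
      = (\<integral>\<^sup>+x. h (x i) * ennreal (Per N p x powr s) \<partial>(distr (piM {1..N}) (piM {1..N}) (\<lambda>x. x \<circ> \<tau>)))"
    by (simp only: distr_piM_permute[OF finite_atLeastAtMost \<tau>])
  also have "\<dots> = (\<integral>\<^sup>+x. h ((x \<circ> \<tau>) i) * ennreal (Per N p (x \<circ> \<tau>) powr s) \<partial>(piM {1..N}))"
    by (rule nn_integral_distr[OF meas]) measurable
  also have "\<dots> = (\<integral>\<^sup>+x. h (x 1) * ennreal (Per N p x powr s) \<partial>(piM {1..N}))"
    unfolding Per_compose[OF \<tau>] by (simp add: \<tau>_def)
  finally show ?thesis using nn_marginal_1[OF assms(2)] by simp
qed

end

section \<open>Entropy, Hellinger distance and a lower bound for the partition function\<close>

context gibbs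
begin

declare One_nat_def [simp del]

lemma Fm_borel [measurable]: "Fm \<in> borel_measurable borel"
proof -
  have "Fm = (\<lambda>x. Z * exp (\<beta> * phi x))" using Z_pos by (simp add: exp_phi fun_eq_iff)
  then show ?thesis using borel[OF PLip_phi] by simp
qed

lemma measurable_coordinate: "i \<in> {1..N} \<Longrightarrow> (\<lambda>x. x i) \<in> piM {1..N} \<rightarrow>\<^sub>M borel"
  unfolding measurable_cong_sets[OF refl sets_nu, symmetric] by (rule measurable_component_singleton)

lemma distr_marginal:
  assumes i: "i \<in> {1..N}"
  shows "distr (density (piM {1..N}) (\<lambda>x. ennreal (Per N p x powr s))) borel (\<lambda>x. x i) = density \<nu> (\<lambda>z. ennreal (Fm z))"
proof (rule measure_eqI)
  note m = measurable_coordinate[OF i]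
  fix A assume "A \<in> sets (distr (density (piM {1..N}) (\<lambda>x. ennreal (Per N p x powr s))) borel (\<lambda>x. x i))"
  then have [measurable]: "A \<in> sets borel" by simp
  have "emeasure (distr (density (piM {1..N}) (\<lambda>x. ennreal (Per N p x powr s))) borel (\<lambda>x. x i)) A
      = (\<integral>\<^sup>+x. ennreal (Per N p x powr s) * indicator ((\<lambda>x. x i) -` A \<inter> space (piM {1..N})) x \<partial>(piM {1..N}))"
    using m by (subst emeasure_distr) (auto intro!: emeasure_density measurable_sets simp: space_density)
  also have "\<dots> = (\<integral>\<^sup>+x. indicator A (x i) * ennreal (Per N p x powr s) \<partial>(piM {1..N}))"
    by (intro nn_integral_cong) (auto split: split_indicator)
  also have "\<dots> = (\<integral>\<^sup>+z. indicator A z * ennreal (Fm z) \<partial>\<nu>)" by (rule nn_marginal[OF i]) measurable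
  also have "\<dots> = emeasure (density \<nu> (\<lambda>z. ennreal (Fm z))) A"
    by (subst emeasure_density) (auto simp: mult.commute)
  finally show "emeasure (distr (density (piM {1..N}) (\<lambda>x. ennreal (Per N p x powr s))) borel (\<lambda>x. x i)) A
    = emeasure (density \<nu> (\<lambda>z. ennreal (Fm z))) A" .
qed simp

lemma marginal_integral:
  fixes h :: "real^'n \<Rightarrow> real"
  assumes i: "i \<in> {1..N}" and [measurable]: "h \<in> borel_measurable borel"
    and int: "integrable \<nu> (\<lambda>z. Fm z * h z)"
  shows "integrable (piM {1..N}) (\<lambda>x. Per N p x powr s * h (x i))"
    and "(\<integral>x. Per N p x powr s * h (x i) \<partial>(piM {1..N})) = (\<integral>z. Fm z * h z \<partial>\<nu>)"
proof -
  let ?D = "density (piM {1..N}) (\<lambda>x. ennreal (Per N p x powr s))"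
  note m = measurable_coordinate[OF i]
  have hm: "(\<lambda>x. h (x i)) \<in> borel_measurable (piM {1..N})" by (rule measurable_compose[OF m]) measurable
  have F0: "0 \<le> Fm z" for z using Fm_pos[of z] by simp
  have "integrable (density \<nu> (\<lambda>z. ennreal (Fm z))) h"
    using int F0 by (subst integrable_real_density) auto
  then have "integrable (distr ?D borel (\<lambda>x. x i)) h" by (simp only: distr_marginal[OF i])
  then have "integrable ?D (\<lambda>x. h (x i))" using m by (subst (asm) integrable_distr_eq) auto
  then show "integrable (piM {1..N}) (\<lambda>x. Per N p x powr s * h (x i))"
    using hm by (subst (asm) integrable_real_density) auto
  have "(\<integral>x. Per N p x powr s * h (x i) \<partial>(piM {1..N})) = (\<integral>x. h (x i) \<partial>?D)"
    using hm by (subst integral_real_density) auto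
  also have "\<dots> = (\<integral>z. h z \<partial>(distr ?D borel (\<lambda>x. x i)))"
    using m by (subst integral_distr) auto
  also have "\<dots> = (\<integral>z. Fm z * h z \<partial>\<nu>)"
    unfolding distr_marginal[OF i] using F0 by (subst integral_real_density) auto
  finally show "(\<integral>x. Per N p x powr s * h (x i) \<partial>(piM {1..N})) = (\<integral>z. Fm z * h z \<partial>\<nu>)" .
qed

lemma M_phi: "M phi = 1"
proof -
  have "(\<lambda>x. exp (\<beta> * phi x)) = (\<lambda>x. Fm x / Z)" by (simp add: exp_phi)
  then have "integrable \<nu> (\<lambda>x. Z * (Fm x / Z))"
    using integrable_exp[OF PLip_phi] by (metis integrable_mult_right)
  then have int: "integrable \<nu> Fm" using Z_pos by simp
  have "1 \<in> {1..N}" using N_pos by simp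
  from marginal_integral(2)[OF this, of "\<lambda>_. 1"] int have "Z = (\<integral>z. Fm z \<partial>\<nu>)" by (simp add: Z_def)
  then show ?thesis using Z_pos by (simp add: M_def exp_phi)
qed

text \<open>Subadditivity of the entropy: the Gibbs density \<open>f\<close> is compared with the product \<open>g\<close> of its
  marginals through \<open>f (1 + ln (g / f)) \<le> g\<close>.\<close>
lemma entropy_bound:
  assumes PL: "PLip P \<psi>" and lower: "\<And>z. support_fun P z - C \<le> \<psi> z"
    and Y: "\<And>i z. i \<in> {1..N} \<Longrightarrow> z \<bullet> ((1 / real k) *\<^sub>R p i) \<le> \<psi> z + l i"
  shows "integrable \<nu> (\<lambda>z. (phi z - \<psi> z) * exp (\<beta> * phi z))"
    and "\<beta> * real N * (\<integral>z. (phi z - \<psi> z) * exp (\<beta> * phi z) \<partial>\<nu>)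
      \<le> s * ln (fact N) + \<beta> * (\<Sum>i=1..N. l i) - ln Z"
proof -
  note [measurable] = borel[OF PL] borel[OF PLip_phi]
  define h where "h z = phi z - \<psi> z" for z
  have [measurable]: "h \<in> borel_measurable borel" unfolding h_def by measurable
  \<comment> \<open>The first summand bounds the part where \<open>h \<ge> 0\<close>, since there
    \<open>h \<le> phi 0 + C\<close>. The second bounds the part \<open>h < 0\<close>:
    \<open>- \<beta> * h \<le> exp (- \<beta> * h)\<close> turns the product with
    \<open>exp (\<beta> * phi z)\<close> into \<open>exp (\<beta> * \<psi> z)\<close>.\<close>
  define c where "c = \<bar>phi 0 + C\<bar> * exp (\<beta> * phi 0) + exp (\<beta> * \<psi> 0) / \<beta>"
  have hb: "\<bar>h z * exp (\<beta> * phi z)\<bar> \<le> c * exp (\<beta> * support_fun P z)" for z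
  proof (cases "0 \<le> h z")
    case True
    have "h z \<le> \<bar>phi 0 + C\<bar>" using le_support[OF PLip_phi, of z] lower[of z] by (simp add: h_def)
    then have "h z * exp (\<beta> * phi z) \<le> \<bar>phi 0 + C\<bar> * (exp (\<beta> * phi 0) * exp (\<beta> * support_fun P z))"
      using True exp_le_support[OF PLip_phi, of z] by (intro mult_mono) auto
    also have "\<dots> \<le> c * exp (\<beta> * support_fun P z)" unfolding c_def using beta_pos by (simp add: algebra_simps)
    finally show ?thesis using True by simp
  next
    case False
    have "\<beta> * (- h z) \<le> exp (\<beta> * (- h z))" using exp_ge_add_one_self[of "\<beta> * (- h z)"] by linarith
    then have "\<beta> * (- h z) * exp (\<beta> * phi z) \<le> exp (\<beta> * (- h z)) * exp (\<beta> * phi z)" by (intro mult_right_mono) auto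
    also have "\<dots> = exp (\<beta> * \<psi> z)" by (simp add: exp_add[symmetric] h_def algebra_simps)
    also have "\<dots> \<le> exp (\<beta> * \<psi> 0) * exp (\<beta> * support_fun P z)" by (rule exp_le_support[OF PL])
    finally have "(- h z) * exp (\<beta> * phi z) \<le> exp (\<beta> * \<psi> 0) / \<beta> * exp (\<beta> * support_fun P z)"
      using beta_pos by (simp add: field_simps)
    also have "\<dots> \<le> c * exp (\<beta> * support_fun P z)" unfolding c_def by (intro mult_right_mono) auto
    finally show ?thesis using False by (simp add: abs_mult)
  qed
  then have int: "integrable \<nu> (\<lambda>z. h z * exp (\<beta> * phi z))"
    by (intro integrable_bound_support) auto
  then show "integrable \<nu> (\<lambda>z. (phi z - \<psi> z) * exp (\<beta> * phi z))" by (simp add: h_def)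
  have Fm: "Fm z * h z = Z * (h z * exp (\<beta> * phi z))" for z using Z_pos by (simp add: exp_phi)
  define T where "T = (\<integral>z. h z * exp (\<beta> * phi z) \<partial>\<nu>)"
  \<comment> \<open>Chosen so that the Young bound for the permanent reads ln f \<le> A + \<beta>
    \<Sum> \<psi> (x_i).\<close>
  define A where "A = s * ln (fact N) + \<beta> * (\<Sum>i=1..N. l i) - ln Z"
  define f where "f x = Per N p x powr s / Z" for x
  define g where "g x = (\<Prod>i=1..N. exp (\<beta> * phi (x i)))" for x :: "nat \<Rightarrow> real^'n"
  have f_pos: "0 < f x" for x using Per_pos[of N p x] Z_pos by (simp add: f_def)
  have g_pos: "0 < g x" for x by (simp add: g_def prod_pos)
  have mi: "integrable (piM {1..N}) (\<lambda>x. f x * h (x i))" "(\<integral>x. f x * h (x i) \<partial>(piM {1..N})) = T"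
    if i: "i \<in> {1..N}" for i
  proof -
    have "integrable \<nu> (\<lambda>z. Fm z * h z)" unfolding Fm using int by simp
    from marginal_integral[OF i _ this]
    have "integrable (piM {1..N}) (\<lambda>x. Per N p x powr s * h (x i))"
      "(\<integral>x. Per N p x powr s * h (x i) \<partial>(piM {1..N})) = Z * T" unfolding Fm T_def by auto
    moreover have "(\<lambda>x. f x * h (x i)) = (\<lambda>x. (Per N p x powr s * h (x i)) / Z)" by (simp add: f_def fun_eq_iff)
    ultimately show "integrable (piM {1..N}) (\<lambda>x. f x * h (x i))" "(\<integral>x. f x * h (x i) \<partial>(piM {1..N})) = T"
      using Z_pos by auto
  qed
  have intf: "integrable (piM {1..N}) f" "(\<integral>x. f x \<partial>(piM {1..N})) = 1"
    using integrable_Per Z_pos by (auto simp: f_def[abs_def] Z_def)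
  have intg: "integrable (piM {1..N}) g" "(\<integral>x. g x \<partial>(piM {1..N})) = 1"
    unfolding g_def[abs_def] using integrable_exp[OF PLip_phi] M_phi
      prodnu.product_integral_prod[of "{1..N}" "\<lambda>_ z. exp (\<beta> * phi z)"]
    by (auto intro!: prodnu.product_integrable_prod simp: M_def)
  have pt: "f x + (\<Sum>i=1..N. \<beta> * (f x * h (x i))) - A * f x \<le> g x" for x
  proof -
    have "ln (f x) = s * ln (Per N p x) - ln Z"
      using Per_pos[of N p x] Z_pos by (simp add: f_def ln_div ln_powr)
    also have "ln (Per N p x) \<le> ln (fact N) + real k * ((\<Sum>i=1..N. \<psi> (x i)) + (\<Sum>i=1..N. l i))"
      using Per_le_Young[OF k_pos Y, where x = x] Per_pos[of N p x]
      by (subst ln_exp[of "real k * _", symmetric], subst ln_mult_pos[symmetric]) auto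
    then have "s * ln (Per N p x) - ln Z \<le> s * (ln (fact N) + real k * ((\<Sum>i=1..N. \<psi> (x i)) + (\<Sum>i=1..N. l i))) - ln Z"
      using s_pos by simp
    also have "\<dots> = s * ln (fact N) + (s * real k) * ((\<Sum>i=1..N. \<psi> (x i)) + (\<Sum>i=1..N. l i)) - ln Z"
      by (simp add: algebra_simps)
    also have "\<dots> = A + \<beta> * (\<Sum>i=1..N. \<psi> (x i))" unfolding s_k A_def by (simp add: algebra_simps)
    finally have lnf: "ln (f x) \<le> A + \<beta> * (\<Sum>i=1..N. \<psi> (x i))" .
    have lng: "ln (g x) = \<beta> * (\<Sum>i=1..N. phi (x i))"
      by (simp add: g_def exp_sum[symmetric] sum_distrib_left)
    have "1 + (\<beta> * (\<Sum>i=1..N. h (x i)) - A) \<le> 1 + ln (g x / f x)"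
      using lnf lng f_pos[of x] g_pos[of x] by (simp add: ln_div h_def sum_subtractf right_diff_distrib)
    also have "\<dots> \<le> g x / f x" using ln_le_minus_one[of "g x / f x"] f_pos[of x] g_pos[of x] by simp
    finally have "f x * (1 + (\<beta> * (\<Sum>i=1..N. h (x i)) - A)) \<le> f x * (g x / f x)"
      using f_pos[of x] by (intro mult_left_mono) auto
    then show ?thesis using f_pos[of x]
      by (simp add: distrib_left right_diff_distrib sum_distrib_left mult.commute mult.left_commute)
  qed
  have ints: "integrable (piM {1..N}) (\<lambda>x. \<Sum>i=1..N. \<beta> * (f x * h (x i)))" using mi by auto
  \<comment> \<open>Both \<open>f\<close> and \<open>g\<close> have integral 1, and the sum
    contributes \<open>N\<close> times the same marginal integral \<open>T\<close>; what remains is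
    \<open>\<beta> * real N * T \<le> A\<close>.\<close>
  have "(\<integral>x. f x + (\<Sum>i=1..N. \<beta> * (f x * h (x i))) - A * f x \<partial>(piM {1..N})) \<le> (\<integral>x. g x \<partial>(piM {1..N}))"
    using intf intg ints pt by (intro integral_mono) auto
  also have "(\<integral>x. f x + (\<Sum>i=1..N. \<beta> * (f x * h (x i))) - A * f x \<partial>(piM {1..N}))
      = 1 + (\<integral>x. (\<Sum>i=1..N. \<beta> * (f x * h (x i))) \<partial>(piM {1..N})) - A"
    using intf ints by simp
  also have "(\<integral>x. (\<Sum>i=1..N. \<beta> * (f x * h (x i))) \<partial>(piM {1..N})) = \<beta> * real N * T"
    using mi by (subst Bochner_Integration.integral_sum) auto
  finally show "\<beta> * real N * (\<integral>z. (phi z - \<psi> z) * exp (\<beta> * phi z) \<partial>\<nu>)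
      \<le> s * ln (fact N) + \<beta> * (\<Sum>i=1..N. l i) - ln Z"
    using intg by (simp add: T_def A_def h_def)
qed

text \<open>The pointwise inequality
  \<open>(exp a - 1)\<^sup>2 \<le> (exp a)\<^sup>2 - 1 - 2 * a\<close>, a form of
  \<open>exp a \<ge> 1 + a\<close>, bounds the squared Hellinger distance by the relative entropy.
  The term \<open>M \<psi> - 1\<close> appears because \<open>\<psi>\<close> need not be normalised
  here.\<close>

lemma hellinger_bound:
  assumes PL: "PLip P \<psi>" and lower: "\<And>z. support_fun P z - C \<le> \<psi> z"
    and Y: "\<And>i z. i \<in> {1..N} \<Longrightarrow> z \<bullet> ((1 / real k) *\<^sub>R p i) \<le> \<psi> z + l i"
  shows "(\<integral>\<^sup>+x. ennreal ((exp (\<beta> * \<psi> x / 2) - exp (\<beta> * phi x / 2))\<^sup>2) \<partial>\<nu>)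
    \<le> ennreal (M \<psi> - 1 + (s * ln (fact N) + \<beta> * (\<Sum>i=1..N. l i) - ln Z) / real N)"
proof -
  note [measurable] = borel[OF PL] borel[OF PLip_phi]
  note ent = entropy_bound[OF assms]
  define T where "T = (\<integral>z. (phi z - \<psi> z) * exp (\<beta> * phi z) \<partial>\<nu>)"
  have pt: "(exp (\<beta> * \<psi> x / 2) - exp (\<beta> * phi x / 2))\<^sup>2
      \<le> exp (\<beta> * \<psi> x) - exp (\<beta> * phi x) + \<beta> * ((phi x - \<psi> x) * exp (\<beta> * phi x))" for x
  proof -
    define a where "a = \<beta> * (\<psi> x - phi x) / 2"
    have e: "exp (\<beta> * \<psi> x / 2) = exp (\<beta> * phi x / 2) * exp a" "exp (\<beta> * phi x) = (exp (\<beta> * phi x / 2))\<^sup>2"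
      by (simp_all add: a_def exp_add[symmetric] exp_double[symmetric] right_diff_distrib diff_divide_distrib)
    have e2: "exp (\<beta> * \<psi> x) = (exp (\<beta> * phi x / 2))\<^sup>2 * (exp a)\<^sup>2"
      unfolding power_mult_distrib[symmetric] e(1)[symmetric] by (simp add: exp_double[symmetric])
    have "(exp a - 1)\<^sup>2 = (exp a)\<^sup>2 - 2 * exp a + 1" by (simp add: power2_diff)
    then have "(exp a - 1)\<^sup>2 \<le> (exp a)\<^sup>2 - 1 - 2 * a"
      using exp_ge_add_one_self[of a] by linarith
    then have "(exp (\<beta> * phi x / 2))\<^sup>2 * (exp a - 1)\<^sup>2 \<le> (exp (\<beta> * phi x / 2))\<^sup>2 * ((exp a)\<^sup>2 - 1 - 2 * a)"
      by (intro mult_left_mono) auto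
    also have "\<dots> = exp (\<beta> * \<psi> x) - exp (\<beta> * phi x) + \<beta> * ((phi x - \<psi> x) * exp (\<beta> * phi x))"
    proof -
      have "2 * a = \<beta> * (\<psi> x - phi x)" by (simp add: a_def)
      then show ?thesis unfolding e2 e(2) by (simp only:) (simp add: algebra_simps)
    qed
    also have "(exp (\<beta> * phi x / 2))\<^sup>2 * (exp a - 1)\<^sup>2 = (exp (\<beta> * \<psi> x / 2) - exp (\<beta> * phi x / 2))\<^sup>2"
      unfolding e(1) power_mult_distrib[symmetric] by (simp add: algebra_simps)
    finally show ?thesis .
  qed
  have int: "integrable \<nu> (\<lambda>x. exp (\<beta> * \<psi> x) - exp (\<beta> * phi x) + \<beta> * ((phi x - \<psi> x) * exp (\<beta> * phi x)))"
    using ent(1) integrable_exp[OF PL] integrable_exp[OF PLip_phi] by auto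
  have "(\<integral>\<^sup>+x. ennreal ((exp (\<beta> * \<psi> x / 2) - exp (\<beta> * phi x / 2))\<^sup>2) \<partial>\<nu>)
      \<le> (\<integral>\<^sup>+x. ennreal (exp (\<beta> * \<psi> x) - exp (\<beta> * phi x) + \<beta> * ((phi x - \<psi> x) * exp (\<beta> * phi x))) \<partial>\<nu>)"
    by (intro nn_integral_mono ennreal_leI pt)
  also have "\<dots> = ennreal (\<integral>x. exp (\<beta> * \<psi> x) - exp (\<beta> * phi x) + \<beta> * ((phi x - \<psi> x) * exp (\<beta> * phi x)) \<partial>\<nu>)"
    using order_trans[OF zero_le_power2 pt] by (intro nn_integral_eq_integral int AE_I2) auto
  also have "(\<integral>x. exp (\<beta> * \<psi> x) - exp (\<beta> * phi x) + \<beta> * ((phi x - \<psi> x) * exp (\<beta> * phi x)) \<partial>\<nu>)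
      = M \<psi> - 1 + \<beta> * T"
    using ent(1) integrable_exp[OF PL] integrable_exp[OF PLip_phi] M_phi by (simp add: M_def T_def)
  also have "\<dots> \<le> M \<psi> - 1 + (s * ln (fact N) + \<beta> * (\<Sum>i=1..N. l i) - ln Z) / real N"
    using ent(2) N_pos by (simp add: T_def field_simps)
  finally show ?thesis by (simp add: ennreal_leI)
qed

text \<open>Only the permutations of \<open>I\<close> are averaged over; the multinomial factor is the number of ways of
  distributing the points \<open>x i\<close>, \<open>i \<in> I\<close>, among the sets \<open>V c\<close> with the right multiplicities.\<close>
lemma Z_lower:
  fixes lab :: "nat \<Rightarrow> 'c" and V :: "'c \<Rightarrow> (real^'n) set"
  assumes I: "I \<subseteq> {1..N}" and disj: "disjoint_family_on V (lab ` I)"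
    and W: "\<And>j. j \<in> {1..N} \<Longrightarrow> W j \<in> sets borel" "\<And>j. j \<in> I \<Longrightarrow> W j = V (lab j)"
    and w: "\<And>j. j \<in> {1..N} \<Longrightarrow> 0 \<le> w j"
      "\<And>j. j \<in> {1..N} \<Longrightarrow> ennreal (w j) \<le> (\<integral>\<^sup>+x. ennreal (exp (\<beta> * (x \<bullet> ((1 / real k) *\<^sub>R p j)))) * indicator (W j) x \<partial>\<nu>)"
  shows "fact (card I) * (\<Prod>j=1..N. w j) \<le> (\<Prod>c\<in>lab ` I. fact (card {j\<in>I. lab j = c})) * Z"
proof -
  define T :: nat where "T = (\<Prod>c\<in>lab ` I. fact (card {j\<in>I. lab j = c}))"
  have finI: "finite I" using I finite_subset by blast
  define S where "S = {\<sigma>. \<sigma> permutes I}"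
  have finS: "finite S" "card S = fact (card I)"
    unfolding S_def using finI by (auto simp: finite_permutations card_permutations)
  have SN: "\<sigma> permutes {1..N}" if "\<sigma> \<in> S" for \<sigma> using that I permutes_subset by (auto simp: S_def)
  define e where "e j x = ennreal (exp (\<beta> * (x \<bullet> ((1 / real k) *\<^sub>R p j)))) * indicator (W j) x" for j x
  have em [measurable]: "e j \<in> borel_measurable \<nu>" if "j \<in> {1..N}" for j
    unfolding e_def using W(1)[OF that] by measurable
  \<comment> \<open>At a given \<open>x\<close> only the permutations matching every
    \<open>x i\<close>, \<open>i \<in> I\<close>, to its set give a nonzero product, and there are
    at most \<open>T\<close> of them. Each such product is at most the power \<open>s\<close> of a
    single term of the permanent, because \<open>exp (\<beta> * (z \<bullet> p j / k)) = exp (z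
    \<bullet> p j) powr s\<close>.\<close>
  have pt: "(\<Sum>\<sigma>\<in>S. \<Prod>i=1..N. e (\<sigma> i) (x i)) \<le> of_nat T * ennreal (Per N p x powr s)" for x
  proof -
    define G where "G = {\<sigma>. \<sigma> permutes I \<and> (\<forall>i\<in>I. x i \<in> V (lab (\<sigma> i)))}"
    have GS: "G \<subseteq> S" by (auto simp: G_def S_def)
    have term_le: "(\<Prod>i=1..N. e (\<sigma> i) (x i)) \<le> (if \<sigma> \<in> G then ennreal (Per N p x powr s) else 0)" if \<sigma>: "\<sigma> \<in> S" for \<sigma>
    proof (cases "\<sigma> \<in> G")
      case True
      have "(\<Prod>i=1..N. e (\<sigma> i) (x i)) \<le> (\<Prod>i=1..N. ennreal (exp (\<beta> * (x i \<bullet> ((1 / real k) *\<^sub>R p (\<sigma> i))))))"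
        by (intro prod_mono_ennreal) (auto simp: e_def split: split_indicator)
      also have "\<dots> = ennreal ((\<Prod>i=1..N. exp (x i \<bullet> p (\<sigma> i))) powr s)"
      proof -
        have "(\<Prod>i=1..N. exp (\<beta> * (x i \<bullet> ((1 / real k) *\<^sub>R p (\<sigma> i))))) = exp (s * (\<Sum>i=1..N. x i \<bullet> p (\<sigma> i)))"
          by (simp add: exp_sum[symmetric] s_def sum_distrib_left)
        also have "\<dots> = (\<Prod>i=1..N. exp (x i \<bullet> p (\<sigma> i))) powr s"
          by (simp add: exp_sum[symmetric] powr_def)
        finally show ?thesis by (simp add: prod_ennreal)
      qed
      also have "\<dots> \<le> ennreal (Per N p x powr s)"
      proof (intro ennreal_leI powr_mono2)
        show "(\<Prod>i=1..N. exp (x i \<bullet> p (\<sigma> i))) \<le> Per N p x"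
          unfolding Per_def using SN[OF \<sigma>]
          by (intro member_le_sum[of \<sigma> _ "\<lambda>\<sigma>. \<Prod>i=1..N. exp (x i \<bullet> p (\<sigma> i))"]) (auto intro: prod_nonneg simp: finite_permutations)
      qed (use s_pos in \<open>auto intro: prod_nonneg\<close>)
      finally show ?thesis using True by simp
    next
      case False
      then obtain i where i: "i \<in> I" "x i \<notin> V (lab (\<sigma> i))" using \<sigma> by (auto simp: G_def S_def)
      have "\<sigma> i \<in> I" using \<sigma> i(1) by (auto simp: S_def permutes_in_image)
      then have "e (\<sigma> i) (x i) = 0" using i(2) W(2) by (simp add: e_def)
      then have "(\<Prod>i=1..N. e (\<sigma> i) (x i)) = 0" using i(1) I by (intro prod_zero) auto
      then show ?thesis by (simp only: zero_le)
    qed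
    have "(\<Sum>\<sigma>\<in>S. \<Prod>i=1..N. e (\<sigma> i) (x i)) \<le> (\<Sum>\<sigma>\<in>S. if \<sigma> \<in> G then ennreal (Per N p x powr s) else 0)"
      by (intro sum_mono term_le)
    also have "\<dots> = of_nat (card G) * ennreal (Per N p x powr s)"
      using finS GS by (simp add: sum.If_cases Int_absorb1)
    also have "card G \<le> T" unfolding G_def T_def by (rule card_matching_permutations[OF finI disj])
    then have "of_nat (card G) * ennreal (Per N p x powr s) \<le> of_nat T * ennreal (Per N p x powr s)"
      by (intro mult_right_mono) auto
    finally show ?thesis .
  qed
  \<comment> \<open>By Fubini, \<open>\<sigma>\<close> merely permutes the factors, so every
    permutation contributes the same product of one-point integrals.\<close>
  have each: "(\<integral>\<^sup>+x. (\<Prod>i=1..N. e (\<sigma> i) (x i)) \<partial>(piM {1..N})) \<ge> ennreal (\<Prod>j=1..N. w j)" if "\<sigma> \<in> S" for \<sigma>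
  proof -
    have \<sigma>N: "\<sigma> i \<in> {1..N}" if "i \<in> {1..N}" for i using permutes_in_image[OF SN[OF \<open>\<sigma> \<in> S\<close>]] that by blast
    have "ennreal (\<Prod>j=1..N. w j) = (\<Prod>j=1..N. ennreal (w j))" using w(1) by (intro prod_ennreal[symmetric]) auto
    also have "\<dots> \<le> (\<Prod>j=1..N. \<integral>\<^sup>+x. e j x \<partial>\<nu>)"
      unfolding e_def using w(2) by (intro prod_mono_ennreal) auto
    also have "\<dots> = (\<Prod>i=1..N. \<integral>\<^sup>+x. e (\<sigma> i) x \<partial>\<nu>)"
      by (subst prod.permute[OF SN[OF that]]) (simp add: comp_def)
    also have "\<dots> = (\<integral>\<^sup>+x. (\<Prod>i=1..N. e (\<sigma> i) (x i)) \<partial>(piM {1..N}))"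
      using em \<sigma>N by (intro prodnu.product_nn_integral_prod[symmetric]) auto
    finally show ?thesis .
  qed
  have meas: "(\<lambda>x. \<Prod>i=1..N. e (\<sigma> i) (x i)) \<in> borel_measurable (piM {1..N})" if "\<sigma> \<in> S" for \<sigma>
  proof (intro borel_measurable_prod_ennreal)
    fix i assume i: "i \<in> {1..N}"
    then have "\<sigma> i \<in> {1..N}" using permutes_in_image[OF SN[OF that]] by blast
    then show "(\<lambda>x. e (\<sigma> i) (x i)) \<in> borel_measurable (piM {1..N})"
      by (intro measurable_compose[OF measurable_component_singleton[OF i]] em)
  qed
  have "ennreal (fact (card I) * (\<Prod>j=1..N. w j)) = of_nat (card S) * ennreal (\<Prod>j=1..N. w j)"
  proof -
    have "0 \<le> (\<Prod>j=1..N. w j)" using w(1) by (intro prod_nonneg) auto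
    then show ?thesis using finS by (simp add: ennreal_mult ennreal_of_nat_eq_real_of_nat)
  qed
  also have "\<dots> = (\<Sum>\<sigma>\<in>S. ennreal (\<Prod>j=1..N. w j))" by simp
  also have "\<dots> \<le> (\<Sum>\<sigma>\<in>S. \<integral>\<^sup>+x. (\<Prod>i=1..N. e (\<sigma> i) (x i)) \<partial>(piM {1..N}))" by (intro sum_mono each)
  also have "\<dots> = (\<integral>\<^sup>+x. (\<Sum>\<sigma>\<in>S. \<Prod>i=1..N. e (\<sigma> i) (x i)) \<partial>(piM {1..N}))"
    using meas by (intro nn_integral_sum[symmetric]) auto
  also have "\<dots> \<le> (\<integral>\<^sup>+x. of_nat T * ennreal (Per N p x powr s) \<partial>(piM {1..N}))" by (intro nn_integral_mono pt)
  also have "\<dots> = of_nat T * (\<integral>\<^sup>+x. ennreal (Per N p x powr s) \<partial>(piM {1..N}))" by (rule nn_integral_cmult) measurable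
  also have "(\<integral>\<^sup>+x. ennreal (Per N p x powr s) \<partial>(piM {1..N})) = ennreal Z"
    unfolding Z_def by (intro nn_integral_eq_integral integrable_Per) auto
  also have "of_nat T * ennreal Z = ennreal (real T * Z)"
    using Z_pos by (simp add: ennreal_mult ennreal_of_nat_eq_real_of_nat)
  finally have "fact (card I) * (\<Prod>j=1..N. w j) \<le> real T * Z"
    using Z_pos by (subst (asm) ennreal_le_iff) auto
  then show ?thesis by (simp add: T_def)
qed

end

section \<open>Asymptotics of the partition function\<close>

text \<open>The term of index \<open>m\<close> in the power series of \<open>exp m\<close> is at
  most the whole sum.\<close>

lemma ln_fact_lower: "real m * ln (real m) - real m \<le> ln (fact m)"
proof (cases "m = 0")
  case False
  have "(real m ^ m) / fact m \<le> exp (real m)"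
  proof -
    have "(\<Sum>n\<in>{m}. real m ^ n /\<^sub>R fact n) \<le> (\<Sum>n. real m ^ n /\<^sub>R fact n)"
      using summable_exp_generic[of "real m"] by (intro sum_le_suminf) auto
    then show ?thesis by (simp add: exp_def divide_inverse mult.commute)
  qed
  then have "ln ((real m ^ m) / fact m) \<le> ln (exp (real m))"
    using False by (intro ln_mono) auto
  then show ?thesis using False by (simp add: ln_div ln_realpow)
qed simp

lemma ln_fact_upper: "ln (fact m) \<le> real m * ln (real m) - real m + 1 + ln (real m)"
proof (induction m)
  case (Suc m)
  show ?case
  proof (cases "m = 0")
    case False
    have "ln (real m / real (Suc m)) \<le> real m / real (Suc m) - 1" using False by (intro ln_le_minus_one) auto
    also have "\<dots> = - 1 / real (Suc m)" by (simp add: field_simps)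
    finally have "real (Suc m) * (ln (real m) - ln (real (Suc m))) \<le> real (Suc m) * (- 1 / real (Suc m))"
      using False by (intro mult_left_mono) (auto simp: ln_div)
    then have "real (Suc m) * ln (real m) - real (Suc m) * ln (real (Suc m)) \<le> - 1"
      by (simp add: right_diff_distrib)
    moreover have "ln (fact (Suc m)) = ln (real (Suc m)) + ln (fact m)"
      by (simp add: ln_mult_pos del: of_nat_Suc)
    ultimately show ?thesis using Suc by (simp add: algebra_simps)
  qed simp
qed simp

lemma xlnx_split: "0 < N \<Longrightarrow> real m * ln (real m) = real m * ln (real m / real N) + real m * ln (real N)"
  by (cases "m = 0") (auto simp: ln_div algebra_simps)

context ma_equation
begin

definition ZN :: "nat \<Rightarrow> nat \<Rightarrow> (nat \<Rightarrow> real^'n) \<Rightarrow> real" where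
  "ZN k N p = (\<integral>x. Per N p x powr (\<beta> / real k) \<partial>(piM {1..N}))"

definition phiN :: "nat \<Rightarrow> nat \<Rightarrow> (nat \<Rightarrow> real^'n) \<Rightarrow> real^'n \<Rightarrow> real" where
  "phiN k N p x = ln ((\<integral>y. Per N p (y(1 := x)) powr (\<beta> / real k) \<partial>(piM {2..N})) / ZN k N p) / \<beta>"

text \<open>On the unit ball the exponent is at least \<open>- \<beta> * L\<close>. The constant
  serves for the few lattice points outside all cubes; \<open>c \<le> 1\<close> fixes the sign of
  \<open>ln c\<close>.\<close>

lemma ball_lower:
  obtains c where "0 < c" "c \<le> 1"
    "\<And>q. q \<in> P \<Longrightarrow> ennreal c \<le> (\<integral>\<^sup>+x. ennreal (exp (\<beta> * (x \<bullet> q))) * indicator (ball 0 1) x \<partial>\<nu>)"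
proof -
  have "0 < ennreal (exp (- (\<beta> * L))) * emeasure \<nu> (ball 0 1)"
    using nu_open_pos[of "ball 0 1"] by (simp add: ennreal_zero_less_mult_iff)
  then obtain c' where c': "0 < c'" "c' < min 1 (ennreal (exp (- (\<beta> * L))) * emeasure \<nu> (ball 0 1))"
    using dense[of 0 "min 1 (ennreal (exp (- (\<beta> * L))) * emeasure \<nu> (ball 0 1))"] by auto
  define c where "c = enn2real c'"
  have "c' < top" using c'(2) by (auto intro: less_trans)
  then have cc: "c' = ennreal c" by (simp add: c_def)
  have "0 < c" using c'(1) unfolding cc by simp
  moreover have "c \<le> 1" using c'(2) unfolding cc by (simp add: ennreal_less_one_iff)
  moreover have "ennreal c \<le> (\<integral>\<^sup>+x. ennreal (exp (\<beta> * (x \<bullet> q))) * indicator (ball 0 1) x \<partial>\<nu>)" if q: "q \<in> P" for q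
  proof -
    have "ennreal c \<le> ennreal (exp (- (\<beta> * L))) * emeasure \<nu> (ball 0 1)"
      using c'(2) unfolding cc by (simp add: less_imp_le)
    also have "\<dots> = (\<integral>\<^sup>+x. ennreal (exp (- (\<beta> * L))) * indicator (ball 0 1) x \<partial>\<nu>)"
      by (subst nn_integral_cmult_indicator) auto
    also have "\<dots> \<le> (\<integral>\<^sup>+x. ennreal (exp (\<beta> * (x \<bullet> q))) * indicator (ball 0 1) x \<partial>\<nu>)"
    proof (intro nn_integral_mono)
      fix x :: "real^'n"
      have "- L \<le> x \<bullet> q" if "x \<in> ball 0 1"
      proof -
        have "- (x \<bullet> q) \<le> norm x * norm q" using Cauchy_Schwarz_ineq2[of x q] by linarith
        also have "\<dots> \<le> 1 * L" using that norm_le_L[OF q] by (intro mult_mono) auto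
        finally show ?thesis by simp
      qed
      then have "- (\<beta> * L) \<le> \<beta> * (x \<bullet> q)" if "x \<in> ball 0 1"
        using that mult_left_mono[of "- L" "x \<bullet> q" \<beta>] beta_pos by simp
      then show "ennreal (exp (- (\<beta> * L))) * indicator (ball 0 1) x \<le> ennreal (exp (\<beta> * (x \<bullet> q))) * indicator (ball 0 1) x"
        by (auto split: split_indicator simp: ennreal_leI)
    qed
    finally show ?thesis .
  qed
  ultimately show thesis by (rule that)
qed

end

locale gibbs_sequence = ma_equation P \<beta> r
  for P :: "(real^'n) set" and \<beta> :: real and r :: "real^'n \<Rightarrow> real" +
  fixes N :: "nat \<Rightarrow> nat" and p :: "nat \<Rightarrow> nat \<Rightarrow> real^'n"
  assumes N_card: "\<And>k. 0 < k \<Longrightarrow> N k = card (lattice_points k P)"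
    and p_bij: "\<And>k. 0 < k \<Longrightarrow> bij_betw (p k) {1..N k} (lattice_points k P)"
begin

abbreviation q :: "nat \<Rightarrow> nat \<Rightarrow> real^'n" where "q k i \<equiv> (1 / real k) *\<^sub>R p k i"

lemma gibbs_k: "0 < k \<Longrightarrow> 0 < N k \<Longrightarrow> gibbs P \<beta> r k (N k) (p k)"
  using p_bij[of k] by unfold_locales (auto simp: bij_betw_def lattice_points_eq)

lemma sum_q: "0 < k \<Longrightarrow> (\<Sum>i=1..N k. f (q k i)) = (\<Sum>y\<in>lattice_points k P. f ((1 / real k) *\<^sub>R y))"
  using sum.reindex_bij_betw[OF p_bij, of k "\<lambda>y. f ((1 / real k) *\<^sub>R y)"] by simp

text \<open>The Riemann sum of the indicator of \<open>P\<close>, whose volume is 1; hence averages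
  over the lattice points may be normalised by \<open>N k\<close> instead of
  \<open>k ^ CARD('n)\<close>.\<close>

lemma N_asymp: "(\<lambda>k. real (N k) / real k ^ CARD('n)) \<longlonglongrightarrow> 1"
proof -
  have lim: "(\<lambda>k. (\<Sum>y\<in>lattice_points k P. indicator P ((1 / real k) *\<^sub>R y) * 1) / real k ^ CARD('n))
      \<longlonglongrightarrow> (\<integral>x. indicator P x * (1::real) \<partial>lborel)"
    by (rule riemann_convex[where B = 1]) (auto simp: compact_imp_bounded[OF compact_P] convex_P)
  have int: "(\<integral>x. indicator P x * (1::real) \<partial>lborel) = 1" by (simp add: volume_P_measure)
  have ev: "eventually (\<lambda>k. (\<Sum>y\<in>lattice_points k P. indicator P ((1 / real k) *\<^sub>R y) * 1) / real k ^ CARD('n)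
      = real (N k) / real k ^ CARD('n)) sequentially"
    using eventually_gt_at_top[of 0]
    by (rule eventually_mono) (auto simp: N_card lattice_points_eq)
  show ?thesis using Lim_transform_eventually[OF lim ev] unfolding int .
qed

lemma N_eventually: "eventually (\<lambda>k. 0 < k \<and> 0 < N k \<and> real k / 2 \<le> real (N k) \<and> real (N k) \<le> 2 * real k ^ CARD('n)) sequentially"
proof -
  have "eventually (\<lambda>k. real (N k) / real k ^ CARD('n) > 1/2) sequentially"
    "eventually (\<lambda>k. real (N k) / real k ^ CARD('n) < 2) sequentially"
    using order_tendstoD(1)[OF N_asymp, of "1/2"] order_tendstoD(2)[OF N_asymp, of 2] by simp_all
  with eventually_gt_at_top[of 0] show ?thesis
  proof eventually_elim
    case (elim k)
    then have kn: "0 < real k ^ CARD('n)" by simp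
    have "real k \<le> real k ^ CARD('n)" using elim(1) by (intro self_le_power) auto
    moreover have "real k ^ CARD('n) / 2 < real (N k)" "real (N k) < 2 * real k ^ CARD('n)"
      using elim kn by (simp_all add: field_simps)
    ultimately have "real k / 2 \<le> real (N k)" "real (N k) \<le> 2 * real k ^ CARD('n)" by linarith+
    then show ?case using elim(1) by auto
  qed
qed

lemma N_at_top: "filterlim (\<lambda>k. real (N k)) at_top sequentially"
proof (rule filterlim_at_top_mono)
  show "filterlim (\<lambda>k. (1/2) * real k) at_top sequentially"
    by (rule filterlim_tendsto_pos_mult_at_top[OF tendsto_const _ filterlim_real_sequentially]) simp
  show "eventually (\<lambda>k. (1/2) * real k \<le> real (N k)) sequentially"
    using N_eventually by (rule eventually_mono) simp
qed

lemma average_tendsto: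
  assumes "Q \<subseteq> P" "convex Q" "Q \<in> sets borel" "h \<in> borel_measurable borel"
    "continuous_on (interior Q) h" "\<And>x. x \<in> Q \<Longrightarrow> \<bar>h x\<bar> \<le> B"
  shows "(\<lambda>k. (\<Sum>i=1..N k. indicator Q (q k i) * h (q k i)) / real (N k))
    \<longlonglongrightarrow> (\<integral>x. indicator Q x * h x \<partial>lborel)"
proof -
  have lim: "(\<lambda>k. ((\<Sum>y\<in>lattice_points k P. indicator Q ((1 / real k) *\<^sub>R y) * h ((1 / real k) *\<^sub>R y)) / real k ^ CARD('n))
      / (real (N k) / real k ^ CARD('n))) \<longlonglongrightarrow> (\<integral>x. indicator Q x * h x \<partial>lborel) / 1"
    by (intro tendsto_divide N_asymp riemann_convex[where B = B] compact_imp_bounded compact_P assms) simp_all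
  have ev: "eventually (\<lambda>k. ((\<Sum>y\<in>lattice_points k P. indicator Q ((1 / real k) *\<^sub>R y) * h ((1 / real k) *\<^sub>R y)) / real k ^ CARD('n))
      / (real (N k) / real k ^ CARD('n)) = (\<Sum>i=1..N k. indicator Q (q k i) * h (q k i)) / real (N k)) sequentially"
    using N_eventually
  proof (rule eventually_mono)
    fix k assume k: "0 < k \<and> 0 < N k \<and> real k / 2 \<le> real (N k) \<and> real (N k) \<le> 2 * real k ^ CARD('n)"
    have "(\<Sum>i=1..N k. indicator Q (q k i) * h (q k i))
        = (\<Sum>y\<in>lattice_points k P. indicator Q ((1 / real k) *\<^sub>R y) * h ((1 / real k) *\<^sub>R y))"
      using k sum_q[where f = "\<lambda>x. indicator Q x * h x"] by blast
    then show "((\<Sum>y\<in>lattice_points k P. indicator Q ((1 / real k) *\<^sub>R y) * h ((1 / real k) *\<^sub>R y)) / real k ^ CARD('n))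
      / (real (N k) / real k ^ CARD('n)) = (\<Sum>i=1..N k. indicator Q (q k i) * h (q k i)) / real (N k)"
      using k by simp
  qed
  show ?thesis using Lim_transform_eventually[OF lim ev] by simp
qed

text \<open>\<open>N k \<le> 2 * k ^ CARD('n)\<close> gives ln (N!) / N at most ln 2 + n ln k, and
  the exponent \<open>\<beta> / k\<close> of the permanent outweighs the logarithm.\<close>

lemma ln_fact_negligible: "(\<lambda>k. (\<beta> / real k) * ln (fact (N k)) / real (N k)) \<longlonglongrightarrow> 0"
proof (rule tendsto_sandwich[OF _ _ tendsto_const])
  have lim: "((\<lambda>x::real. ln x / x) \<longlongrightarrow> 0) at_top" by (rule ln_x_over_x_tendsto_0)
  have "(\<lambda>k. \<beta> * (ln 2 * (1 / real k) + real CARD('n) * (ln (real k) / real k))) \<longlonglongrightarrow> \<beta> * (ln 2 * 0 + real CARD('n) * 0)"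
    by (intro tendsto_intros lim_1_over_n filterlim_compose[OF lim filterlim_real_sequentially])
  then show "(\<lambda>k. \<beta> * (ln 2 * (1 / real k) + real CARD('n) * (ln (real k) / real k))) \<longlonglongrightarrow> 0" by simp
  show "eventually (\<lambda>k. 0 \<le> (\<beta> / real k) * ln (fact (N k)) / real (N k)) sequentially"
    using beta_pos by (intro always_eventually allI divide_nonneg_nonneg mult_nonneg_nonneg) (auto simp: ln_ge_zero fact_ge_1)
  show "eventually (\<lambda>k. (\<beta> / real k) * ln (fact (N k)) / real (N k)
      \<le> \<beta> * (ln 2 * (1 / real k) + real CARD('n) * (ln (real k) / real k))) sequentially"
    using N_eventually
  proof (rule eventually_mono)
    fix k assume k: "0 < k \<and> 0 < N k \<and> real k / 2 \<le> real (N k) \<and> real (N k) \<le> 2 * real k ^ CARD('n)"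
    have "fact (N k) \<le> (real (N k) ^ N k)" using fact_le_power[of "N k"] by (metis of_nat_fact of_nat_le_iff of_nat_power fact_le_power le_refl)
    then have "ln (fact (N k)) \<le> real (N k) * ln (real (N k))"
      using k by (subst ln_realpow[symmetric]) (auto intro: ln_mono)
    also have "\<dots> \<le> real (N k) * (ln 2 + real CARD('n) * ln (real k))"
    proof -
      have "ln (real (N k)) \<le> ln (2 * real k ^ CARD('n))" using k by (intro ln_mono) auto
      also have "\<dots> = ln 2 + real CARD('n) * ln (real k)" using k by (simp add: ln_mult_pos ln_realpow)
      finally show ?thesis by (rule mult_left_mono) simp
    qed
    finally have "ln (fact (N k)) / real (N k) \<le> ln 2 + real CARD('n) * ln (real k)"
      using k by (simp add: divide_le_eq mult.commute)
    then have "(\<beta> / real k) * (ln (fact (N k)) / real (N k)) \<le> (\<beta> / real k) * (ln 2 + real CARD('n) * ln (real k))"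
      using beta_pos by (intro mult_left_mono) auto
    then show "(\<beta> / real k) * ln (fact (N k)) / real (N k)
      \<le> \<beta> * (ln 2 * (1 / real k) + real CARD('n) * (ln (real k) / real k))"
      by (simp add: field_simps add_divide_distrib)
  qed
qed

text \<open>\<open>Z_lower\<close> is used with each scaled lattice point labelled by the cube that
  contains it. After taking logarithms and dividing by \<open>N k\<close>, the cell counts tend to
  \<open>v\<close>, the averages of the transform tend to its integrals over the cubes, and Stirling
  handles the factorials.\<close>

lemma Z_asymp_lower:
  assumes sol: "is_solution \<psi>" and n: "normalized \<psi>" and J: "J \<psi> < \<infinity>" and \<epsilon>: "0 < \<epsilon>"
  shows "eventually (\<lambda>k. \<beta> * (\<integral>p. indicator P p * leg \<psi> p \<partial>lborel) - \<epsilon> \<le> ln (ZN k (N k) (p k)) / real (N k)) sequentially"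
proof -
  define Gl where "Gl = (\<integral>p. indicator P p * leg \<psi> p \<partial>lborel)"
  obtain c where c: "0 < c" "c \<le> 1"
    "\<And>q. q \<in> P \<Longrightarrow> ennreal c \<le> (\<integral>\<^sup>+x. ennreal (exp (\<beta> * (x \<bullet> q))) * indicator (ball 0 1) x \<partial>\<nu>)"
    using ball_lower by blast
  \<comment> \<open>The losses in the limit add up to at most \<open>\<eta> * K\<close>:
    \<open>\<eta>\<close> from \<open>\<theta> * ln \<theta>\<close>, twice
    \<open>\<beta> * \<eta>\<close> from the integral outside the cubes and from the Young gap, and
    \<open>- \<eta> * ln c\<close> from the points outside the cubes.\<close>
  define K where "K = 1 + 2 * \<beta> - ln c"
  have "ln c \<le> 0" using c by simp
  then have K: "0 < K" using beta_pos by (simp add: K_def)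
  define \<eta> where "\<eta> = min (1/2) (\<epsilon> / (2 * K))"
  have \<eta>: "0 < \<eta>" "\<eta> \<le> 1/2" "\<eta> * K < \<epsilon>"
  proof -
    show "0 < \<eta>" "\<eta> \<le> 1/2" using \<epsilon> K by (auto simp: \<eta>_def)
    have "\<eta> * K \<le> \<epsilon> / (2 * K) * K" using K by (intro mult_right_mono) (auto simp: \<eta>_def)
    also have "\<dots> < \<epsilon>" using K \<epsilon> by simp
    finally show "\<eta> * K < \<epsilon>" .
  qed
  obtain C :: "(real^'n) set" and Q V v B where
    finC: "finite C" and v: "0 < v" and vC: "1 - \<eta> \<le> v * real (card C)" "v * real (card C) \<le> 1"
    and cQ: "\<And>a. a \<in> C \<Longrightarrow> convex (Q a)" and bQ: "\<And>a. a \<in> C \<Longrightarrow> Q a \<in> sets borel"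
    and QP: "\<And>a. a \<in> C \<Longrightarrow> Q a \<subseteq> interior P" and mQ: "\<And>a. a \<in> C \<Longrightarrow> measure lborel (Q a) = v"
    and legB: "\<And>a p. a \<in> C \<Longrightarrow> p \<in> Q a \<Longrightarrow> \<bar>leg \<psi> p\<bar> \<le> B"
    and dQ: "disjoint_family_on Q C" and dV: "disjoint_family_on V C" and bV: "\<And>a. a \<in> C \<Longrightarrow> V a \<in> sets borel"
    and VQ: "\<And>a p. a \<in> C \<Longrightarrow> p \<in> Q a \<Longrightarrow>
      ennreal (exp (\<beta> * (leg \<psi> p - \<eta>)) * v) \<le> (\<integral>\<^sup>+x. ennreal (exp (\<beta> * (x \<bullet> p))) * indicator (V a) x \<partial>\<nu>)"
    and legQ: "Gl - \<eta> \<le> (\<Sum>a\<in>C. \<integral>p. indicator (Q a) p * leg \<psi> p \<partial>lborel)"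
    unfolding Gl_def by (rule cells_exist[OF sol n J \<eta>(1)]) blast
  define \<theta> where "\<theta> = v * real (card C)"
  have \<theta>: "1 - \<eta> \<le> \<theta>" "\<theta> \<le> 1" "0 < \<theta>" using vC \<eta> by (auto simp: \<theta>_def)
  have QP': "Q a \<subseteq> P" if "a \<in> C" for a using QP[OF that] interior_subset[of P] by blast
  define nn where "nn k a = card {i\<in>{1..N k}. q k i \<in> Q a}" for k a
  define mm where "mm k = (\<Sum>a\<in>C. nn k a)" for k
  have nn_sum: "real (nn k a) = (\<Sum>i=1..N k. indicator (Q a) (q k i) * 1)" for k a
    by (simp add: nn_def sum.If_cases indicator_def Int_def)
  have lim_nn: "(\<lambda>k. real (nn k a) / real (N k)) \<longlonglongrightarrow> v" if "a \<in> C" for a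
  proof -
    have "(\<lambda>k. (\<Sum>i=1..N k. indicator (Q a) (q k i) * 1) / real (N k)) \<longlonglongrightarrow> (\<integral>x. indicator (Q a) x * 1 \<partial>lborel)"
      using that QP' cQ bQ by (intro average_tendsto[where B = 1]) auto
    then show ?thesis unfolding nn_sum using mQ[OF that] by simp
  qed
  have lim_mm: "(\<lambda>k. real (mm k) / real (N k)) \<longlonglongrightarrow> \<theta>"
  proof -
    have "(\<lambda>k. \<Sum>a\<in>C. real (nn k a) / real (N k)) \<longlonglongrightarrow> (\<Sum>a\<in>C. v)" by (intro tendsto_sum lim_nn)
    then show ?thesis by (simp add: mm_def \<theta>_def sum_divide_distrib mult.commute)
  qed
  have lim_leg: "(\<lambda>k. (\<Sum>i=1..N k. indicator (Q a) (q k i) * leg \<psi> (q k i)) / real (N k))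
      \<longlonglongrightarrow> (\<integral>x. indicator (Q a) x * leg \<psi> x \<partial>lborel)" if "a \<in> C" for a
  proof -
    have "continuous_on (interior (Q a)) (leg \<psi>)"
      using leg_continuous[OF normalized_le[OF n] J] QP[OF that] interior_subset[of "Q a"]
      by (meson continuous_on_subset order_trans)
    then show ?thesis using that QP' cQ bQ legB by (intro average_tendsto[where B = B]) auto
  qed
  \<comment> \<open>The lower bound for \<open>ln Z / N\<close> that is verified below, written in
    the quotients whose limits are known.\<close>
  define low where "low k = real (mm k) / real (N k) * ln (real (mm k) / real (N k))
      - (\<Sum>a\<in>C. real (nn k a) / real (N k) * ln (real (nn k a) / real (N k)))
      - real (card C) * (1 / real (N k) + ln (real (N k)) / real (N k))
      + \<beta> * (\<Sum>a\<in>C. (\<Sum>i=1..N k. indicator (Q a) (q k i) * leg \<psi> (q k i)) / real (N k))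
      + real (mm k) / real (N k) * (ln v - \<beta> * \<eta>) + (1 - real (mm k) / real (N k)) * ln c" for k
  define lim where "lim = \<theta> * ln \<theta> - (\<Sum>a\<in>C. v * ln v) - real (card C) * (0 + 0)
      + \<beta> * (\<Sum>a\<in>C. \<integral>x. indicator (Q a) x * leg \<psi> x \<partial>lborel) + \<theta> * (ln v - \<beta> * \<eta>) + (1 - \<theta>) * ln c"
  have "low \<longlonglongrightarrow> lim"
    unfolding low_def lim_def
    using \<theta>(3) v
    by (intro tendsto_intros lim_mm lim_nn lim_leg
        filterlim_compose[OF ln_x_over_x_tendsto_0 N_at_top]
        tendsto_divide_0[OF tendsto_const filterlim_at_top_imp_at_infinity[OF N_at_top]]) auto
  moreover have "\<beta> * Gl - \<epsilon> < lim"
  proof -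
    \<comment> \<open>All cubes have volume \<open>v\<close>, so the entropy sum collapses and
      cancels the \<open>\<theta> * ln v\<close> that comes from the weights.\<close>
    have sv: "(\<Sum>a\<in>C. v * ln v) = \<theta> * ln v" by (simp add: \<theta>_def)
    have "lim = \<theta> * ln \<theta> + \<beta> * (\<Sum>a\<in>C. \<integral>x. indicator (Q a) x * leg \<psi> x \<partial>lborel) - \<theta> * (\<beta> * \<eta>) + (1 - \<theta>) * ln c"
      unfolding lim_def sv by (simp add: algebra_simps)
    moreover have "- \<eta> \<le> \<theta> * ln \<theta>"
    proof -
      have "ln (1 / \<theta>) \<le> 1 / \<theta> - 1" using \<theta> by (intro ln_le_minus_one) auto
      then have "- ln \<theta> \<le> 1 / \<theta> - 1" using \<theta> by (simp add: ln_div)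
      then have "\<theta> * - ln \<theta> \<le> \<theta> * (1 / \<theta> - 1)" using \<theta> by (intro mult_left_mono) auto
      then show ?thesis using \<theta> by (simp add: right_diff_distrib)
    qed
    moreover have "\<beta> * (Gl - \<eta>) \<le> \<beta> * (\<Sum>a\<in>C. \<integral>x. indicator (Q a) x * leg \<psi> x \<partial>lborel)"
      using legQ beta_pos by (intro mult_left_mono) auto
    moreover have "\<theta> * (\<beta> * \<eta>) \<le> 1 * (\<beta> * \<eta>)" using \<theta> beta_pos \<eta> by (intro mult_right_mono) auto
    moreover have "\<eta> * ln c \<le> (1 - \<theta>) * ln c" using \<theta> c by (intro mult_right_mono_neg) auto
    moreover have "\<eta> * K = \<eta> + 2 * (\<beta> * \<eta>) - \<eta> * ln c" by (simp add: K_def algebra_simps)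
    moreover have "\<beta> * (Gl - \<eta>) = \<beta> * Gl - \<beta> * \<eta>" by (simp add: right_diff_distrib)
    ultimately show ?thesis using \<eta>(3) by linarith
  qed
  ultimately have "eventually (\<lambda>k. \<beta> * Gl - \<epsilon> < low k) sequentially" by (rule order_tendstoD)
  with N_eventually show ?thesis
  proof eventually_elim
    case (elim k)
    then have k: "0 < k" and Nk: "0 < N k" by auto
    interpret gibbs P \<beta> r k "N k" "p k" by (rule gibbs_k[OF k Nk])
    have Zeq: "Z = ZN k (N k) (p k)" by (simp add: Z_def ZN_def s_def)
    define I where "I = {i\<in>{1..N k}. \<exists>a\<in>C. q k i \<in> Q a}"
    define lab where "lab i = (SOME a. a \<in> C \<and> q k i \<in> Q a)" for i
    have lab: "lab i \<in> C" "q k i \<in> Q (lab i)" if "i \<in> I" for i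
    proof -
      have "\<exists>a. a \<in> C \<and> q k i \<in> Q a" using that by (auto simp: I_def)
      from someI_ex[OF this] show "lab i \<in> C" "q k i \<in> Q (lab i)" unfolding lab_def by auto
    qed
    have lab_eq: "lab i = a" if "i \<in> I" "a \<in> C" "q k i \<in> Q a" for i a
    proof (rule ccontr)
      assume "lab i \<noteq> a"
      then have "Q (lab i) \<inter> Q a = {}" using dQ lab(1)[OF that(1)] that(2) unfolding disjoint_family_on_def by blast
      then show False using lab(2)[OF that(1)] that(3) by blast
    qed
    have fib: "{j\<in>I. lab j = a} = {i\<in>{1..N k}. q k i \<in> Q a}" if "a \<in> C" for a
    proof
      show "{j\<in>I. lab j = a} \<subseteq> {i\<in>{1..N k}. q k i \<in> Q a}" using lab by (auto simp: I_def)
      show "{i\<in>{1..N k}. q k i \<in> Q a} \<subseteq> {j\<in>I. lab j = a}"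
      proof
        fix i assume i: "i \<in> {i\<in>{1..N k}. q k i \<in> Q a}"
        then have "i \<in> I" using that by (auto simp: I_def)
        then show "i \<in> {j\<in>I. lab j = a}" using lab_eq[of i a] that i by auto
      qed
    qed
    have finI: "finite I" by (simp add: I_def)
    have cardI: "card I = mm k"
    proof -
      have "I = (\<Union>a\<in>C. {j\<in>I. lab j = a})" using lab by auto
      then have "card I = (\<Sum>a\<in>C. card {j\<in>I. lab j = a})"
        using finC finI by (subst card_UN_disjoint[symmetric]) auto
      then show ?thesis using fib by (simp add: mm_def nn_def cong: sum.cong)
    qed
    have sumI: "(\<Sum>j\<in>I. f j) = (\<Sum>a\<in>C. \<Sum>i=1..N k. indicator (Q a) (q k i) * f i)" for f :: "nat \<Rightarrow> real"
    proof -
      have "(\<Sum>j\<in>I. f j) = (\<Sum>a\<in>C. \<Sum>j\<in>{j\<in>I. lab j = a}. f j)"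
        using lab(1) finC finI by (intro sum.group[symmetric]) auto
      also have "\<dots> = (\<Sum>a\<in>C. \<Sum>i=1..N k. indicator (Q a) (q k i) * f i)"
      proof (rule sum.cong[OF refl])
        fix a assume "a \<in> C"
        have "(\<Sum>i=1..N k. indicator (Q a) (q k i) * f i) = (\<Sum>i\<in>{1..N k}. if q k i \<in> Q a then f i else 0)"
          by (intro sum.cong) (auto simp: indicator_def)
        also have "\<dots> = (\<Sum>i\<in>{i\<in>{1..N k}. q k i \<in> Q a}. f i)" by (subst sum.inter_filter) auto
        finally show "(\<Sum>j\<in>{j\<in>I. lab j = a}. f j) = (\<Sum>i=1..N k. indicator (Q a) (q k i) * f i)"
          using fib[OF \<open>a \<in> C\<close>] by simp
      qed
      finally show ?thesis .
    qed
    \<comment> \<open>Indices in no cube get the unit ball with weight \<open>c\<close>; their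
      proportion tends to \<open>1 - \<theta> \<le> \<eta>\<close>.\<close>
    define W where "W j = (if j \<in> I then V (lab j) else ball 0 1)" for j
    define w where "w j = (if j \<in> I then exp (\<beta> * (leg \<psi> (q k j) - \<eta>)) * v else c)" for j
    have w_pos: "0 < w j" for j using v c by (simp add: w_def)
    have "fact (card I) * (\<Prod>j=1..N k. w j) \<le> (\<Prod>a\<in>lab ` I. fact (card {j\<in>I. lab j = a})) * Z"
    proof (rule Z_lower)
      show "disjoint_family_on V (lab ` I)" using dV lab(1) by (auto simp: disjoint_family_on_def)
      show "W j \<in> sets borel" for j using bV lab(1) by (auto simp: W_def)
      show "ennreal (w j) \<le> (\<integral>\<^sup>+x. ennreal (exp (\<beta> * (x \<bullet> q k j))) * indicator (W j) x \<partial>\<nu>)" if "j \<in> {1..N k}" for j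
        using VQ[OF lab(1) lab(2), of j] c(3)[OF p_in[OF that]] by (simp add: W_def w_def)
    qed (use w_pos in \<open>auto simp: I_def W_def less_imp_le\<close>)
    also have "(\<Prod>a\<in>lab ` I. fact (card {j\<in>I. lab j = a})) = (\<Prod>a\<in>C. fact (nn k a) :: real)"
    proof -
      have "(\<Prod>a\<in>lab ` I. fact (card {j\<in>I. lab j = a}) :: real) = (\<Prod>a\<in>C. fact (card {j\<in>I. lab j = a}))"
      proof (rule prod.mono_neutral_left[OF finC])
        show "\<forall>a\<in>C - lab ` I. fact (card {j\<in>I. lab j = a}) = (1::real)"
        proof
          fix a assume "a \<in> C - lab ` I"
          then have "{j\<in>I. lab j = a} = {}" by auto
          then show "fact (card {j\<in>I. lab j = a}) = (1::real)" by (simp only: card.empty fact_0)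
        qed
      qed (use lab in auto)
      also have "\<dots> = (\<Prod>a\<in>C. fact (nn k a))" using fib by (intro prod.cong) (auto simp: nn_def)
      finally show ?thesis .
    qed
    finally have that_ln: "ln (fact (card I) * (\<Prod>j=1..N k. w j)) \<le> ln ((\<Prod>a\<in>C. fact (nn k a)) * Z)"
      using w_pos by (intro ln_mono) (auto intro!: mult_pos_pos prod_pos)
    have main: "ln (fact (mm k)) + (\<Sum>j=1..N k. ln (w j)) \<le> (\<Sum>a\<in>C. ln (fact (nn k a))) + ln Z"
    proof -
      have "ln (\<Prod>j=1..N k. w j) = (\<Sum>j=1..N k. ln (w j))"
        using w_pos by (intro ln_prod) (auto simp: less_imp_neq[symmetric] less_imp_neq)
      moreover have "ln (\<Prod>a\<in>C. fact (nn k a) :: real) = (\<Sum>a\<in>C. ln (fact (nn k a)))"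
        using finC by (intro ln_prod) auto
      moreover have "0 < (\<Prod>j=1..N k. w j)" "0 < (\<Prod>a\<in>C. fact (nn k a) :: real)"
        using w_pos by (auto intro: prod_pos)
      ultimately show ?thesis
        using that_ln Z_pos by (simp add: ln_mult_pos cardI)
    qed
    have sum_w: "(\<Sum>j=1..N k. ln (w j)) = \<beta> * (\<Sum>a\<in>C. \<Sum>i=1..N k. indicator (Q a) (q k i) * leg \<psi> (q k i))
        + real (mm k) * (ln v - \<beta> * \<eta>) + (real (N k) - real (mm k)) * ln c"
    proof -
      have "{1..N k} = I \<union> ({1..N k} - I)" by (auto simp: I_def)
      then have "(\<Sum>j=1..N k. ln (w j)) = (\<Sum>j\<in>I. ln (w j)) + (\<Sum>j\<in>{1..N k} - I. ln (w j))"
        using finI by (metis Diff_disjoint finite_Diff finite_atLeastAtMost sum.union_disjoint)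
      moreover have "(\<Sum>j\<in>{1..N k} - I. ln (w j)) = (real (N k) - real (mm k)) * ln c"
      proof -
        have "I \<subseteq> {1..N k}" by (auto simp: I_def)
        then have "real (card ({1..N k} - I)) = real (N k) - real (mm k)"
          using finI card_mono[of "{1..N k}" I] by (simp add: card_Diff_subset cardI of_nat_diff)
        then show ?thesis by (simp add: w_def)
      qed
      moreover have "(\<Sum>j\<in>I. ln (w j)) = (\<Sum>j\<in>I. \<beta> * leg \<psi> (q k j)) + real (mm k) * (ln v - \<beta> * \<eta>)"
      proof -
        have "(\<Sum>j\<in>I. ln (w j)) = (\<Sum>j\<in>I. \<beta> * leg \<psi> (q k j) + (ln v - \<beta> * \<eta>))"
          using v by (intro sum.cong) (auto simp: w_def ln_mult_pos right_diff_distrib)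
        then show ?thesis by (simp add: sum.distrib cardI)
      qed
      moreover have "(\<Sum>j\<in>I. \<beta> * leg \<psi> (q k j)) = \<beta> * (\<Sum>a\<in>C. \<Sum>i=1..N k. indicator (Q a) (q k i) * leg \<psi> (q k i))"
        by (simp add: sum_distrib_left[symmetric] sumI)
      ultimately show ?thesis by simp
    qed
    \<comment> \<open>Since the cell counts sum to \<open>mm k\<close>, the linear terms of
      Stirling's bounds and the multiples of \<open>ln (N k)\<close> cancel. The leftover
      \<open>1 + ln (N k)\<close> per cube vanishes after division by \<open>N k\<close>.\<close>
    have fact_sum: "real (mm k) * ln (real (mm k) / real (N k)) - (\<Sum>a\<in>C. real (nn k a) * ln (real (nn k a) / real (N k)))
        - real (card C) * (1 + ln (real (N k))) \<le> ln (fact (mm k)) - (\<Sum>a\<in>C. ln (fact (nn k a)))"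
    proof -
      have "(\<Sum>a\<in>C. ln (fact (nn k a))) \<le> (\<Sum>a\<in>C. (real (nn k a) * ln (real (nn k a) / real (N k)) + real (nn k a) * ln (real (N k)))
          - real (nn k a) + (1 + ln (real (N k))))"
      proof (rule sum_mono)
        fix a
        have "nn k a \<le> N k" 
          unfolding nn_def by (rule order_trans[OF card_mono[of "{1..N k}"]]) auto
        then have "ln (real (nn k a)) \<le> ln (real (N k))" using Nk by (cases "nn k a = 0") auto
        then show "ln (fact (nn k a)) \<le> (real (nn k a) * ln (real (nn k a) / real (N k)) + real (nn k a) * ln (real (N k)))
          - real (nn k a) + (1 + ln (real (N k)))"
          unfolding xlnx_split[OF Nk, symmetric] using ln_fact_upper[of "nn k a"] by linarith
      qed
      also have "\<dots> = (\<Sum>a\<in>C. real (nn k a) * ln (real (nn k a) / real (N k))) + real (mm k) * ln (real (N k))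
          - real (mm k) + real (card C) * (1 + ln (real (N k)))"
        by (simp add: sum.distrib sum_subtractf mm_def sum_distrib_right)
      finally show ?thesis using ln_fact_lower[of "mm k"] xlnx_split[OF Nk, of "mm k"] by linarith
    qed
    have "low k * real (N k) = real (mm k) * ln (real (mm k) / real (N k)) - (\<Sum>a\<in>C. real (nn k a) * ln (real (nn k a) / real (N k)))
        - real (card C) * (1 + ln (real (N k)))
        + \<beta> * (\<Sum>a\<in>C. \<Sum>i=1..N k. indicator (Q a) (q k i) * leg \<psi> (q k i))
        + real (mm k) * (ln v - \<beta> * \<eta>) + (real (N k) - real (mm k)) * ln c"
    proof -
      define S1 where "S1 = (\<Sum>a\<in>C. real (nn k a) * ln (real (nn k a) / real (N k)))"
      define S2 where "S2 = (\<Sum>a\<in>C. \<Sum>i=1..N k. indicator (Q a) (q k i) * leg \<psi> (q k i))"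
      have "(\<Sum>a\<in>C. real (nn k a) / real (N k) * ln (real (nn k a) / real (N k))) = S1 / real (N k)"
        unfolding S1_def sum_divide_distrib by (intro sum.cong) auto
      moreover have "(\<Sum>a\<in>C. (\<Sum>i=1..N k. indicator (Q a) (q k i) * leg \<psi> (q k i)) / real (N k)) = S2 / real (N k)"
        unfolding S2_def by (rule sum_divide_distrib[symmetric])
      ultimately show ?thesis
        using Nk unfolding low_def S1_def[symmetric] S2_def[symmetric]
        by (simp add: field_simps)
    qed
    then have "low k * real (N k) \<le> ln Z" using main sum_w fact_sum by linarith
    then have "low k \<le> ln Z / real (N k)" using Nk by (simp add: le_divide_eq)
    then show ?case using elim(2) by (simp add: Zeq Gl_def)
  qed
qed

end

section \<open>Convergence of the one-point functions\<close>

context gibbs_sequence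
begin

text \<open>For fixed \<open>x\<close> the maximum equals \<open>\<psi> x\<close> once the cut-off
  is large, and the exponential of the support function dominates. The lower bound \<open>b\<close>
  leaves room to ask that the truncation be invisible on a given ball.\<close>

lemma truncation_mass:
  assumes "PLip P \<psi>" "M \<psi> = 1" "0 < \<delta>"
  shows "\<exists>c\<ge>b. M (\<lambda>x. max (\<psi> x) (support_fun P x - c)) \<le> 1 + \<delta>"
proof -
  note [measurable] = borel[OF assms(1)]
  have "(\<lambda>j. M (\<lambda>x. max (\<psi> x) (support_fun P x - real j))) \<longlonglongrightarrow> M \<psi>"
    unfolding M_def
  proof (rule integral_dominated_convergence[where w = "\<lambda>x. exp (\<beta> * \<bar>\<psi> 0\<bar>) * exp (\<beta> * support_fun P x)"])
    show "integrable \<nu> (\<lambda>x. exp (\<beta> * \<bar>\<psi> 0\<bar>) * exp (\<beta> * support_fun P x))" using integrable_support by simp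
    show "AE x in \<nu>. (\<lambda>j. exp (\<beta> * max (\<psi> x) (support_fun P x - real j))) \<longlonglongrightarrow> exp (\<beta> * \<psi> x)"
    proof (rule AE_I2)
      fix x
      obtain j0 :: nat where "support_fun P x - \<psi> x \<le> real j0" using real_arch_simple by blast
      then have "eventually (\<lambda>j. exp (\<beta> * \<psi> x) = exp (\<beta> * max (\<psi> x) (support_fun P x - real j))) sequentially"
        by (intro eventually_sequentiallyI[of j0]) (auto simp: max_def)
      then show "(\<lambda>j. exp (\<beta> * max (\<psi> x) (support_fun P x - real j))) \<longlonglongrightarrow> exp (\<beta> * \<psi> x)"
        by (rule Lim_transform_eventually[OF tendsto_const])
    qed
    show "AE x in \<nu>. norm (exp (\<beta> * max (\<psi> x) (support_fun P x - real j))) \<le> exp (\<beta> * \<bar>\<psi> 0\<bar>) * exp (\<beta> * support_fun P x)" for j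
    proof (rule AE_I2)
      fix x
      have "max (\<psi> x) (support_fun P x - real j) \<le> \<bar>\<psi> 0\<bar> + support_fun P x"
        using le_support[OF assms(1), of x] abs_ge_self[of "\<psi> 0"] by (intro max.boundedI) linarith+
      then have "\<beta> * max (\<psi> x) (support_fun P x - real j) \<le> \<beta> * (\<bar>\<psi> 0\<bar> + support_fun P x)"
        using beta_pos by (intro mult_left_mono) auto
      then show "norm (exp (\<beta> * max (\<psi> x) (support_fun P x - real j))) \<le> exp (\<beta> * \<bar>\<psi> 0\<bar>) * exp (\<beta> * support_fun P x)"
        by (simp add: exp_add[symmetric] distrib_left)
    qed
  qed measurable
  then have "eventually (\<lambda>j. M (\<lambda>x. max (\<psi> x) (support_fun P x - real j)) < 1 + \<delta>) sequentially"
    using assms by (intro order_tendstoD) auto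
  moreover obtain j1 :: nat where "b \<le> real j1" using real_arch_simple by blast
  then have "eventually (\<lambda>j. b \<le> real j) sequentially" by (intro eventually_sequentiallyI[of j1]) auto
  ultimately have "eventually (\<lambda>j. b \<le> real j \<and> M (\<lambda>x. max (\<psi> x) (support_fun P x - real j)) \<le> 1 + \<delta>) sequentially"
    by eventually_elim simp
  then obtain j :: nat where "b \<le> real j" "M (\<lambda>x. max (\<psi> x) (support_fun P x - real j)) \<le> 1 + \<delta>"
    unfolding eventually_sequentially by blast
  then show ?thesis by blast
qed

theorem phiN_converges:
  assumes sol: "is_solution \<psi>" and n: "normalized \<psi>" and J: "J \<psi> < \<infinity>" and \<epsilon>: "0 < \<epsilon>"
  shows "eventually (\<lambda>k. \<forall>x\<in>cball 0 R. \<bar>phiN k (N k) (p k) x - \<psi> x\<bar> \<le> \<epsilon>) sequentially"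
proof -
  have PL: "PLip P \<psi>" and M1: "M \<psi> = 1" using n by (auto simp: normalized_def)
  obtain \<delta> where \<delta>: "0 < \<delta>" "\<And>u w. PLip P u \<and> PLip P w \<and> - M_bound \<le> u 0 \<and> - M_bound \<le> w 0 \<and>
    (\<integral>\<^sup>+x. ennreal ((exp (\<beta> * u x / 2) - exp (\<beta> * w x / 2))\<^sup>2) \<partial>\<nu>) \<le> ennreal \<delta>
    \<longrightarrow> (\<forall>x\<in>cball 0 R. \<bar>u x - w x\<bar> \<le> \<epsilon>)"
    using hellinger_control[OF \<epsilon>] by blast
  define Gl where "Gl = (\<integral>p. indicator P p * leg \<psi> p \<partial>lborel)"
  \<comment> \<open>With \<open>c \<ge> 2 * L * R + M_bound\<close> the shifted support function
    stays below \<open>\<psi>\<close> on the ball of radius \<open>R\<close>, so truncation does not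
    affect the convergence being proved there.\<close>
  obtain c where c: "2 * L * R + M_bound \<le> c" "M (\<lambda>x. max (\<psi> x) (support_fun P x - c)) \<le> 1 + \<delta> / 4"
    using truncation_mass[OF PL M1, of "\<delta> / 4" "2 * L * R + M_bound"] \<delta>(1) by auto
  define \<psi>c where "\<psi>c x = max (\<psi> x) (support_fun P x - c)" for x
  have PLc: "PLip P \<psi>c" unfolding \<psi>c_def by (intro PLip_max PL PLip_diff_const PLip_support)
  have eqR: "\<psi>c x = \<psi> x" if "x \<in> cball 0 R" for x
  proof -
    have "support_fun P x \<le> L * norm x" using lipschitz[OF PLip_support, of x 0] by (simp add: support_fun_zero P_nonempty)
    moreover have "\<psi> 0 - L * norm x \<le> \<psi> x" using lipschitz[OF PL, of x 0] by simp
    moreover have "L * norm x \<le> L * R" using that L_pos by simp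
    ultimately have "support_fun P x - c \<le> \<psi> x" using c(1) normalized_bounds(1)[OF PL M1] by linarith
    then show ?thesis by (simp add: \<psi>c_def)
  qed
  \<comment> \<open>A bounded majorant of the transform of \<open>\<psi>c\<close> on
    \<open>P\<close>. The constant \<open>c\<close> comes from the truncation
    \<open>support_fun P - c\<close>; on the boundary, where \<open>leg\<close> may hold its junk
    value, it is the only safe choice, and the boundary is null for the integral.\<close>
  define l where "l y = (if y \<in> interior P then min (leg \<psi> y) c else c)" for y
  have [measurable]: "l \<in> borel_measurable borel" unfolding l_def by measurable
  have Y: "z \<bullet> y \<le> \<psi>c z + l y" if "y \<in> P" for z y
  proof -
    have "z \<bullet> y \<le> support_fun P z" by (rule inner_le_support_fun[OF compact_P that])
    moreover have "z \<bullet> y - \<psi> z \<le> leg \<psi> y" if "y \<in> interior P"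
      using that interior_subset_fdom[OF normalized_le[OF n] J] by (intro leg_upper) blast
    ultimately show ?thesis by (auto simp: \<psi>c_def l_def)
  qed
  have lb: "\<bar>l y\<bar> \<le> \<bar>M_bound\<bar> + \<bar>c\<bar>" for y
    using leg_ge_bound[of \<psi> y] by (auto simp: l_def)
  have "continuous_on (interior P) (\<lambda>y. min (leg \<psi> y) c)"
    by (intro continuous_intros leg_continuous[OF normalized_le[OF n] J])
  then have cl: "continuous_on (interior P) l"
    by (subst continuous_on_cong[OF refl]) (auto simp: l_def)
  have lim_l: "(\<lambda>k. (\<Sum>i=1..N k. indicator P (q k i) * l (q k i)) / real (N k)) \<longlonglongrightarrow> (\<integral>y. indicator P y * l y \<partial>lborel)"
    using lb by (intro average_tendsto[where B = "\<bar>M_bound\<bar> + \<bar>c\<bar>"] cl) (auto simp: convex_P)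
  have int_l: "(\<integral>y. indicator P y * l y \<partial>lborel) \<le> Gl"
    unfolding Gl_def
  proof (rule integral_mono_AE)
    show "integrable lborel (\<lambda>y. indicator P y * l y)"
      using lb by (intro Bochner_Integration.integrable_bound[OF integrable_mult_right[OF integrable_P, of "\<bar>M_bound\<bar> + \<bar>c\<bar>"]])
        (auto intro!: AE_I2 split: split_indicator)
    show "AE y in lborel. indicator P y * l y \<le> indicator P y * leg \<psi> y"
      using AE_not_frontier_convex[OF convex_P]
      by (rule eventually_mono) (use closed_P in \<open>auto simp: frontier_def l_def indicator_def\<close>)
  qed (rule leg_integrable(1)[OF J])
  have ev1: "eventually (\<lambda>k. (\<Sum>i=1..N k. indicator P (q k i) * l (q k i)) / real (N k) < Gl + \<delta> / (4 * \<beta>)) sequentially"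
    using order_tendstoD(2)[OF lim_l, of "Gl + \<delta> / (4 * \<beta>)"] int_l \<delta>(1) beta_pos
    by (auto intro!: less_le_trans add_pos_pos simp: add_strict_increasing2 le_less_trans)
  have ev2: "eventually (\<lambda>k. (\<beta> / real k) * ln (fact (N k)) / real (N k) < \<delta> / 4) sequentially"
    using \<delta>(1) by (intro order_tendstoD(2)[OF ln_fact_negligible]) simp
  have ev3: "eventually (\<lambda>k. \<beta> * Gl - \<delta> / 4 \<le> ln (ZN k (N k) (p k)) / real (N k)) sequentially"
    unfolding Gl_def using \<delta>(1) by (intro Z_asymp_lower[OF sol n J]) simp
  show ?thesis
    using N_eventually ev1 ev2 ev3
  proof eventually_elim
    case (elim k)
    then have k: "0 < k" and Nk: "0 < N k" by auto
    interpret gibbs P \<beta> r k "N k" "p k" by (rule gibbs_k[OF k Nk])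
    have Zeq: "Z = ZN k (N k) (p k)" by (simp add: Z_def ZN_def s_def)
    have phi_eq: "phi = phiN k (N k) (p k)"
      by (simp add: phi_def phiN_def Fm_def Zeq s_def fun_eq_iff)
    have suml: "(\<Sum>i=1..N k. l (q k i)) = (\<Sum>i=1..N k. indicator P (q k i) * l (q k i))"
      using p_in by (intro sum.cong) auto
    have "(\<integral>\<^sup>+x. ennreal ((exp (\<beta> * \<psi>c x / 2) - exp (\<beta> * phi x / 2))\<^sup>2) \<partial>\<nu>)
      \<le> ennreal (M \<psi>c - 1 + (s * ln (fact (N k)) + \<beta> * (\<Sum>i=1..N k. l (q k i)) - ln Z) / real (N k))"
    proof (rule hellinger_bound[OF PLc, where C = c])
      show "support_fun P z - c \<le> \<psi>c z" for z by (simp add: \<psi>c_def)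
      show "z \<bullet> q k i \<le> \<psi>c z + l (q k i)" if "i \<in> {1..N k}" for i z by (rule Y[OF p_in[OF that]])
    qed
    \<comment> \<open>Four quarters of \<open>\<delta>\<close>: the excess mass of
      \<open>\<psi>c\<close>, the factorial term, the average of \<open>l\<close> above
      \<open>Gl\<close>, and the deficit of \<open>ln Z / N\<close>.\<close>
    also have "\<dots> \<le> ennreal \<delta>"
    proof (rule ennreal_leI)
      have "\<beta> * ((\<Sum>i=1..N k. l (q k i)) / real (N k)) \<le> \<beta> * (Gl + \<delta> / (4 * \<beta>))"
        using elim(2) beta_pos unfolding suml by (intro mult_left_mono) auto
      also have "\<dots> = \<beta> * Gl + \<delta> / 4" using beta_pos by (simp add: field_simps)
      finally have 1: "\<beta> * ((\<Sum>i=1..N k. l (q k i)) / real (N k)) \<le> \<beta> * Gl + \<delta> / 4" .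
      have 2: "s * ln (fact (N k)) / real (N k) < \<delta> / 4" using elim(3) by (simp add: s_def)
      have 3: "M \<psi>c \<le> 1 + \<delta> / 4" using c(2) by (simp add: \<psi>c_def[abs_def])
      have 4: "\<beta> * Gl - \<delta> / 4 \<le> ln Z / real (N k)" using elim(4) by (simp add: Zeq)
      have "(s * ln (fact (N k)) + \<beta> * (\<Sum>i=1..N k. l (q k i)) - ln Z) / real (N k)
        = s * ln (fact (N k)) / real (N k) + \<beta> * ((\<Sum>i=1..N k. l (q k i)) / real (N k)) - ln Z / real (N k)"
        by (simp add: add_divide_distrib diff_divide_distrib)
      then show "M \<psi>c - 1 + (s * ln (fact (N k)) + \<beta> * (\<Sum>i=1..N k. l (q k i)) - ln Z) / real (N k) \<le> \<delta>"
        using 1 2 3 4 by linarith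
    qed
    finally have h: "(\<integral>\<^sup>+x. ennreal ((exp (\<beta> * \<psi>c x / 2) - exp (\<beta> * phi x / 2))\<^sup>2) \<partial>\<nu>) \<le> ennreal \<delta>" .
    have "- M_bound \<le> \<psi>c 0" using normalized_bounds(1)[OF PL M1] by (simp add: \<psi>c_def)
    then have "\<forall>x\<in>cball 0 R. \<bar>\<psi>c x - phi x\<bar> \<le> \<epsilon>"
      using \<delta>(2)[of \<psi>c phi] PLc PLip_phi normalized_bounds(1)[OF PLip_phi M_phi] h by blast
    then show ?case using eqR unfolding phi_eq[symmetric] by (simp add: abs_minus_commute)
  qed
qed

end

section \<open>Differentiability\<close>

text \<open>Differentiation under the integral sign: along any sequence of steps tending to 0, the
  remainder divided by the step length is dominated by \<open>2 * (C * f x y)\<close> and tends to 0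
  pointwise.\<close>

lemma GDERIV_integral:
  fixes f :: "'a::euclidean_space \<Rightarrow> 'b \<Rightarrow> real" and g :: "'b \<Rightarrow> 'a"
  assumes int: "\<And>u. integrable M (f u)" and [measurable]: "g \<in> borel_measurable M"
    and der: "\<And>y. GDERIV (\<lambda>u. f u y) x :> g y"
    and dom: "\<And>h y. norm h \<le> 1 \<Longrightarrow> \<bar>f (x + h) y - f x y\<bar> \<le> C * norm h * f x y"
    and gb: "\<And>y. norm (g y) \<le> C * f x y"
  shows "GDERIV (\<lambda>u. \<integral>y. f u y \<partial>M) x :> (\<integral>y. g y \<partial>M)"
proof -
  have intg: "integrable M g"
  proof (rule Bochner_Integration.integrable_bound)
    show "integrable M (\<lambda>y. C * f x y)" using int by simp
    show "AE y in M. norm (g y) \<le> norm (C * f x y)" using order_trans[OF gb abs_ge_self] by (intro AE_I2) auto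
  qed measurable
  have "((\<lambda>h. norm ((\<integral>y. f (x + h) y \<partial>M) - (\<integral>y. f x y \<partial>M) - h \<bullet> (\<integral>y. g y \<partial>M)) / norm h) \<longlongrightarrow> 0) (at 0)"
    unfolding tendsto_at_iff_sequentially comp_def
  proof (intro allI impI)
    fix X :: "nat \<Rightarrow> 'a" assume X: "\<forall>i. X i \<in> UNIV - {0}" "X \<longlonglongrightarrow> 0"
    define Q where "Q h = norm ((\<integral>y. f (x + h) y \<partial>M) - (\<integral>y. f x y \<partial>M) - h \<bullet> (\<integral>y. g y \<partial>M)) / norm h" for h
    \<comment> \<open>The domination is assumed only for steps of norm at most 1, so an initial
      segment of the sequence is dropped and restored by \<open>LIMSEQ_offset\<close>.\<close>
    have "eventually (\<lambda>i. norm (X i) < 1) sequentially"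
      using tendsto_norm[OF X(2)] by (intro order_tendstoD(2)) auto
    then obtain m where m: "\<And>i. i \<ge> m \<Longrightarrow> norm (X i) \<le> 1"
      unfolding eventually_sequentially by (auto intro: less_imp_le)
    define Y where "Y i = X (i + m)" for i
    have Y: "Y \<longlonglongrightarrow> 0" "\<And>i. Y i \<noteq> 0" "\<And>i. norm (Y i) \<le> 1"
      using X m LIMSEQ_ignore_initial_segment[OF X(2), of m] by (auto simp: Y_def[abs_def])
    define D where "D i y = (f (x + Y i) y - f x y - Y i \<bullet> g y) / norm (Y i)" for i y
    have intD: "integrable M (D i)" for i
      unfolding D_def using int intg by (intro integrable_divide Bochner_Integration.integrable_diff integrable_inner_right) auto
    have "(\<lambda>i. \<integral>y. D i y \<partial>M) \<longlonglongrightarrow> (\<integral>y. 0 \<partial>M)"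
    proof (rule integral_dominated_convergence[where w = "\<lambda>y. 2 * (C * f x y)"])
      show "AE y in M. (\<lambda>i. D i y) \<longlonglongrightarrow> 0"
      proof (rule AE_I2)
        fix y
        have "((\<lambda>h. norm (f (x + h) y - f x y - h \<bullet> g y) / norm h) \<longlongrightarrow> 0) (at 0)"
          using der[of y] by (simp add: gderiv_def has_derivative_at)
        then have "(\<lambda>i. norm (f (x + Y i) y - f x y - Y i \<bullet> g y) / norm (Y i)) \<longlonglongrightarrow> 0"
          by (rule filterlim_compose) (use Y in \<open>auto simp: filterlim_at\<close>)
        then have "(\<lambda>i. norm (D i y)) \<longlonglongrightarrow> 0" by (simp add: D_def)
        then show "(\<lambda>i. D i y) \<longlonglongrightarrow> 0" by (rule tendsto_norm_zero_cancel)
      qed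
      show "AE y in M. norm (D i y) \<le> 2 * (C * f x y)" for i
      proof (rule AE_I2)
        fix y
        have "\<bar>f (x + Y i) y - f x y - Y i \<bullet> g y\<bar> \<le> \<bar>f (x + Y i) y - f x y\<bar> + \<bar>Y i \<bullet> g y\<bar>" by simp
        also have "\<dots> \<le> C * norm (Y i) * f x y + norm (Y i) * norm (g y)"
          by (intro add_mono dom Y Cauchy_Schwarz_ineq2)
        also have "\<dots> \<le> C * norm (Y i) * f x y + norm (Y i) * (C * f x y)"
          using gb by (intro add_left_mono mult_left_mono) auto
        also have "\<dots> = norm (Y i) * (2 * (C * f x y))" by (simp add: algebra_simps)
        finally show "norm (D i y) \<le> 2 * (C * f x y)" using Y(2)[of i] by (simp add: D_def divide_le_eq mult.commute)
      qed
    qed (use int intD in auto)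
    then have "(\<lambda>i. norm (\<integral>y. D i y \<partial>M)) \<longlonglongrightarrow> 0" by (simp add: tendsto_rabs_zero)
    moreover have "norm (\<integral>y. D i y \<partial>M) = Q (Y i)" for i
    proof -
      have "(\<integral>y. D i y \<partial>M) = ((\<integral>y. f (x + Y i) y \<partial>M) - (\<integral>y. f x y \<partial>M) - Y i \<bullet> (\<integral>y. g y \<partial>M)) / norm (Y i)"
        unfolding D_def using int intg by simp
      then show ?thesis by (simp add: Q_def)
    qed
    ultimately have "(\<lambda>i. Q (X (i + m))) \<longlonglongrightarrow> 0" by (simp add: Y_def)
    then show "(\<lambda>i. Q (X i)) \<longlonglongrightarrow> 0" by (rule LIMSEQ_offset)
  qed
  then show ?thesis
    by (simp add: gderiv_def has_derivative_at bounded_linear_inner_left)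
qed

text \<open>Difference quotients in direction \<open>v\<close> are bounded by
  \<open>support_fun P v\<close>, hence so is the directional derivative
  \<open>v \<bullet> g\<close>, and the separation criterion applies.\<close>

lemma PLip_GDERIV_mem:
  assumes P: "compact P" "convex P" "P \<noteq> {}" and PL: "PLip P \<phi>" and g: "GDERIV \<phi> x :> g"
  shows "g \<in> P"
proof (rule mem_if_inner_le_support_fun[OF P])
  fix v
  have "((\<lambda>t. x + t *\<^sub>R v) has_derivative (\<lambda>t. t *\<^sub>R v)) (at 0)"
    by (auto intro!: derivative_eq_intros)
  moreover have "(\<phi> has_derivative (\<lambda>h. h \<bullet> g)) (at (x + 0 *\<^sub>R v))" using g by (simp add: gderiv_def)
  ultimately have "((\<lambda>t. \<phi> (x + t *\<^sub>R v)) has_derivative (\<lambda>t. (t *\<^sub>R v) \<bullet> g)) (at 0)"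
    by (rule has_derivative_compose)
  then have "((\<lambda>t. \<phi> (x + t *\<^sub>R v)) has_real_derivative (v \<bullet> g)) (at 0)"
    by (simp add: has_field_derivative_def mult_commute_abs)
  then have "((\<lambda>t. (\<phi> (x + t *\<^sub>R v) - \<phi> x) / t) \<longlongrightarrow> v \<bullet> g) (at 0)"
    by (simp add: DERIV_def)
  then have lim: "((\<lambda>t. (\<phi> (x + t *\<^sub>R v) - \<phi> x) / t) \<longlongrightarrow> v \<bullet> g) (at_right 0)"
    by (rule tendsto_mono[OF at_le, rotated]) simp
  show "v \<bullet> g \<le> support_fun P v"
  proof (rule tendsto_upperbound[OF lim])
    show "eventually (\<lambda>t. (\<phi> (x + t *\<^sub>R v) - \<phi> x) / t \<le> support_fun P v) (at_right 0)"
      using eventually_at_right_less[of 0]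
    proof (rule eventually_mono)
      fix t :: real assume t: "0 < t"
      have "\<phi> (x + t *\<^sub>R v) - \<phi> x \<le> support_fun P (t *\<^sub>R v)" using PLipD[OF PL, of "x + t *\<^sub>R v" x] by simp
      also have "\<dots> \<le> t * support_fun P v"
        using t by (intro support_fun_le[OF P(3)]) (simp add: inner_le_support_fun[OF P(1)])
      finally show "(\<phi> (x + t *\<^sub>R v) - \<phi> x) / t \<le> support_fun P v" using t by (simp add: divide_le_eq mult.commute)
    qed
  qed simp
qed

context gibbs
begin

lemma GDERIV_phi: "\<exists>g\<in>P. GDERIV phi x :> g"
proof -
  define S where "S = {\<sigma>. \<sigma> permutes {1..N}}"
  define c where "c \<sigma> y = (\<Prod>i=2..N. exp (y i \<bullet> p (\<sigma> i)))" for \<sigma> and y :: "nat \<Rightarrow> real^'n"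
  have c0: "0 \<le> c \<sigma> y" for \<sigma> y unfolding c_def by (intro prod_nonneg) auto
  have [measurable]: "c \<sigma> \<in> borel_measurable (piM {2..N})" for \<sigma> unfolding c_def by measurable
  have Per_eq: "Per N p (y(1 := u)) = (\<Sum>\<sigma>\<in>S. exp (u \<bullet> p (\<sigma> 1)) * c \<sigma> y)" for y u
    unfolding Per_def S_def[symmetric]
  proof (rule sum.cong[OF refl])
    fix \<sigma>
    have "(\<Prod>i=1..N. exp ((y(1 := u)) i \<bullet> p (\<sigma> i))) = exp (u \<bullet> p (\<sigma> 1)) * (\<Prod>i=2..N. exp ((y(1 := u)) i \<bullet> p (\<sigma> i)))"
      unfolding split_index by (subst prod.insert) auto
    also have "(\<Prod>i=2..N. exp ((y(1 := u)) i \<bullet> p (\<sigma> i))) = c \<sigma> y" unfolding c_def by (intro prod.cong) auto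
    finally show "(\<Prod>i=1..N. exp ((y(1 := u)) i \<bullet> p (\<sigma> i))) = exp (u \<bullet> p (\<sigma> 1)) * c \<sigma> y" .
  qed
  define f where "f u y = Per N p (y(1 := u)) powr s" for u y
  define G where "G y = (\<Sum>\<sigma>\<in>S. (exp (x \<bullet> p (\<sigma> 1)) * c \<sigma> y) *\<^sub>R p (\<sigma> 1))" for y
  define g where "g y = (s * Per N p (y(1 := x)) powr (s - 1)) *\<^sub>R G y" for y
  \<comment> \<open>With \<open>t = \<beta> * L * norm h\<close>, the ratio of
    \<open>f (x + h) y\<close> to \<open>f x y\<close> lies between \<open>exp (- t)\<close> and
    \<open>exp t\<close>. Both differ from 1 by at most \<open>t * exp t\<close>, which is at most
    \<open>C * norm h\<close> when \<open>norm h \<le> 1\<close>.\<close>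
  define C where "C = \<beta> * L * exp (\<beta> * L)"
  have C: "\<beta> * L \<le> C" "0 < \<beta> * L" using beta_pos L_pos by (auto simp: C_def)
  have "GDERIV (\<lambda>u. \<integral>y. f u y \<partial>(piM {2..N})) x :> (\<integral>y. g y \<partial>(piM {2..N}))"
  proof (rule GDERIV_integral[where C = C])
    show "integrable (piM {2..N}) (f u)" for u unfolding f_def by (rule integrable_Per_upd)
    show "g \<in> borel_measurable (piM {2..N})" unfolding g_def G_def by measurable
    show "GDERIV (\<lambda>u. f u y) x :> g y" for y
    proof -
      have "((\<lambda>u. \<Sum>\<sigma>\<in>S. exp (u \<bullet> p (\<sigma> 1)) * c \<sigma> y) has_derivative (\<lambda>h. h \<bullet> G y)) (at x)"
        by (auto intro!: derivative_eq_intros simp: G_def inner_sum_right fun_eq_iff algebra_simps)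
      then have "GDERIV (\<lambda>u. Per N p (y(1 := u))) x :> G y" by (simp add: gderiv_def Per_eq)
      moreover have "DERIV (\<lambda>t. t powr s) (Per N p (y(1 := x))) :> s * Per N p (y(1 := x)) powr (s - 1)"
        by (rule has_real_derivative_powr[OF Per_pos])
      ultimately show ?thesis unfolding f_def g_def by (rule GDERIV_DERIV_compose)
    qed
    have up: "f u y \<le> exp (\<beta> * L * norm (u - u')) * f u' y" for u u' y
    proof -
      have "support_fun P (u - u') \<le> L * norm (u - u')"
        using lipschitz[OF PLip_support, of "u - u'" 0] by (simp add: support_fun_zero P_nonempty)
      then have "\<beta> * support_fun P (u - u') \<le> \<beta> * L * norm (u - u')" using beta_pos by (simp add: mult.assoc)
      then have "exp (\<beta> * support_fun P (u - u')) * f u' y \<le> exp (\<beta> * L * norm (u - u')) * f u' y"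
        by (intro mult_right_mono) (auto simp: f_def)
      then show ?thesis using powr_Per_upd_le[of y u u'] by (simp add: f_def)
    qed
    show "\<bar>f (x + h) y - f x y\<bar> \<le> C * norm h * f x y" if h: "norm h \<le> 1" for h y
    proof -
      define t where "t = \<beta> * L * norm h"
      have t: "0 \<le> t" "t \<le> \<beta> * L" using C h mult_left_mono[OF h, of "\<beta> * L"] by (auto simp: t_def)
      have f0: "0 \<le> f x y" by (simp add: f_def)
      have 1: "f (x + h) y \<le> exp t * f x y" using up[of "x + h" y x] by (simp add: t_def)
      have "f x y \<le> exp t * f (x + h) y" using up[of x y "x + h"] by (simp add: t_def)
      then have "exp (- t) * f x y \<le> exp (- t) * (exp t * f (x + h) y)" by (intro mult_left_mono) auto
      also have "\<dots> = f (x + h) y" by (simp add: mult.assoc[symmetric] exp_add[symmetric])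
      finally have 2: "exp (- t) * f x y \<le> f (x + h) y" .
      have e: "1 - exp (- t) \<le> t" "exp t - 1 \<le> t * exp t" "t \<le> t * exp t"
      proof -
        show "1 - exp (- t) \<le> t" using exp_ge_add_one_self[of "- t"] by linarith
        have "(1 + (- t)) * exp t \<le> exp (- t) * exp t" by (intro mult_right_mono exp_ge_add_one_self) auto
        then show "exp t - 1 \<le> t * exp t" by (simp add: exp_minus algebra_simps)
        show "t \<le> t * exp t" using t by (simp add: mult_le_cancel_left1)
      qed
      have "t * exp t \<le> t * exp (\<beta> * L)" using t by (intro mult_left_mono) auto
      also have "\<dots> = C * norm h" by (simp add: t_def C_def)
      finally have tC: "t * exp t \<le> C * norm h" .
      have "(exp t - 1) * f x y \<le> C * norm h * f x y" "(1 - exp (- t)) * f x y \<le> C * norm h * f x y"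
        using e tC f0 by (auto intro!: mult_right_mono)
      then show ?thesis using 1 2 by (simp add: abs_le_iff algebra_simps)
    qed
    show "norm (g y) \<le> C * f x y" for y
    proof -
      have "norm (G y) \<le> (\<Sum>\<sigma>\<in>S. (exp (x \<bullet> p (\<sigma> 1)) * c \<sigma> y) * (real k * L))"
        unfolding G_def
      proof (rule sum_norm_le)
        fix \<sigma> assume "\<sigma> \<in> S"
        then have "\<sigma> 1 \<in> {1..N}" using permutes_in_image[of \<sigma> "{1..N}" 1] N_pos by (auto simp: S_def)
        then have "norm ((1 / real k) *\<^sub>R p (\<sigma> 1)) \<le> L" by (intro norm_le_L p_in)
        then have "norm (p (\<sigma> 1)) \<le> real k * L" using k_pos by (simp add: field_simps)
        then show "norm ((exp (x \<bullet> p (\<sigma> 1)) * c \<sigma> y) *\<^sub>R p (\<sigma> 1)) \<le> (exp (x \<bullet> p (\<sigma> 1)) * c \<sigma> y) * (real k * L)"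
          using c0 by (simp add: abs_mult mult_left_mono)
      qed
      also have "\<dots> = Per N p (y(1 := x)) * (real k * L)" by (simp add: Per_eq sum_distrib_right)
      finally have "norm (g y) \<le> (s * Per N p (y(1 := x)) powr (s - 1)) * (Per N p (y(1 := x)) * (real k * L))"
        unfolding g_def using s_pos by (simp add: mult_left_mono)
      also have "\<dots> = (s * real k) * L * (Per N p (y(1 := x)) powr (s - 1) * Per N p (y(1 := x)))" by simp
      also have "Per N p (y(1 := x)) powr (s - 1) * Per N p (y(1 := x)) = f x y"
        using Per_pos[of N p "y(1 := x)"] by (simp add: f_def powr_diff)
      finally show ?thesis unfolding s_k
        by (rule order_trans[OF _ mult_right_mono[OF C(1)]]) (simp add: f_def)
    qed
  qed
  then have "GDERIV Fm x :> (\<integral>y. g y \<partial>(piM {2..N}))" by (simp add: Fm_def[abs_def] f_def)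
  moreover have "DERIV (\<lambda>t. ln (t / Z) / \<beta>) (Fm x) :> 1 / Fm x / \<beta>"
    using Fm_pos[of x] Z_pos beta_pos by (auto intro!: derivative_eq_intros simp: field_simps)
  ultimately have "GDERIV phi x :> (1 / Fm x / \<beta>) *\<^sub>R (\<integral>y. g y \<partial>(piM {2..N}))"
    unfolding phi_def by (rule GDERIV_DERIV_compose)
  then show ?thesis using PLip_GDERIV_mem[OF compact_P convex_P P_nonempty PLip_phi] by blast
qed

end

section \<open>The main result\<close>

text \<open>A positive density charges every nonempty open set, so the support is the whole space
  and the indicator in \<open>exp_measure\<close> is constantly 1.\<close>

lemma exp_measure_eq:
  fixes \<rho> g :: "real^'n \<Rightarrow> real"
  assumes "\<rho> \<in> borel_measurable borel" "\<And>x. 0 < \<rho> x" "g \<in> borel_measurable borel"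
  shows "exp_measure g (density lborel (\<lambda>x. ennreal (\<rho> x))) = density lborel (\<lambda>x. ennreal (exp (g x) * \<rho> x))"
proof -
  have "measure_support (density lborel (\<lambda>x. ennreal (\<rho> x))) = UNIV"
    unfolding measure_support_def using density_open_pos[OF assms(1,2)] by blast
  then show ?thesis
    unfolding exp_measure_def using assms
    by (simp add: density_density_eq ennreal_mult less_imp_le mult.commute)
qed

theorem corollary1p2:
  fixes P :: "(real^'n) set"
    and \<mu>\<^sub>0 :: "(real^'n) measure"
    and \<phi>\<^sub>0 \<rho>\<^sub>0 :: "real^'n \<Rightarrow> real"
    and \<beta> :: real
    and N :: "nat \<Rightarrow> nat"
    and p :: "nat \<Rightarrow> nat \<Rightarrow> real^'n"
  assumes "compact P" and "convex P" and "interior P \<noteq> {}"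
    and "emeasure lborel P = 1"
    and "weighted_measure P \<mu>\<^sub>0 \<phi>\<^sub>0"
    and "0 < \<beta>"
    and "\<rho>\<^sub>0 \<in> borel_measurable borel" and "\<And>x. 0 < \<rho>\<^sub>0 x"
    and "\<mu>\<^sub>0 = density lborel (\<lambda>x. ennreal (\<rho>\<^sub>0 x))"
    and "\<And>k. 0 < k \<Longrightarrow> N k = card (lattice_points k P)"
    and "\<And>k. 0 < k \<Longrightarrow> bij_betw (p k) {1..N k} (lattice_points k P)"
  shows "(\<forall>k>0. 0 < N k \<longrightarrow>
            (\<forall>x. \<exists>g\<in>P. GDERIV (phi_N \<beta> \<mu>\<^sub>0 \<phi>\<^sub>0 k (N k) (p k)) x :> g)) \<and>
         (\<exists>!\<phi>. solves_second_bvp P \<beta> \<mu>\<^sub>0 \<phi>\<^sub>0 \<phi>) \<and>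
         (\<forall>\<phi>. solves_second_bvp P \<beta> \<mu>\<^sub>0 \<phi>\<^sub>0 \<phi> \<longrightarrow>
            locally_uniform_limit (\<lambda>k. phi_N \<beta> \<mu>\<^sub>0 \<phi>\<^sub>0 k (N k) (p k)) \<phi> sequentially)"
proof -
  have supp: "measure_support \<mu>\<^sub>0 = UNIV"
    unfolding measure_support_def assms(9) using density_open_pos[OF assms(7,8)] by blast
  then have cont: "continuous_on UNIV \<phi>\<^sub>0" using assms(5) by (simp add: weighted_measure_def)
  have [measurable]: "\<phi>\<^sub>0 \<in> borel_measurable borel" by (rule borel_measurable_continuous_onI[OF cont])
  have "P \<noteq> {}" using assms(3) interior_subset by blast
  then have [measurable]: "support_fun P \<in> borel_measurable borel"
    by (intro borel_measurable_continuous_onI PLip_continuous[of P] PLip_support_fun assms(1))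
  note em = exp_measure_eq[OF assms(7,8), folded assms(9)]
  define r where "r x = exp (- \<beta> * \<phi>\<^sub>0 x) * \<rho>\<^sub>0 x" for x
  have [measurable]: "r \<in> borel_measurable borel" using assms(7) unfolding r_def by measurable
  have "emeasure (exp_measure (\<lambda>x. \<beta> * (support_fun P x - \<phi>\<^sub>0 x)) \<mu>\<^sub>0) UNIV < \<infinity>"
    using assms(5,6) by (simp add: weighted_measure_def)
  moreover have "exp (\<beta> * (support_fun P x - \<phi>\<^sub>0 x)) * \<rho>\<^sub>0 x = exp (\<beta> * support_fun P x) * r x" for x
    by (simp add: r_def exp_add[symmetric] right_diff_distrib mult.assoc[symmetric])
  ultimately have fin: "(\<integral>\<^sup>+x. ennreal (exp (\<beta> * support_fun P x) * r x) \<partial>lborel) < \<infinity>"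
    using assms(7) by (subst (asm) em) (auto simp: emeasure_density)
  interpret gibbs_sequence P \<beta> r N p
    using assms(1-4,6-8,10,11) fin by unfold_locales (auto simp: r_def)
  have nu: "exp_measure (\<lambda>x. - \<beta> * \<phi>\<^sub>0 x) \<mu>\<^sub>0 = \<nu>"
    by (subst em) (simp_all add: \<nu>_def r_def)
  have wt: "exp_measure (\<lambda>x. \<beta> * (\<phi> x - \<phi>\<^sub>0 x)) \<mu>\<^sub>0 = wt \<phi>" if "convex_on UNIV \<phi>" for \<phi>
  proof -
    have [measurable]: "\<phi> \<in> borel_measurable borel"
      using that by (intro borel_measurable_continuous_onI convex_on_continuous) auto
    have "exp (\<beta> * (\<phi> x - \<phi>\<^sub>0 x)) * \<rho>\<^sub>0 x = r x * exp (\<beta> * \<phi> x)" for x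
      by (simp add: r_def exp_add[symmetric] right_diff_distrib mult.assoc[symmetric] mult.commute[of _ "exp (\<beta> * \<phi> x)"])
    then show ?thesis
      using r_pos by (subst em) (simp_all add: wt_def \<nu>_def density_density_eq ennreal_mult less_imp_le)
  qed
  have solves: "solves_second_bvp P \<beta> \<mu>\<^sub>0 \<phi>\<^sub>0 \<phi> \<longleftrightarrow> is_solution \<phi>" for \<phi>
    unfolding solves_second_bvp_def is_solution_def using wt by auto
  have phi: "phi_N \<beta> \<mu>\<^sub>0 \<phi>\<^sub>0 k (N k) (p k) = phiN k (N k) (p k)" for k
  proof
    fix x
    have "partition_fun \<beta> \<mu>\<^sub>0 \<phi>\<^sub>0 k (N k) (p k) = ZN k (N k) (p k)"
      by (simp only: partition_fun_def nu ZN_def)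
    then show "phi_N \<beta> \<mu>\<^sub>0 \<phi>\<^sub>0 k (N k) (p k) x = phiN k (N k) (p k) x"
      unfolding phi_N_def nu phiN_def by simp
  qed
  obtain \<psi> where \<psi>: "normalized \<psi>" "J \<psi> < \<infinity>" "\<And>\<psi>'. normalized \<psi>' \<Longrightarrow> J \<psi> \<le> J \<psi>'"
    using minimiser_exists by blast
  have sol: "is_solution \<psi>" by (rule minimiser_solution[OF \<psi>])
  have uniq: "\<phi> = \<psi>" if "is_solution \<phi>" for \<phi>
    using solution_le[OF that sol] solution_le[OF sol that] by (intro ext antisym)
  have "locally_uniform_limit (\<lambda>k. phiN k (N k) (p k)) \<psi> sequentially"
    unfolding locally_uniform_limit_def
  proof
    fix x :: "real^'n"
    have "uniform_limit (ball 0 (norm x + 1)) (\<lambda>k. phiN k (N k) (p k)) \<psi> sequentially"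
      unfolding uniform_limit_iff
    proof (intro allI impI)
      fix e :: real assume "0 < e"
      then have "eventually (\<lambda>k. \<forall>z\<in>cball 0 (norm x + 1). \<bar>phiN k (N k) (p k) z - \<psi> z\<bar> \<le> e / 2) sequentially"
        by (intro phiN_converges[OF sol \<psi>(1,2)]) simp
      then show "\<forall>\<^sub>F k in sequentially. \<forall>z\<in>ball 0 (norm x + 1). dist (phiN k (N k) (p k) z) (\<psi> z) < e"
      proof (rule eventually_mono, intro ballI)
        fix k and z :: "real^'n"
        assume "\<forall>z\<in>cball 0 (norm x + 1). \<bar>phiN k (N k) (p k) z - \<psi> z\<bar> \<le> e / 2" "z \<in> ball 0 (norm x + 1)"
        then have "\<bar>phiN k (N k) (p k) z - \<psi> z\<bar> \<le> e / 2" by simp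
        then show "dist (phiN k (N k) (p k) z) (\<psi> z) < e" using \<open>0 < e\<close> by (simp add: dist_real_def)
      qed
    qed
    then show "\<exists>U. open U \<and> x \<in> U \<and> uniform_limit U (\<lambda>k. phiN k (N k) (p k)) \<psi> sequentially"
      by (intro exI[of _ "ball 0 (norm x + 1)"]) auto
  qed
  moreover have "\<exists>g\<in>P. GDERIV (phiN k (N k) (p k)) x :> g" if "0 < k" "0 < N k" for k x
  proof -
    interpret gibbs P \<beta> r k "N k" "p k" by (rule gibbs_k[OF that])
    have "phi = phiN k (N k) (p k)"
      by (simp add: phi_def phiN_def Fm_def Z_def ZN_def s_def fun_eq_iff)
    then show ?thesis using GDERIV_phi by simp
  qed
  ultimately show ?thesis
    unfolding solves phi using sol uniq by blast
qed

end
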